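(* Let $\Omega\subset\mathbb{R}^d$ ($d\ge 1$) be a bounded domain with $C^2$ boundary $\partial\Omega$, let $T>0$, let $\omega_1,\omega_2\subseteq\Omega$ be nonempty open subsets with $\omega_1\cap\omega_2=\emptyset$, let $a\in L^\infty(\Omega\times(0,T))$, $y_0\in L^2(\Omega)$, let $y_1,y_2\in L^2(\Omega)$ with $y_1\neq y_2$, and let $M_1,M_2>0$. With the admissible control sets $\mathcal{U}_1,\mathcal{U}_2$ and the functionals $J_1,J_2$ defined in the context, there exists a pair $(u_1^*,u_2^* )\in\mathcal{U}_1\times\mathcal{U}_2$ such that $$J_1(u_1^*,u_2^* )\le J_1(u_1,u_2^* )\quad\text{for all } u_1\in\mathcal{U}_1$$ and $$J_2(u_1^*,u_2^* )\le J_2(u_1^*,u_2)\quad\text{for all } u_2\in\mathcal{U}_2,$$ i.e. the game problem admits a Nash equilibrium.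
   Context: For $u_1,u_2\in L^2(0,T;L^2(\Omega))$, let $y(\cdot;u_1,u_2)\in C([0,T];L^2(\Omega))$ denote the unique solution of the linear heat equation $$\begin{cases}\partial_t y-\Delta y+a(x,t)y=\chi_{\omega_1}u_1+\chi_{\omega_2}u_2 & \text{in }\Omega\times(0,T),\\ y=0 & \text{on }\partial\Omega\times(0,T),\\ y(0)=y_0 & \text{in }\Omega,\end{cases}$$ where $\chi_{\omega_i}$ is the characteristic function of $\omega_i$. For $i=1,2$ the admissible control set is $$\mathcal{U}_i=\{u\in L^\infty(0,T;L^2(\Omega)):\ \|u(t)\|_{L^2(\Omega)}\le M_i\ \text{for a.e. } t\in(0,T)\},$$ and the functional $J_i:(L^2(0,T;L^2(\Omega)))^2\to[0,+\infty)$ is $$J_i(u_1,u_2)=\|y(T;u_1,u_2)-y_i\|_{L^2(\Omega)}.$$ A pair $(u_1^*,u_2^* )\in\mathcal{U}_1\times\mathcal{U}_2$ is called a Nash equilibrium if $J_1(u_1^*,u_2^* )\le J_1(u_1,u_2^* )$ for all $u_1\in\mathcal{U}_1$ and $J_2(u_1^*,u_2^* )\le J_2(u_1^*,u_2)$ for all $u_2\in\mathcal{U}_2$. *)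

theory Defs
  imports "HOL-Analysis.Analysis"
begin

text \<open>Elements of Lebesgue spaces are represented by Borel measurable functions; every class of
  Lebesgue measurable functions modulo null sets contains one. Equality in such a space is
  therefore equality almost everywhere.
  Euclidean space is an arbitrary type of class \<^class>\<open>euclidean_space\<close>, whose dimension is at
  least 1. Functions on the space-time cylinder are curried, time first.\<close>

abbreviation borel_on :: "'a::euclidean_space set \<Rightarrow> 'a measure" where
  "borel_on S \<equiv> restrict_space lborel S"

abbreviation cylinder :: "real \<Rightarrow> 'a::euclidean_space set \<Rightarrow> (real \<times> 'a) measure" where
  "cylinder T \<Omega> \<equiv> borel_on {0<..<T} \<Otimes>\<^sub>M borel_on \<Omega>"

definition L2 :: "'a measure \<Rightarrow> ('a \<Rightarrow> 'b::euclidean_space) set" where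
  "L2 M = {f \<in> borel_measurable M. integrable M (\<lambda>x. (norm (f x))\<^sup>2)}"

definition L2_norm :: "'a measure \<Rightarrow> ('a \<Rightarrow> 'b::euclidean_space) \<Rightarrow> real" where
  "L2_norm M f = sqrt (\<integral>x. (norm (f x))\<^sup>2 \<partial>M)"

definition Linf :: "'a measure \<Rightarrow> ('a \<Rightarrow> real) set" where
  "Linf M = {f \<in> borel_measurable M. \<exists>C. AE x in M. \<bar>f x\<bar> \<le> C}"

primrec C_k :: "nat \<Rightarrow> ('a::euclidean_space \<Rightarrow> real) \<Rightarrow> bool" where
  "C_k 0 f \<longleftrightarrow> continuous_on UNIV f"
| "C_k (Suc k) f \<longleftrightarrow> (\<forall>x. f differentiable at x) \<and>
     (\<forall>i\<in>Basis. C_k k (\<lambda>x. frechet_derivative f (at x) i))"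

definition grad :: "('a::euclidean_space \<Rightarrow> real) \<Rightarrow> 'a \<Rightarrow> 'a" where
  "grad f x = (\<Sum>i\<in>Basis. frechet_derivative f (at x) i *\<^sub>R i)"

text \<open>Near each boundary point, after a rotation of the coordinate axes taking the last one to
  \<open>e\<close>, the set is the part above the graph of a \<open>C\<^sup>2\<close> function \<open>\<gamma>\<close> of the remaining coordinates,
  i.e. of the orthogonal projection \<open>x - (x \<bullet> e) *\<^sub>R e\<close>.\<close>

definition C2_boundary :: "'a::euclidean_space set \<Rightarrow> bool" where
  "C2_boundary \<Omega> \<longleftrightarrow> (\<forall>p\<in>frontier \<Omega>. \<exists>r>0. \<exists>e \<gamma>. norm e = 1 \<and> C_k 2 \<gamma> \<and>
     (\<forall>x\<in>ball p r. x \<in> \<Omega> \<longleftrightarrow> x \<bullet> e > \<gamma> (x - (x \<bullet> e) *\<^sub>R e)))"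

definition test_fun :: "'a::euclidean_space set \<Rightarrow> ('a \<Rightarrow> real) set" where
  "test_fun \<Omega> = {\<phi>. (\<forall>k. C_k k \<phi>) \<and> compact (closure {x. \<phi> x \<noteq> 0}) \<and> closure {x. \<phi> x \<noteq> 0} \<subseteq> \<Omega>}"

text \<open>\<open>v\<close> belongs to \<open>H\<^sup>1\<^sub>0(\<Omega>)\<close>, the closure of the test functions in \<open>H\<^sup>1(\<Omega>)\<close>, and \<open>g\<close> is its weak
  gradient (an \<open>L\<^sup>2\<close> limit of gradients is the weak gradient of the \<open>L\<^sup>2\<close> limit).\<close>

definition H10_with_grad :: "'a::euclidean_space set \<Rightarrow> ('a \<Rightarrow> real) \<Rightarrow> ('a \<Rightarrow> 'a) \<Rightarrow> bool" where
  "H10_with_grad \<Omega> v g \<longleftrightarrow> v \<in> L2 (borel_on \<Omega>) \<and> g \<in> L2 (borel_on \<Omega>) \<and>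
     (\<exists>\<phi>::nat \<Rightarrow> 'a \<Rightarrow> real. (\<forall>n. \<phi> n \<in> test_fun \<Omega>) \<and>
        (\<lambda>n. L2_norm (borel_on \<Omega>) (\<lambda>x. \<phi> n x - v x)) \<longlonglongrightarrow> 0 \<and>
        (\<lambda>n. L2_norm (borel_on \<Omega>) (\<lambda>x. grad (\<phi> n) x - g x)) \<longlonglongrightarrow> 0)"

definition C_L2 :: "real \<Rightarrow> 'a::euclidean_space set \<Rightarrow> (real \<Rightarrow> 'a \<Rightarrow> real) set" where
  "C_L2 T \<Omega> = {y. (\<forall>t\<in>{0..T}. y t \<in> L2 (borel_on \<Omega>)) \<and>
     (\<forall>t\<in>{0..T}. ((\<lambda>s. L2_norm (borel_on \<Omega>) (\<lambda>x. y s x - y t x)) \<longlongrightarrow> 0) (at t within {0..T}))}"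

text \<open>Weak solutions, in \<open>C([0,T]; L\<^sup>2(\<Omega>)) \<inter> L\<^sup>2(0,T; H\<^sup>1\<^sub>0(\<Omega>))\<close>, of
  \<open>\<partial>\<^sub>t y - \<Delta> y + a y = f\<close>, \<open>y = 0\<close> on the lateral boundary, \<open>y(0) = y0\<close>. The identity
  \<open>d/dt \<langle>y, \<phi>\<rangle> + \<langle>\<nabla>y, \<nabla>\<phi>\<rangle> + \<langle>a y, \<phi>\<rangle> = \<langle>f, \<phi>\<rangle>\<close> on \<open>(0,T)\<close> is stated integrated over \<open>(0,t)\<close>;
  \<open>G\<close> is the spatial gradient of \<open>y\<close>.\<close>

definition heat_solution ::
  "real \<Rightarrow> 'a::euclidean_space set \<Rightarrow> (real \<Rightarrow> 'a \<Rightarrow> real) \<Rightarrow> (real \<Rightarrow> 'a \<Rightarrow> real) \<Rightarrow>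
   ('a \<Rightarrow> real) \<Rightarrow> (real \<Rightarrow> 'a \<Rightarrow> real) \<Rightarrow> bool" where
  "heat_solution T \<Omega> a f y0 y \<longleftrightarrow>
     y \<in> C_L2 T \<Omega> \<and> case_prod y \<in> borel_measurable (cylinder T \<Omega>) \<and>
     (AE x in borel_on \<Omega>. y 0 x = y0 x) \<and>
     (\<exists>G :: real \<Rightarrow> 'a \<Rightarrow> 'a. case_prod G \<in> L2 (cylinder T \<Omega>) \<and>
        (AE t in borel_on {0<..<T}. H10_with_grad \<Omega> (y t) (G t)) \<and>
        (\<forall>\<phi>\<in>test_fun \<Omega>. \<forall>t\<in>{0..T}.
           (\<integral>x. y t x * \<phi> x \<partial>borel_on \<Omega>) +
           (\<integral>s. (\<integral>x. G s x \<bullet> grad \<phi> x + a s x * y s x * \<phi> x \<partial>borel_on \<Omega>) \<partial>borel_on {0<..<t}) =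
           (\<integral>x. y0 x * \<phi> x \<partial>borel_on \<Omega>) +
           (\<integral>s. (\<integral>x. f s x * \<phi> x \<partial>borel_on \<Omega>) \<partial>borel_on {0<..<t})))"

text \<open>The solution is unique only as a curve of \<open>L\<^sup>2(\<Omega>)\<close> classes; \<open>SOME\<close> picks representatives.\<close>

definition heat_state ::
  "real \<Rightarrow> 'a::euclidean_space set \<Rightarrow> 'a set \<Rightarrow> 'a set \<Rightarrow> (real \<Rightarrow> 'a \<Rightarrow> real) \<Rightarrow> ('a \<Rightarrow> real) \<Rightarrow>
   (real \<Rightarrow> 'a \<Rightarrow> real) \<Rightarrow> (real \<Rightarrow> 'a \<Rightarrow> real) \<Rightarrow> real \<Rightarrow> 'a \<Rightarrow> real" where
  "heat_state T \<Omega> \<omega>1 \<omega>2 a y0 u1 u2 =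
     (SOME y. heat_solution T \<Omega> a
        (\<lambda>t x. indicator \<omega>1 x * u1 t x + indicator \<omega>2 x * u2 t x) y0 y)"

text \<open>\<open>L\<^sup>\<infinity>(0,T; L\<^sup>2(\<Omega>))\<close>\<close>

definition Linf_L2 :: "real \<Rightarrow> 'a::euclidean_space set \<Rightarrow> (real \<Rightarrow> 'a \<Rightarrow> real) set" where
  "Linf_L2 T \<Omega> = {u. case_prod u \<in> borel_measurable (cylinder T \<Omega>) \<and>
     (AE t in borel_on {0<..<T}. u t \<in> L2 (borel_on \<Omega>)) \<and>
     (\<exists>C. AE t in borel_on {0<..<T}. L2_norm (borel_on \<Omega>) (u t) \<le> C)}"

definition admissible :: "real \<Rightarrow> 'a::euclidean_space set \<Rightarrow> real \<Rightarrow> (real \<Rightarrow> 'a \<Rightarrow> real) set" where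
  "admissible T \<Omega> M =
     {u \<in> Linf_L2 T \<Omega>. AE t in borel_on {0<..<T}. L2_norm (borel_on \<Omega>) (u t) \<le> M}"

definition cost ::
  "real \<Rightarrow> 'a::euclidean_space set \<Rightarrow> 'a set \<Rightarrow> 'a set \<Rightarrow> (real \<Rightarrow> 'a \<Rightarrow> real) \<Rightarrow> ('a \<Rightarrow> real) \<Rightarrow>
   ('a \<Rightarrow> real) \<Rightarrow> (real \<Rightarrow> 'a \<Rightarrow> real) \<Rightarrow> (real \<Rightarrow> 'a \<Rightarrow> real) \<Rightarrow> real" where
  "cost T \<Omega> \<omega>1 \<omega>2 a y0 yd u1 u2 =
     L2_norm (borel_on \<Omega>) (\<lambda>x. heat_state T \<Omega> \<omega>1 \<omega>2 a y0 u1 u2 T x - yd x)"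

end

theory Submission
  imports Defs
begin

text \<open>The solution map is affine in the controls: \<open>y(T) = z + P\<^sub>1 u\<^sub>1 + P\<^sub>2 u\<^sub>2\<close> with bounded linear \<open>P\<^sub>i\<close>.
  Hence the players minimize distances whose squares differ from twice the convex function
  \<open>\<bar>y(T)\<bar>\<^sup>2 / 2 - \<langle>P\<^sub>1 u\<^sub>1, y\<^sub>1\<rangle> - \<langle>P\<^sub>2 u\<^sub>2, y\<^sub>2\<rangle>\<close> only by terms independent of the own control: this
  is an exact potential game, and a minimizer of the potential over the closed bounded convex set of
  admissible pairs is an equilibrium. It exists without any compactness of the solution map.

  The affine structure rests on well-posedness. Let \<open>R = (1 + A)\<^sup>-\<^sup>1\<close> be the resolvent of the
  Dirichlet Laplacian. Every \<open>w\<close> in \<open>C([0,T]; L\<^sup>2)\<close> gives the explicit solution \<open>y = R W\<close>,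
  \<open>W(t) = w\<^sub>0 + \<integral>\<^sub>0\<^sup>t w\<close>, with source \<open>R w + W - R W\<close>. The sources obtained are dense, because
  \<open>w \<mapsto> R w + (1 - R) W\<close> is accretive, and the energy estimate extends solvability to their closure;
  a weighted energy estimate keeps the density when the bounded potential is added. Uniqueness follows
  from a Gronwall inequality for \<open>\<langle>R y, y\<rangle>\<close>. The test functions need not be shown to be dense in
  \<open>L\<^sup>2(\<Omega>)\<close>: if \<open>y\<^sub>0\<close> is not in their closure there are no solutions and all costs are constant.\<close>

section \<open>Closed convex sets in Hilbert spaces\<close>

text \<open>The time derivative of a weak solution lies only in a dual space, so a solution cannot
  be differentiated against itself. That space is never formed: energy identities are computed for
  the curves \<open>R W\<close>, which are differentiable in \<open>L2\<close>, and survive limits,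
  while \<open><R y, y>\<close> is controlled with test pairs \<open>(R h, D h)\<close> alone. The
  source attached to \<open>R W\<close> is dictated by \<open>(1 + A) R = 1\<close>: the time
  derivative is \<open>R w\<close>, and \<open>A R W = W - R W\<close>. In the weight
  \<open>exp (- l * s)\<close> the rate \<open>l\<close> exceeds the bound of the potential by one,
  and that unit is what remains after the potential has been absorbed. Minimizers come from nested
  bounded closed convex sets, where the parallelogram law does the work of weak compactness. All
  estimates live in Hilbert spaces of classes on the whole space, functions on the domain being
  extended by zero. Since the definitions speak of functions, two bridges are built: jointly
  measurable representatives of continuous curves, and time slices of space-time classes.\<close>

lemma nested_convex_Inter_nonempty:
  fixes C :: "nat \<Rightarrow> 'a::{real_inner,complete_space} set"
  assumes ne: "\<And>n. C n \<noteq> {}" and dec: "\<And>m n. m \<le> n \<Longrightarrow> C n \<subseteq> C m"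
    and cl: "\<And>n. closed (C n)" and cv: "\<And>n. convex (C n)" and bd: "bounded (C 0)"
  shows "(\<Inter>n. C n) \<noteq> {}"
proof -
  define e where "e n = (INF x\<in>C n. (norm x)\<^sup>2)" for n
  obtain B where B: "\<And>x. x \<in> C 0 \<Longrightarrow> norm x \<le> B"
    using bd by (auto simp: bounded_iff)
  have bb: "bdd_below ((\<lambda>x. (norm x)\<^sup>2) ` C n)" for n
    by (rule bdd_belowI2[of _ 0]) auto
  have e_le: "e n \<le> (norm x)\<^sup>2" if "x \<in> C n" for n x
    unfolding e_def by (rule cINF_lower[OF bb that])
  have e_mono: "e m \<le> e n" if "m \<le> n" for m n
    unfolding e_def by (rule cINF_superset_mono[OF ne bb dec[OF that]]) simp
  have "\<exists>x\<in>C n. (norm x)\<^sup>2 < e n + 1 / real (Suc n)" for n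
  proof -
    have "e n < e n + 1 / real (Suc n)" by simp
    thus ?thesis unfolding e_def using cINF_less_iff[OF ne bb] by blast
  qed
  then obtain x where x: "\<And>n. x n \<in> C n" "\<And>n. (norm (x n))\<^sup>2 < e n + 1 / real (Suc n)"
    by metis
  have "e n \<le> B\<^sup>2" for n
  proof -
    have "x n \<in> C 0" using x(1)[of n] dec[of 0 n] by auto
    hence "(norm (x n))\<^sup>2 \<le> B\<^sup>2" using B by (simp add: power_mono)
    thus ?thesis using e_le[OF x(1)[of n]] by simp
  qed
  then obtain L where L: "e \<longlonglongrightarrow> L"
    using e_mono by (metis incseq_convergent incseq_def)
  have eL: "e n \<le> L" for n
    by (rule incseq_le[OF _ L]) (use e_mono in \<open>auto simp: incseq_def\<close>)
  \<comment> \<open>The midpoint of \<open>x n\<close> and \<open>x m\<close> lies in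
    \<open>C n\<close>, so its squared norm is at least \<open>e n\<close>. The parallelogram
    identity then leaves only the near-minimality errors of both points and the gap
    \<open>L - e n\<close>.\<close>
  have est: "(dist (x m) (x n))\<^sup>2 \<le> 4 / real (Suc n) + 2 * (L - e n)" if "n \<le> m" for m n
  proof -
    have m: "x m \<in> C n" using x(1)[of m] dec[OF that] by auto
    define z where "z = (1/2) *\<^sub>R x n + (1/2) *\<^sub>R x m"
    have "z \<in> C n" unfolding z_def by (rule convexD[OF cv x(1) m]) auto
    hence "e n \<le> (norm z)\<^sup>2" by (rule e_le)
    moreover have "(dist (x m) (x n))\<^sup>2 = 2 * (norm (x n))\<^sup>2 + 2 * (norm (x m))\<^sup>2 - 4 * (norm z)\<^sup>2"
      unfolding z_def dist_norm power2_norm_eq_inner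
      by (simp add: inner_add_left inner_add_right inner_diff_left inner_diff_right inner_commute)
    moreover have "1 / real (Suc m) \<le> 1 / real (Suc n)" using that by (simp add: frac_le)
    moreover have "d \<le> 4 * q + 2 * (L - e n)" if "e n \<le> z2" "d = 2 * a + 2 * b - 4 * z2" "p \<le> q"
      "a < e n + q" "b < e m + p" "e m \<le> L" for a b d p q z2 :: real
      using that by argo
    ultimately show ?thesis using x(2)[of n] x(2)[of m] eL[of m] by fastforce
  qed
  have lim0: "(\<lambda>n. 4 / real (Suc n) + 2 * (L - e n)) \<longlonglongrightarrow> 0"
  proof -
    have "(\<lambda>n. 4 * inverse (real (Suc n)) + 2 * (L - e n)) \<longlonglongrightarrow> 4 * 0 + 2 * (L - L)"
      by (intro tendsto_intros LIMSEQ_inverse_real_of_nat L)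
    thus ?thesis by (simp add: divide_inverse)
  qed
  have "Cauchy x"
  proof (rule metric_CauchyI)
    fix r :: real assume r: "r > 0"
    then have "\<forall>\<^sub>F n in sequentially. 4 / real (Suc n) + 2 * (L - e n) < (r/2)\<^sup>2"
      by (intro order_tendstoD(2)[OF lim0]) auto
    then obtain N where N: "4 / real (Suc N) + 2 * (L - e N) < (r/2)\<^sup>2"
      by (auto simp: eventually_sequentially)
    have *: "dist (x m) (x N) < r/2" if "m \<ge> N" for m
      by (rule power2_less_imp_less) (use est[OF that] N r in auto)
    show "\<exists>M. \<forall>m\<ge>M. \<forall>n\<ge>M. dist (x m) (x n) < r"
      by (rule exI[of _ N]) (metis * dist_triangle_half_l)
  qed
  then obtain l where l: "x \<longlonglongrightarrow> l" by (auto simp: Cauchy_convergent_iff convergent_def)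
  have "l \<in> C n" for n
  proof (rule Lim_in_closed_set[OF cl _ _ l])
    show "\<forall>\<^sub>F k in sequentially. x k \<in> C n"
      using x(1) dec by (auto simp: eventually_sequentially intro!: exI[of _ n])
  qed simp
  thus ?thesis by blast
qed

text \<open>Continuity and convexity make the near-minimal sets \<open>K n\<close> closed and
  convex; they are nested and bounded, and any point common to all of them is a minimizer.\<close>

lemma convex_continuous_attains_inf:
  fixes C :: "'a::{real_inner,complete_space} set" and f :: "'a \<Rightarrow> real"
  assumes "C \<noteq> {}" "closed C" "convex C" "bounded C"
    and f: "continuous_on C f" "convex_on C f" and bb: "bdd_below (f ` C)"
  shows "\<exists>x\<in>C. \<forall>y\<in>C. f x \<le> f y"
proof -
  define I where "I = (INF x\<in>C. f x)"
  define K where "K n = {x\<in>C. f x \<le> I + 1 / real (Suc n)}" for n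
  have "(\<Inter>n. K n) \<noteq> {}"
  proof (rule nested_convex_Inter_nonempty)
    show "K n \<noteq> {}" for n
    proof -
      have "I < I + 1 / real (Suc n)" by simp
      then obtain x where "x \<in> C" "f x < I + 1 / real (Suc n)"
        unfolding I_def using cINF_less_iff[OF assms(1) bb] by blast
      thus ?thesis unfolding K_def by (auto intro: less_imp_le)
    qed
    show "K n \<subseteq> K m" if "m \<le> n" for m n
    proof -
      have "1 / real (Suc n) \<le> 1 / real (Suc m)" using that by (simp add: frac_le)
      thus ?thesis unfolding K_def by auto
    qed
    show "closed (K n)" for n
    proof -
      have "K n = C \<inter> f -` {.. I + 1 / real (Suc n)}" unfolding K_def by auto
      thus ?thesis using continuous_closed_preimage[OF f(1) assms(2)] by simp
    qed
    show "convex (K n)" for n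
      unfolding K_def
    proof (rule convexI, safe)
      fix x y u v assume *: "x \<in> C" "y \<in> C" "f x \<le> I + 1 / real (Suc n)" "f y \<le> I + 1 / real (Suc n)"
        "0 \<le> u" "0 \<le> v" "u + v = (1::real)"
      show "u *\<^sub>R x + v *\<^sub>R y \<in> C" by (rule convexD[OF assms(3) *(1,2,5,6,7)])
      have "f (u *\<^sub>R x + v *\<^sub>R y) \<le> u * f x + v * f y"
        using f(2) * by (auto simp: convex_on_def)
      also have "\<dots> \<le> I + 1 / real (Suc n)" by (rule convex_bound_le) (use * in auto)
      finally show "f (u *\<^sub>R x + v *\<^sub>R y) \<le> I + 1 / real (Suc n)" .
    qed
    show "bounded (K 0)" by (rule bounded_subset[OF assms(4)]) (auto simp: K_def)
  qed
  then obtain x where x: "\<And>n. x \<in> K n" by blast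
  hence "x \<in> C" unfolding K_def by auto
  moreover have "f x \<le> I"
  proof (rule LIMSEQ_le_const)
    show "(\<lambda>n. I + inverse (real (Suc n))) \<longlonglongrightarrow> I"
      using tendsto_add[OF tendsto_const[of I] LIMSEQ_inverse_real_of_nat] by simp
    show "\<exists>N. \<forall>n\<ge>N. f x \<le> I + inverse (real (Suc n))"
      using x by (auto simp: K_def divide_inverse)
  qed
  moreover have "I \<le> f y" if "y \<in> C" for y unfolding I_def by (rule cINF_lower[OF bb that])
  ultimately show ?thesis by (meson order_trans)
qed

section \<open>Orthogonal projection onto a closed subspace\<close>

definition proj :: "'a::real_inner set \<Rightarrow> 'a \<Rightarrow> 'a" where
  "proj S x = (SOME p. p \<in> S \<and> (\<forall>s\<in>S. (x - p) \<bullet> s = 0))"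

text \<open>The nearest point of \<open>S\<close> exists by minimizing the distance on a bounded
  piece of \<open>S\<close>. The ball of radius \<open>norm x\<close> around \<open>x\<close>
  contains 0, so points outside it cannot be nearer than the minimizer.\<close>

lemma proj_exists:
  fixes S :: "'a::{real_inner,complete_space} set"
  assumes S: "subspace S" "closed S"
  shows "\<exists>p. p \<in> S \<and> (\<forall>s\<in>S. (x - p) \<bullet> s = 0)"
proof -
  have "\<exists>p\<in>S \<inter> cball x (norm x). \<forall>y\<in>S \<inter> cball x (norm x). dist x p \<le> dist x y"
  proof (rule convex_continuous_attains_inf)
    show "S \<inter> cball x (norm x) \<noteq> {}" using subspace_0[OF S(1)] by (auto simp: dist_norm)
    show "closed (S \<inter> cball x (norm x))" using S(2) by auto
    show cv: "convex (S \<inter> cball x (norm x))" using subspace_imp_convex[OF S(1)] by (intro convex_Int) auto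
    show "bounded (S \<inter> cball x (norm x))" by auto
    show "continuous_on (S \<inter> cball x (norm x)) (dist x)" by (intro continuous_intros)
    show "convex_on (S \<inter> cball x (norm x)) (dist x)" by (intro convex_on_dist cv)
    show "bdd_below (dist x ` (S \<inter> cball x (norm x)))" by (rule bdd_belowI2[of _ 0]) auto
  qed
  then obtain p where p: "p \<in> S" "dist x p \<le> norm x"
    and min: "\<And>y. y \<in> S \<Longrightarrow> dist x y \<le> norm x \<Longrightarrow> dist x p \<le> dist x y" by auto
  have min': "norm (x - p) \<le> norm (x - y)" if "y \<in> S" for y
    using min[OF that] p(2) by (force simp: dist_norm)
  have "(x - p) \<bullet> s = 0" if s: "s \<in> S" for s
  proof (rule ccontr)
    assume nz: "(x - p) \<bullet> s \<noteq> 0"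
    \<comment> \<open>The best multiple of \<open>s\<close> to add to \<open>p\<close>: it lowers
      the squared distance by exactly
      \<open>((x - p) \<bullet> s)\<^sup>2 / (s \<bullet> s)\<close>, which contradicts
      minimality.\<close>
    define c where "c = (x - p) \<bullet> s / (s \<bullet> s)"
    have ss: "s \<bullet> s > 0" using nz by (metis inner_gt_zero_iff inner_zero_right)
    have "p + c *\<^sub>R s \<in> S" using p(1) s S(1) by (simp add: subspace_add subspace_scale)
    from min'[OF this] have "(norm (x - p))\<^sup>2 \<le> (norm (x - (p + c *\<^sub>R s)))\<^sup>2" by (simp add: power_mono)
    also have "\<dots> = (norm (x - p))\<^sup>2 - ((x - p) \<bullet> s)\<^sup>2 / (s \<bullet> s)"
    proof -
      have "(norm (x - (p + c *\<^sub>R s)))\<^sup>2 = (norm (x - p))\<^sup>2 - 2 * c * ((x - p) \<bullet> s) + c * c * (s \<bullet> s)"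
        unfolding power2_norm_eq_inner diff_diff_add[symmetric]
        by (simp add: inner_diff_left[of "x - p"] inner_diff_right[of _ "x - p"] inner_commute[of s "x - p"] right_diff_distrib)
      thus ?thesis using ss by (simp add: c_def power2_eq_square)
    qed
    finally have "((x - p) \<bullet> s)\<^sup>2 / (s \<bullet> s) \<le> 0" by simp
    moreover have "((x - p) \<bullet> s)\<^sup>2 / (s \<bullet> s) > 0" using nz ss by simp
    ultimately show False by simp
  qed
  with p(1) show ?thesis by blast
qed

context
  fixes S :: "'a::{real_inner,complete_space} set"
  assumes S: "subspace S" "closed S"
begin

lemma proj_in: "proj S x \<in> S" and proj_orth: "s \<in> S \<Longrightarrow> (x - proj S x) \<bullet> s = 0"
  using someI_ex[OF proj_exists[OF S, of x]] unfolding proj_def by auto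

lemma inner_proj_left: "s \<in> S \<Longrightarrow> proj S x \<bullet> s = x \<bullet> s"
  using proj_orth[of s x] by (simp add: inner_diff_left)

lemma proj_unique:
  assumes "p \<in> S" "\<And>s. s \<in> S \<Longrightarrow> p \<bullet> s = x \<bullet> s"
  shows "proj S x = p"
proof -
  have "proj S x - p \<in> S" using proj_in assms(1) S(1) by (simp add: subspace_diff)
  hence "(proj S x - p) \<bullet> (proj S x - p) = 0"
    using assms(2) inner_proj_left by (simp add: inner_diff_left)
  thus ?thesis by simp
qed

lemma proj_id: "x \<in> S \<Longrightarrow> proj S x = x"
  by (rule proj_unique) auto

lemma inner_proj_proj: "proj S x \<bullet> proj S y = proj S x \<bullet> y"
  using inner_proj_left[OF proj_in, of y x] by (simp add: inner_commute)

lemma norm_proj_le: "norm (proj S x) \<le> norm x"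
proof -
  have "(norm (proj S x))\<^sup>2 = proj S x \<bullet> x" by (simp add: power2_norm_eq_inner inner_proj_proj)
  also have "\<dots> \<le> norm (proj S x) * norm x" by (rule norm_cauchy_schwarz)
  finally show ?thesis by (cases "norm (proj S x) = 0") (auto simp: power2_eq_square)
qed

lemma bounded_linear_proj: "bounded_linear (proj S)"
proof (rule bounded_linear_intro[of _ 1])
  show "proj S (x + y) = proj S x + proj S y" for x y
    by (rule proj_unique) (use S(1) in \<open>auto simp: inner_add_left inner_proj_left proj_in subspace_add\<close>)
  show "proj S (r *\<^sub>R x) = r *\<^sub>R proj S x" for r x
    by (rule proj_unique) (use S(1) in \<open>auto simp: inner_proj_left proj_in subspace_scale\<close>)
  show "norm (proj S x) \<le> norm x * 1" for x using norm_proj_le by simp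
qed

end

section \<open>Hilbert spaces of square integrable functions\<close>

lemma L2_measurable[measurable_dest]: "f \<in> L2 M \<Longrightarrow> f \<in> borel_measurable M"
  by (simp add: L2_def)

lemma L2_integrable_inner:
  assumes "f \<in> L2 M" "g \<in> L2 M"
  shows "integrable M (\<lambda>x. f x \<bullet> g x)"
proof (rule Bochner_Integration.integrable_bound)
  show "integrable M (\<lambda>x. (norm (f x))\<^sup>2 + (norm (g x))\<^sup>2)"
    using assms by (auto simp: L2_def)
  have [measurable]: "f \<in> borel_measurable M" "g \<in> borel_measurable M" using assms by (auto simp: L2_def)
  show "(\<lambda>x. f x \<bullet> g x) \<in> borel_measurable M" by measurable
  have "norm (f x \<bullet> g x) \<le> norm ((norm (f x))\<^sup>2 + (norm (g x))\<^sup>2)" for x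
  proof -
    have "\<bar>f x \<bullet> g x\<bar> \<le> norm (f x) * norm (g x)" by (rule Cauchy_Schwarz_ineq2)
    also have "\<dots> \<le> 2 * norm (f x) * norm (g x)" by simp
    also have "\<dots> \<le> (norm (f x))\<^sup>2 + (norm (g x))\<^sup>2" by (rule sum_squares_bound)
    finally show ?thesis by simp
  qed
  thus "AE x in M. norm (f x \<bullet> g x) \<le> norm ((norm (f x))\<^sup>2 + (norm (g x))\<^sup>2)" by simp
qed

lemma L2_zero: "(\<lambda>x. 0) \<in> L2 M" by (simp add: L2_def)

lemma L2_scaleR: "f \<in> L2 M \<Longrightarrow> (\<lambda>x. c *\<^sub>R f x) \<in> L2 M"
  by (auto simp: L2_def power_mult_distrib)

lemma L2_add:
  assumes "f \<in> L2 M" "g \<in> L2 M"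
  shows "(\<lambda>x. f x + g x) \<in> L2 M"
proof -
  have "integrable M (\<lambda>x. (norm (f x))\<^sup>2 + (norm (g x))\<^sup>2 + 2 * (f x \<bullet> g x))"
    using L2_integrable_inner[OF assms] assms by (auto simp: L2_def)
  hence "integrable M (\<lambda>x. (norm (f x + g x))\<^sup>2)"
    by (rule Bochner_Integration.integrable_cong[THEN iffD1, rotated 2])
       (auto simp: power2_norm_eq_inner inner_add_left inner_add_right inner_commute)
  thus ?thesis using assms by (auto simp: L2_def)
qed

lemma L2_uminus: "f \<in> L2 M \<Longrightarrow> (\<lambda>x. - f x) \<in> L2 M"
  using L2_scaleR[of f M "-1"] by simp

lemma L2_diff: "f \<in> L2 M \<Longrightarrow> g \<in> L2 M \<Longrightarrow> (\<lambda>x. f x - g x) \<in> L2 M"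
  using L2_add[of f M "\<lambda>x. - g x"] L2_uminus[of g M] by simp

lemma L2_bounded_mult:
  assumes f: "f \<in> L2 M" and m: "m \<in> borel_measurable M" and C: "\<And>x. \<bar>m x\<bar> \<le> C"
  shows "(\<lambda>x. m x *\<^sub>R f x) \<in> L2 M"
proof -
  have [measurable]: "f \<in> borel_measurable M" using f by (auto simp: L2_def)
  note m[measurable]
  have "integrable M (\<lambda>x. (norm (m x *\<^sub>R f x))\<^sup>2)"
  proof (rule Bochner_Integration.integrable_bound)
    show "integrable M (\<lambda>x. C\<^sup>2 * (norm (f x))\<^sup>2)" using f by (auto simp: L2_def)
    have "(m x)\<^sup>2 \<le> C\<^sup>2" for x using C[of x] by (metis abs_ge_zero power_mono power2_abs)
    thus "AE x in M. norm ((norm (m x *\<^sub>R f x))\<^sup>2) \<le> norm (C\<^sup>2 * (norm (f x))\<^sup>2)"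
      by (auto simp: power_mult_distrib abs_mult intro!: mult_right_mono)
  qed measurable
  thus ?thesis unfolding L2_def by simp
qed

lemma L2_cong_AE:
  assumes "f \<in> L2 M" "g \<in> borel_measurable M" "AE x in M. f x = g x"
  shows "g \<in> L2 M"
proof -
  have [measurable]: "f \<in> borel_measurable M" using assms(1) by (auto simp: L2_def)
  note assms(2)[measurable]
  have "integrable M (\<lambda>x. (norm (g x))\<^sup>2) = integrable M (\<lambda>x. (norm (f x))\<^sup>2)"
    by (rule integrable_cong_AE) (use assms(3) in auto)
  thus ?thesis using assms by (auto simp: L2_def)
qed

lemma L2_integral_cong_AE:
  assumes "f \<in> L2 M" "g \<in> L2 M" "f' \<in> L2 M" "g' \<in> L2 M"
    and "AE x in M. f x = f' x" "AE x in M. g x = g' x"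
  shows "(\<integral>x. f x \<bullet> g x \<partial>M) = (\<integral>x. f' x \<bullet> g' x \<partial>M)"
proof -
  have [measurable]: "f \<in> borel_measurable M" "g \<in> borel_measurable M"
    "f' \<in> borel_measurable M" "g' \<in> borel_measurable M" using assms by (auto simp: L2_def)
  show ?thesis by (rule integral_cong_AE) (use assms(5,6) in auto)
qed

\<comment> \<open>The measure is always Lebesgue measure on the whole space. Functions on the domain
  or on the cylinder enter through extension by zero, so the type does not depend on a set and one
  completeness proof serves for states, gradients and space-time functions.\<close>
quotient_type (overloaded) ('a, 'b) l2 = "'a::euclidean_space \<Rightarrow> 'b::euclidean_space" / partial:
  "\<lambda>f g. f \<in> L2 lborel \<and> g \<in> L2 lborel \<and> (AE x in lborel. f x = g x)"
proof (rule part_equivpI)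
  show "\<exists>f::'a \<Rightarrow> 'b. f \<in> L2 lborel \<and> f \<in> L2 lborel \<and> (AE x in lborel. f x = f x)"
    by (rule exI[of _ "\<lambda>_. 0"]) (simp add: L2_zero)
  show "symp (\<lambda>f (g::'a \<Rightarrow> 'b). f \<in> L2 lborel \<and> g \<in> L2 lborel \<and> (AE x in lborel. f x = g x))"
    by (rule sympI) auto
  show "transp (\<lambda>f (g::'a \<Rightarrow> 'b). f \<in> L2 lborel \<and> g \<in> L2 lborel \<and> (AE x in lborel. f x = g x))"
    by (rule transpI) auto
qed

instantiation l2 :: (euclidean_space, euclidean_space) real_vector
begin

lift_definition zero_l2 :: "('a, 'b) l2" is "\<lambda>_. 0" by (simp add: L2_zero)
lift_definition plus_l2 :: "('a, 'b) l2 \<Rightarrow> ('a, 'b) l2 \<Rightarrow> ('a, 'b) l2"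
  is "\<lambda>f g x. f x + g x" by (auto simp: L2_add elim: eventually_elim2)
lift_definition uminus_l2 :: "('a, 'b) l2 \<Rightarrow> ('a, 'b) l2"
  is "\<lambda>f x. - f x" by (auto simp: L2_uminus elim: eventually_mono)
lift_definition minus_l2 :: "('a, 'b) l2 \<Rightarrow> ('a, 'b) l2 \<Rightarrow> ('a, 'b) l2"
  is "\<lambda>f g x. f x - g x" by (auto simp: L2_diff elim: eventually_elim2)
lift_definition scaleR_l2 :: "real \<Rightarrow> ('a, 'b) l2 \<Rightarrow> ('a, 'b) l2"
  is "\<lambda>c f x. c *\<^sub>R f x" by (auto simp: L2_scaleR elim: eventually_mono)

instance
  by standard (transfer; auto simp: algebra_simps L2_add L2_scaleR L2_zero L2_diff L2_uminus)+

end

instantiation l2 :: (euclidean_space, euclidean_space) real_inner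
begin

lift_definition inner_l2 :: "('a, 'b) l2 \<Rightarrow> ('a, 'b) l2 \<Rightarrow> real"
  is "\<lambda>f g. \<integral>x. f x \<bullet> g x \<partial>lborel"
  by (intro L2_integral_cong_AE) auto

definition norm_l2 :: "('a, 'b) l2 \<Rightarrow> real" where "norm_l2 x = sqrt (x \<bullet> x)"
definition sgn_l2 :: "('a, 'b) l2 \<Rightarrow> ('a, 'b) l2" where "sgn_l2 x = x /\<^sub>R norm x"
definition dist_l2 :: "('a, 'b) l2 \<Rightarrow> ('a, 'b) l2 \<Rightarrow> real" where "dist_l2 x y = norm (x - y)"
definition uniformity_l2 :: "(('a, 'b) l2 \<times> ('a, 'b) l2) filter" where
  "uniformity_l2 = (INF e\<in>{0<..}. principal {(x, y). dist x y < e})"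
definition open_l2 :: "('a, 'b) l2 set \<Rightarrow> bool" where
  "open_l2 U \<longleftrightarrow> (\<forall>x\<in>U. eventually (\<lambda>(x', y). x' = x \<longrightarrow> y \<in> U) uniformity)"

instance
proof
  fix x y z :: "('a, 'b) l2" and r :: real and U :: "('a, 'b) l2 set"
  show "dist x y = norm (x - y)" by (rule dist_l2_def)
  show "sgn x = x /\<^sub>R norm x" by (rule sgn_l2_def)
  show "uniformity = (INF e\<in>{0<..}. principal {(x, y). dist x (y::('a, 'b) l2) < e})"
    by (rule uniformity_l2_def)
  show "open U = (\<forall>x\<in>U. \<forall>\<^sub>F (x', y) in uniformity. x' = x \<longrightarrow> y \<in> U)" by (rule open_l2_def)
  show "x \<bullet> y = y \<bullet> x" by transfer (simp add: inner_commute)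
  show "(x + y) \<bullet> z = x \<bullet> z + y \<bullet> z"
    by transfer (simp add: inner_add_left L2_integrable_inner)
  show "(r *\<^sub>R x) \<bullet> y = r * (x \<bullet> y)" by transfer simp
  show "0 \<le> x \<bullet> x" by transfer simp
  show "(x \<bullet> x = 0) = (x = 0)"
  proof transfer
    fix f :: "'a \<Rightarrow> 'b" assume "f \<in> L2 lborel \<and> f \<in> L2 lborel \<and> (AE x in lborel. f x = f x)"
    hence f: "f \<in> L2 lborel" by simp
    have "(\<integral>x. f x \<bullet> f x \<partial>lborel) = 0 \<longleftrightarrow> (AE x in lborel. f x \<bullet> f x = 0)"
      by (rule integral_nonneg_eq_0_iff_AE) (auto intro: L2_integrable_inner f)
    thus "((\<integral>x. f x \<bullet> f x \<partial>lborel) = 0) =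
        (f \<in> L2 lborel \<and> (\<lambda>_. 0::'b) \<in> L2 lborel \<and> (AE x in lborel. f x = 0))"
      using f L2_zero by auto
  qed
  show "norm x = sqrt (x \<bullet> x)" by (rule norm_l2_def)
qed

end

definition cls :: "('a::euclidean_space \<Rightarrow> 'b::euclidean_space) \<Rightarrow> ('a, 'b) l2" where "cls = abs_l2"
definition rep :: "('a::euclidean_space, 'b::euclidean_space) l2 \<Rightarrow> 'a \<Rightarrow> 'b" where "rep = rep_l2"

lemma rep_L2: "rep X \<in> L2 lborel" and cls_rep[simp]: "cls (rep X) = X"
  using Quotient_l2 unfolding cls_def rep_def Quotient_def by metis+

lemma rep_measurable[measurable]: "rep X \<in> borel_measurable borel"
  using rep_L2[of X] by (simp add: L2_def)

lemma cls_eq_iff: "f \<in> L2 lborel \<Longrightarrow> g \<in> L2 lborel \<Longrightarrow> cls f = cls g \<longleftrightarrow> (AE x in lborel. f x = g x)"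
  using Quotient_l2 unfolding cls_def Quotient_def by (smt (verit) eventually_mono AE_cong)

lemma rep_cls: "f \<in> L2 lborel \<Longrightarrow> AE x in lborel. rep (cls f) x = f x"
  using cls_eq_iff[OF rep_L2] by force

lemma cls_zero: "cls (\<lambda>_. 0) = 0"
  unfolding cls_def zero_l2_def by simp

lemma cls_add: "f \<in> L2 lborel \<Longrightarrow> g \<in> L2 lborel \<Longrightarrow> cls (\<lambda>x. f x + g x) = cls f + cls g"
  unfolding cls_def by (subst plus_l2.abs_eq) auto

lemma cls_diff: "f \<in> L2 lborel \<Longrightarrow> g \<in> L2 lborel \<Longrightarrow> cls (\<lambda>x. f x - g x) = cls f - cls g"
  unfolding cls_def by (subst minus_l2.abs_eq) auto

lemma cls_scaleR: "f \<in> L2 lborel \<Longrightarrow> cls (\<lambda>x. c *\<^sub>R f x) = c *\<^sub>R cls f"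
  unfolding cls_def by (subst scaleR_l2.abs_eq) auto

lemma inner_cls: "f \<in> L2 lborel \<Longrightarrow> g \<in> L2 lborel \<Longrightarrow> cls f \<bullet> cls g = (\<integral>x. f x \<bullet> g x \<partial>lborel)"
  unfolding cls_def by (subst inner_l2.abs_eq) auto

lemma norm_cls: "f \<in> L2 lborel \<Longrightarrow> (norm (cls f))\<^sup>2 = (\<integral>x. (norm (f x))\<^sup>2 \<partial>lborel)"
  by (simp add: power2_norm_eq_inner inner_cls)

lemma nn_integral_cls:
  "f \<in> L2 lborel \<Longrightarrow> (\<integral>\<^sup>+x. ennreal ((norm (f x))\<^sup>2) \<partial>lborel) = ennreal ((norm (cls f))\<^sup>2)"
  by (subst nn_integral_eq_integral) (auto simp: L2_def norm_cls)

lemma L2_nn_integralI: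
  assumes "f \<in> borel_measurable M" "(\<integral>\<^sup>+x. ennreal ((norm (f x))\<^sup>2) \<partial>M) < \<infinity>"
  shows "f \<in> L2 M"
  using assms unfolding L2_def by (auto intro!: integrableI_bounded)

section \<open>Completeness by rapidly converging subsequences\<close>

lemma fast_Cauchy_norm_le:
  fixes X :: "nat \<Rightarrow> 'a::real_normed_vector"
  assumes "\<And>n. norm (X (Suc n) - X n) \<le> (1/2)^n"
  shows "norm (X (n + k) - X n) \<le> 2 * (1/2)^n - 2 * (1/2)^(n + k)"
proof (induction k)
  case (Suc k)
  have "norm (X (n + Suc k) - X n) \<le> norm (X (Suc (n + k)) - X (n + k)) + norm (X (n + k) - X n)"
    using norm_triangle_ineq[of "X (Suc (n + k)) - X (n + k)" "X (n + k) - X n"] by simp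
  \<comment> \<open>The geometric tail subtracted in the claim is what absorbs the new increment;
    without it the induction would not close.\<close>
  also have "\<dots> \<le> (1/2)^(n + k) + (2 * (1/2)^n - 2 * (1/2)^(n + k))"
    using assms[of "n + k"] Suc by linarith
  finally show ?case by simp
qed simp

lemma fast_Cauchy_norm_le':
  fixes X :: "nat \<Rightarrow> 'a::real_normed_vector"
  assumes "\<And>n. norm (X (Suc n) - X n) \<le> (1/2)^n" and "n \<le> m"
  shows "norm (X m - X n) \<le> 2 * (1/2)^n"
proof -
  have "norm (X (n + (m - n)) - X n) \<le> 2 * (1/2)^n - 2 * (1/2)^(n + (m - n))"
    by (rule fast_Cauchy_norm_le[OF assms(1)])
  also have "\<dots> \<le> 2 * (1/2)^n" by simp
  finally show ?thesis using assms(2) by simp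
qed

text \<open>The default 0 at points of divergence keeps the limit measurable. Being defined
  pointwise, \<open>plim\<close> commutes with taking time sections, which is how limits of
  functions of \<open>(t, x)\<close> are compared with limits at a fixed \<open>t\<close>.\<close>

definition plim :: "(nat \<Rightarrow> 'a \<Rightarrow> 'b::euclidean_space) \<Rightarrow> 'a \<Rightarrow> 'b" where
  "plim F x = (if convergent (\<lambda>n. F n x) then lim (\<lambda>n. F n x) else 0)"

lemma plim_LIMSEQ: "convergent (\<lambda>n. F n x) \<Longrightarrow> (\<lambda>n. F n x) \<longlonglongrightarrow> plim F x"
  by (simp add: plim_def convergent_LIMSEQ_iff)

lemma plim_eq: "(\<lambda>n. F n x) \<longlonglongrightarrow> l \<Longrightarrow> plim F x = l"
  by (auto simp: plim_def limI convergent_def)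

lemma borel_measurable_plim:
  fixes F :: "nat \<Rightarrow> 'a \<Rightarrow> 'b::euclidean_space"
  assumes [measurable]: "\<And>n. F n \<in> borel_measurable M"
  shows "plim F \<in> borel_measurable M"
proof -
  have "{x \<in> space M. convergent (\<lambda>n. F n x)} \<in> sets M"
    unfolding Cauchy_convergent_iff[symmetric] by measurable
  moreover have "(\<lambda>x. lim (\<lambda>n. F n x)) \<in> borel_measurable M" by measurable
  ultimately show ?thesis unfolding plim_def by (intro measurable_If) auto
qed

text \<open>The sum of \<open>2 ^ n * \<bar>F (n + 1) - F n\<bar>\<^sup>2\<close> has finite integral, so almost everywhere the
  increments decay geometrically.\<close>

lemma fast_Cauchy_AE_convergent:
  fixes F :: "nat \<Rightarrow> 'a::euclidean_space \<Rightarrow> 'b::euclidean_space"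
  assumes F: "\<And>n. F n \<in> L2 lborel"
    and fast: "\<And>n. norm (cls (F (Suc n)) - cls (F n)) \<le> (1/2)^n"
  shows "AE x in lborel. convergent (\<lambda>n. F n x)"
proof -
  have [measurable]: "F n \<in> borel_measurable lborel" for n using F by (rule L2_measurable)
  define d where "d n x = norm (F (Suc n) x - F n x)" for n x
  have [measurable]: "d n \<in> borel_measurable lborel" for n unfolding d_def by measurable
  have "(\<integral>\<^sup>+x. (\<Sum>n. ennreal (2^n * (d n x)\<^sup>2)) \<partial>lborel) = (\<Sum>n. \<integral>\<^sup>+x. ennreal (2^n * (d n x)\<^sup>2) \<partial>lborel)"
    by (rule nn_integral_suminf) measurable
  \<comment> \<open>A squared increment has integral at most \<open>(1/4)^n\<close>, so the weight
    \<open>2^n\<close> still leaves a convergent geometric series.\<close>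
  also have "\<dots> \<le> (\<Sum>n. ennreal ((1/2)^n))"
  proof (rule suminf_le)
    fix n
    have "(\<integral>\<^sup>+x. ennreal (2^n * (d n x)\<^sup>2) \<partial>lborel) = ennreal (2^n) * (\<integral>\<^sup>+x. ennreal ((d n x)\<^sup>2) \<partial>lborel)"
      by (subst nn_integral_cmult[symmetric]) (auto simp: ennreal_mult)
    also have "(\<integral>\<^sup>+x. ennreal ((d n x)\<^sup>2) \<partial>lborel) = ennreal ((norm (cls (F (Suc n)) - cls (F n)))\<^sup>2)"
      unfolding d_def using nn_integral_cls[OF L2_diff[OF F F]] by (simp add: cls_diff F)
    also have "\<dots> \<le> ennreal (((1/2)^n)\<^sup>2)"
      using fast[of n] by (intro ennreal_leI power_mono) auto
    also have "ennreal (2^n) * ennreal (((1/2)^n)\<^sup>2) = ennreal ((1/2)^n)"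
    proof -
      have "2^n * ((1/2)^n)\<^sup>2 = ((2 * (1/2)) * (1/2::real))^n"
        unfolding power2_eq_square power_mult_distrib by (simp add: mult.assoc)
      thus ?thesis by (simp add: ennreal_mult[symmetric])
    qed
    finally show "(\<integral>\<^sup>+x. ennreal (2^n * (d n x)\<^sup>2) \<partial>lborel) \<le> ennreal ((1/2)^n)"
      by (simp add: mult_left_mono)
  qed auto
  also have "\<dots> < \<infinity>" by (subst suminf_ennreal2) (auto simp: summable_geometric)
  finally have "AE x in lborel. (\<Sum>n. ennreal (2^n * (d n x)\<^sup>2)) \<noteq> \<infinity>"
    by (intro nn_integral_PInf_AE) auto
  thus ?thesis
  proof (rule AE_mp, intro AE_I2 impI)
    fix x assume "(\<Sum>n. ennreal (2^n * (d n x)\<^sup>2)) \<noteq> \<infinity>"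
    hence "summable (\<lambda>n. 2^n * (d n x)\<^sup>2)"
      by (intro summable_suminf_not_top) auto
    hence "Bseq (\<lambda>n. 2^n * (d n x)\<^sup>2)"
      using summable_LIMSEQ_zero convergentI convergent_imp_Bseq by blast
    then obtain C where C: "C > 0" "\<And>n. 2^n * (d n x)\<^sup>2 \<le> C" by (auto simp: Bseq_def)
    \<comment> \<open>Boundedness of the weighted terms by \<open>C\<close> means geometric decay
      with ratio \<open>1 / sqrt 2\<close>, hence absolute convergence of the telescoping
      series.\<close>
    have le: "norm (F (Suc n) x - F n x) \<le> sqrt C * (1 / sqrt 2)^n" for n
      unfolding d_def[symmetric]
    proof (rule power2_le_imp_le)
      have "(sqrt 2 ^ n)\<^sup>2 = (sqrt 2 ^ 2) ^ n" by (simp only: power_mult[symmetric] mult.commute)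
      hence "(sqrt C * (1 / sqrt 2)^n)\<^sup>2 = C / 2^n"
        using C(1) by (simp add: power_mult_distrib power_divide)
      moreover have "(d n x)\<^sup>2 \<le> C / 2^n" using C(2)[of n] by (simp add: field_simps)
      ultimately show "(d n x)\<^sup>2 \<le> (sqrt C * (1 / sqrt 2)^n)\<^sup>2" by simp
    qed (use C in auto)
    have sm: "summable (\<lambda>n. sqrt C * (1 / sqrt 2)^n)"
      by (intro summable_mult summable_geometric) (auto simp: real_less_rsqrt)
    have "summable (\<lambda>n. F (Suc n) x - F n x)"
      by (rule summable_comparison_test'[OF sm, of 0]) (rule le)
    hence "convergent (\<lambda>n. \<Sum>k<n. F (Suc k) x - F k x)" by (simp add: summable_iff_convergent)
    moreover have "(\<Sum>k<n. F (Suc k) x - F k x) = F n x - F 0 x" for n by (rule sum_lessThan_telescope)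
    ultimately have "convergent (\<lambda>n. F n x - F 0 x)" by simp
    thus "convergent (\<lambda>n. F n x)" using convergent_diff_const_right_iff[of "\<lambda>n. F n x" "F 0 x"] by blast
  qed
qed

text \<open>Fatou's lemma for \<open>|F m - F n|^2\<close> as \<open>m\<close> tends to infinity
  bounds the distance of the limit from \<open>F n\<close>; square integrability of the limit
  follows by adding \<open>F n\<close> back.\<close>

lemma fast_Cauchy_plim:
  fixes F :: "nat \<Rightarrow> 'a::euclidean_space \<Rightarrow> 'b::euclidean_space"
  assumes F: "\<And>n. F n \<in> L2 lborel"
    and fast: "\<And>n. norm (cls (F (Suc n)) - cls (F n)) \<le> (1/2)^n"
  shows "plim F \<in> L2 lborel" "norm (cls (plim F) - cls (F n)) \<le> 2 * (1/2)^n"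
proof -
  have [measurable]: "F n \<in> borel_measurable borel" for n using L2_measurable[OF F] by simp
  have [measurable]: "plim F \<in> borel_measurable borel" by (rule borel_measurable_plim) measurable
  have bd: "(\<integral>\<^sup>+x. ennreal ((norm (plim F x - F n x))\<^sup>2) \<partial>lborel) \<le> ennreal ((2 * (1/2)^n)\<^sup>2)" for n
  proof -
    have "(\<integral>\<^sup>+x. ennreal ((norm (plim F x - F n x))\<^sup>2) \<partial>lborel)
        = (\<integral>\<^sup>+x. liminf (\<lambda>m. ennreal ((norm (F m x - F n x))\<^sup>2)) \<partial>lborel)"
    proof (rule nn_integral_cong_AE, rule AE_mp[OF fast_Cauchy_AE_convergent[OF assms]], intro AE_I2 impI)
      fix x assume "convergent (\<lambda>n. F n x)"
      hence "(\<lambda>m. ennreal ((norm (F m x - F n x))\<^sup>2)) \<longlonglongrightarrow> ennreal ((norm (plim F x - F n x))\<^sup>2)"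
        by (intro tendsto_intros tendsto_ennrealI plim_LIMSEQ)
      thus "ennreal ((norm (plim F x - F n x))\<^sup>2) = liminf (\<lambda>m. ennreal ((norm (F m x - F n x))\<^sup>2))"
        using lim_imp_Liminf[OF sequentially_bot] by metis
    qed
    also have "\<dots> \<le> liminf (\<lambda>m. \<integral>\<^sup>+x. ennreal ((norm (F m x - F n x))\<^sup>2) \<partial>lborel)"
      by (rule nn_integral_liminf) measurable
    also have "\<dots> = liminf (\<lambda>m. ennreal ((norm (cls (F m) - cls (F n)))\<^sup>2))"
      using nn_integral_cls[OF L2_diff[OF F F]] by (simp add: cls_diff F)
    also have "\<dots> \<le> ennreal ((2 * (1/2)^n)\<^sup>2)"
    proof (rule Liminf_le)
      show "\<forall>\<^sub>F m in sequentially. ennreal ((norm (cls (F m) - cls (F n)))\<^sup>2) \<le> ennreal ((2 * (1/2)^n)\<^sup>2)"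
        using fast_Cauchy_norm_le'[of "\<lambda>n. cls (F n)", OF fast]
        by (intro eventually_sequentiallyI[of n] ennreal_leI power_mono) auto
    qed simp
    finally show ?thesis .
  qed
  have d: "(\<lambda>x. plim F x - F n x) \<in> L2 lborel" for n
    by (rule L2_nn_integralI) (use bd[of n] in \<open>auto intro: le_less_trans\<close>)
  show L: "plim F \<in> L2 lborel" using L2_add[OF d F, of n n] by simp
  have "ennreal ((norm (cls (plim F) - cls (F n)))\<^sup>2) \<le> ennreal ((2 * (1/2)^n)\<^sup>2)"
    using bd[of n] nn_integral_cls[OF d[of n]] by (simp add: cls_diff L F)
  hence "(norm (cls (plim F) - cls (F n)))\<^sup>2 \<le> (2 * (1/2)^n)\<^sup>2" by (subst (asm) ennreal_le_iff) auto
  thus "norm (cls (plim F) - cls (F n)) \<le> 2 * (1/2)^n" by (rule power2_le_imp_le) simp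
qed

lemma fast_Cauchy_plim_tendsto:
  fixes F :: "nat \<Rightarrow> 'a::euclidean_space \<Rightarrow> 'b::euclidean_space"
  assumes F: "\<And>n. F n \<in> L2 lborel"
    and fast: "\<And>n. norm (cls (F (Suc n)) - cls (F n)) \<le> (1/2)^n"
  shows "(\<lambda>n. cls (F n)) \<longlonglongrightarrow> cls (plim F)"
proof (rule LIM_zero_cancel, rule Lim_null_comparison)
  show "\<forall>\<^sub>F n in sequentially. norm (cls (F n) - cls (plim F)) \<le> 2 * (1/2)^n"
    using fast_Cauchy_plim(2)[OF assms] by (simp add: norm_minus_commute)
  show "(\<lambda>n. 2 * (1/2)^n :: real) \<longlonglongrightarrow> 0"
    using tendsto_mult_right_zero[OF LIMSEQ_power_zero[of "1/2::real"], of 2] by simp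
qed

lemma Cauchy_fast_subseq:
  fixes X :: "nat \<Rightarrow> 'a::real_normed_vector"
  assumes "Cauchy X"
  obtains r where "strict_mono (r::nat \<Rightarrow> nat)" "\<And>n. norm (X (r (Suc n)) - X (r n)) \<le> (1/2)^n"
proof -
  have "\<exists>N. \<forall>m\<ge>N. \<forall>n\<ge>N. norm (X m - X n) < (1/2)^k" for k :: nat
    using CauchyD[OF assms, of "(1/2)^k"] by simp
  then obtain N where N: "\<And>k m n. m \<ge> N k \<Longrightarrow> n \<ge> N k \<Longrightarrow> norm (X m - X n) < (1/2)^k" by metis
  \<comment> \<open>The sum dominates \<open>N n\<close> and is monotone; the extra \<open>n\<close>
    makes the subsequence strictly increasing.\<close>
  define r where "r n = (\<Sum>k\<le>n. N k) + n" for n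
  have "strict_mono r" by (rule strict_monoI_Suc) (simp add: r_def)
  moreover have "r n \<ge> N n" for n unfolding r_def by (cases n) auto
  hence "norm (X (r (Suc n)) - X (r n)) \<le> (1/2)^n" for n
  proof -
    have "r (Suc n) \<ge> r n" by (simp add: r_def)
    thus ?thesis using N[where k=n] \<open>\<And>n. r n \<ge> N n\<close>[of n] by (meson order_trans less_imp_le)
  qed
  ultimately show ?thesis by (rule that)
qed

text \<open>Riesz-Fischer: a Cauchy sequence converges as soon as one subsequence does, and
  \<open>plim\<close> of representatives along a fast subsequence supplies the limit.\<close>

instance l2 :: (euclidean_space, euclidean_space) complete_space
proof
  fix X :: "nat \<Rightarrow> ('a, 'b) l2" assume X: "Cauchy X"
  obtain r where r: "strict_mono (r::nat \<Rightarrow> nat)" "\<And>n. norm (X (r (Suc n)) - X (r n)) \<le> (1/2)^n"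
    using Cauchy_fast_subseq[OF X] by blast
  have "(\<lambda>n. cls (rep (X (r n)))) \<longlonglongrightarrow> cls (plim (\<lambda>n. rep (X (r n))))"
    by (rule fast_Cauchy_plim_tendsto) (use r(2) rep_L2 in auto)
  hence "(X \<circ> r) \<longlonglongrightarrow> cls (plim (\<lambda>n. rep (X (r n))))" by (simp add: o_def)
  from Cauchy_converges_subseq[OF X r(1) this] show "convergent X" by (auto simp: convergent_def)
qed

instance l2 :: (euclidean_space, euclidean_space) banach ..

section \<open>The resolvent of a closed form and its smooth trajectories\<close>

lemma subspace_closure:
  fixes S :: "'a::real_normed_vector set"
  assumes "subspace S"
  shows "subspace (closure S)"
proof (rule subspaceI)
  show "0 \<in> closure S" using subspace_0[OF assms] closure_subset by blast
next
  fix x y assume "x \<in> closure S" "y \<in> closure S"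
  then obtain f g where "\<And>n. f n \<in> S" "f \<longlonglongrightarrow> x" "\<And>n. g n \<in> S" "g \<longlonglongrightarrow> y"
    unfolding closure_sequential by metis
  thus "x + y \<in> closure S" unfolding closure_sequential
    by (intro exI[of _ "\<lambda>n. f n + g n"]) (auto intro: tendsto_add subspace_add[OF assms])
next
  fix c :: real and x assume "x \<in> closure S"
  then obtain f where "\<And>n. f n \<in> S" "f \<longlonglongrightarrow> x" unfolding closure_sequential by metis
  thus "c *\<^sub>R x \<in> closure S" unfolding closure_sequential
    by (intro exI[of _ "\<lambda>n. c *\<^sub>R f n"]) (auto intro: tendsto_scaleR subspace_scale[OF assms])
qed

text \<open>\<open>V\<close> is the graph of the gradient on the form domain. The resolvent \<open>R = (1 + A)\<^sup>-\<^sup>1\<close> of the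
  associated operator \<open>A\<close> is the compression to the first component of the orthogonal projection
  onto \<open>V\<close>, and \<open>D\<close> is the gradient of \<open>R\<close>.\<close>

locale form_graph =
  fixes V :: "('h::{real_inner,banach} \<times> 'e::{real_inner,banach}) set"
  assumes subspace_V: "subspace V" and closed_V: "closed V"
begin

definition R :: "'h \<Rightarrow> 'h" where "R h = fst (proj V (h, 0))"
definition D :: "'h \<Rightarrow> 'e" where "D h = snd (proj V (h, 0))"
text \<open>The closure of the form domain in the state space. On it \<open>R\<close> is injective
  with dense range, so it is the space of possible initial values and states.\<close>

definition Hb :: "'h set" where "Hb = closure (fst ` V)"

lemma RD_in: "(R h, D h) \<in> V"
  unfolding R_def D_def using proj_in[OF subspace_V closed_V] by simp

text \<open>Orthogonality of \<open>(h, 0) - (R h, D h)\<close> to \<open>V\<close>; read as an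
  equation it is the weak form of \<open>(1 + A) (R h) = h\<close>.\<close>

lemma RD_weak: "(\<phi>, \<gamma>) \<in> V \<Longrightarrow> R h \<bullet> \<phi> + D h \<bullet> \<gamma> = h \<bullet> \<phi>"
  using inner_proj_left[OF subspace_V closed_V, of "(\<phi>, \<gamma>)" "(h, 0)"]
  by (simp add: R_def D_def inner_prod_def)

lemma bounded_linear_R: "bounded_linear R" and bounded_linear_D: "bounded_linear D"
proof -
  have "bounded_linear (\<lambda>h. proj V (h, 0))"
    by (rule bounded_linear_compose[OF bounded_linear_proj[OF subspace_V closed_V]])
       (intro bounded_linear_Pair bounded_linear_ident bounded_linear_zero)
  thus "bounded_linear R" "bounded_linear D" unfolding R_def[abs_def] D_def[abs_def]
    by (auto intro: bounded_linear_compose[OF bounded_linear_fst] bounded_linear_compose[OF bounded_linear_snd])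
qed

sublocale R: bounded_linear R by (rule bounded_linear_R)
sublocale D: bounded_linear D by (rule bounded_linear_D)

text \<open>The equation for \<open>R h'\<close> is tested with the pair of \<open>h\<close> itself.
  Symmetry, positivity and contractivity of \<open>R\<close> all follow from this one
  identity.\<close>

lemma R_inner: "h' \<bullet> R h = R h' \<bullet> R h + D h' \<bullet> D h"
  using RD_weak[OF RD_in, of h' h] by simp

lemma R_sym: "R h \<bullet> h' = h \<bullet> R h'"
  using R_inner[of h' h] R_inner[of h h'] by (simp add: inner_commute)

lemma R_energy: "h \<bullet> R h = (norm (R h))\<^sup>2 + (norm (D h))\<^sup>2"
  using R_inner[of h h] by (simp add: power2_norm_eq_inner)

lemma norm_R_le: "norm (R h) \<le> norm h"
proof -
  have "(norm (R h))\<^sup>2 \<le> h \<bullet> R h" by (simp add: R_energy)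
  also have "\<dots> \<le> norm h * norm (R h)" by (rule norm_cauchy_schwarz)
  finally show ?thesis by (cases "norm (R h) = 0") (auto simp: power2_eq_square)
qed

lemma R_contr: "R h \<bullet> h \<le> (norm h)\<^sup>2"
proof -
  have "R h \<bullet> h \<le> norm (R h) * norm h" by (rule norm_cauchy_schwarz)
  also have "\<dots> \<le> norm h * norm h" by (intro mult_right_mono norm_R_le) simp
  finally show ?thesis by (simp add: power2_eq_square)
qed

lemma subspace_Hb: "subspace Hb"
  unfolding Hb_def by (intro subspace_closure linear_subspace_image[OF linear_fst subspace_V])

lemma closed_Hb: "closed Hb" unfolding Hb_def by simp

lemma fst_in_Hb: "(\<phi>, \<gamma>) \<in> V \<Longrightarrow> \<phi> \<in> Hb"
  unfolding Hb_def using closure_subset by force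

lemma R_in_Hb: "R h \<in> Hb" by (rule fst_in_Hb[OF RD_in])

lemma orth_Hb:
  assumes "\<And>\<phi> \<gamma>. (\<phi>, \<gamma>) \<in> V \<Longrightarrow> h \<bullet> \<phi> = 0" and "k \<in> Hb"
  shows "h \<bullet> k = 0"
proof -
  have "closed {k. h \<bullet> k = 0}" by (intro closed_Collect_eq continuous_intros)
  hence "closure (fst ` V) \<subseteq> {k. h \<bullet> k = 0}" by (intro closure_minimal) (use assms(1) in auto)
  thus ?thesis using assms(2) unfolding Hb_def by auto
qed

text \<open>By the energy identity the gradient \<open>D h\<close> vanishes together with
  \<open>R h\<close>; the weak equation then says that \<open>h\<close> is orthogonal to the form
  domain, hence to its closure, which contains \<open>h\<close>.\<close>

lemma R_eq_0_imp: assumes "R h = 0" "h \<in> Hb" shows "h = 0"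
proof -
  have "D h = 0" using R_energy[of h] assms(1) by simp
  hence "h \<bullet> \<phi> = 0" if "(\<phi>, \<gamma>) \<in> V" for \<phi> \<gamma>
    using RD_weak[OF that, of h] assms(1) by simp
  hence "h \<bullet> h = 0" by (rule orth_Hb[OF _ assms(2)])
  thus ?thesis by simp
qed

text \<open>Taking \<open>k = R h\<close> and moving one \<open>R\<close> across by symmetry gives
  \<open>|R h|^2 = 0\<close>; injectivity on \<open>Hb\<close> finishes.\<close>

lemma R_dense: assumes "h \<in> Hb" "\<And>k. k \<in> Hb \<Longrightarrow> h \<bullet> R k = 0" shows "h = 0"
proof (rule R_eq_0_imp[OF _ assms(1)])
  have "R h \<bullet> R h = 0" using assms(2)[OF R_in_Hb] by (simp add: R_sym)
  thus "R h = 0" by simp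
qed

section \<open>The trajectories \<open>R W\<close> and their energy identities\<close>

definition W :: "'h \<Rightarrow> (real \<Rightarrow> 'h) \<Rightarrow> real \<Rightarrow> 'h" where
  "W w0 w t = w0 + integral {0..t} w"

text \<open>The right-hand side of the heat equation solved by \<open>R (W w0 w t)\<close>:
  \<open>R (w t)\<close> is the time derivative, and \<open>W - R W\<close> is the operator of the
  form applied to \<open>R W\<close>.\<close>

definition src :: "'h \<Rightarrow> (real \<Rightarrow> 'h) \<Rightarrow> real \<Rightarrow> 'h" where
  "src w0 w t = R (w t) + W w0 w t - R (W w0 w t)"

context
  fixes T :: real and w0 :: 'h and w :: "real \<Rightarrow> 'h"
  assumes T: "T \<ge> 0" and cont_w: "continuous_on {0..T} w"
begin

lemma W_deriv: "t \<in> {0..T} \<Longrightarrow> (W w0 w has_vector_derivative w t) (at t within {0..T})"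
  unfolding W_def[abs_def]
  using integral_has_vector_derivative[OF cont_w, of t] by (auto intro!: derivative_eq_intros)

lemma W_0: "W w0 w 0 = w0" by (simp add: W_def)

lemma continuous_W: "continuous_on {0..T} (W w0 w)"
  using W_deriv by (meson continuous_on_vector_derivative)

lemma continuous_src: "continuous_on {0..T} (src w0 w)"
  unfolding src_def[abs_def]
  by (intro continuous_intros R.continuous_on continuous_W cont_w)

lemma RW_deriv: "t \<in> {0..T} \<Longrightarrow> ((\<lambda>t. R (W w0 w t)) has_vector_derivative R (w t)) (at t within {0..T})"
  by (rule R.has_vector_derivative[OF W_deriv])

text \<open>By \<open>RD_weak\<close> the derivative of the trajectory, paired with
  \<open>\<phi>\<close>, is the source minus the gradient pairing. Integrating it in time gives the
  weak formulation.\<close>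

lemma weak_identity:
  assumes V: "(\<phi>, \<gamma>) \<in> V" and t: "t \<in> {0..T}"
  shows "R (W w0 w t) \<bullet> \<phi> + integral {0..t} (\<lambda>s. D (W w0 w s) \<bullet> \<gamma>)
    = R w0 \<bullet> \<phi> + integral {0..t} (\<lambda>s. src w0 w s \<bullet> \<phi>)"
proof -
  have eq: "R (w s) \<bullet> \<phi> = src w0 w s \<bullet> \<phi> - D (W w0 w s) \<bullet> \<gamma>" for s
    using RD_weak[OF V, of "W w0 w s"] by (simp add: src_def inner_diff_left inner_add_left)
  have sub: "{0..t} \<subseteq> {0..T}" using t by auto
  have "((\<lambda>s. R (w s) \<bullet> \<phi>) has_integral (R (W w0 w t) \<bullet> \<phi> - R (W w0 w 0) \<bullet> \<phi>)) {0..t}"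
  proof (rule fundamental_theorem_of_calculus)
    show "0 \<le> t" using t by simp
    fix s assume "s \<in> {0..t}"
    hence "((\<lambda>t. R (W w0 w t)) has_vector_derivative R (w s)) (at s within {0..t})"
      by (intro has_vector_derivative_within_subset[OF RW_deriv sub]) (use sub in auto)
    thus "((\<lambda>s. R (W w0 w s) \<bullet> \<phi>) has_vector_derivative R (w s) \<bullet> \<phi>) (at s within {0..t})"
      by (rule bounded_linear.has_vector_derivative[OF bounded_linear_inner_left])
  qed
  moreover have "((\<lambda>s. R (w s) \<bullet> \<phi>) has_integral
     (integral {0..t} (\<lambda>s. src w0 w s \<bullet> \<phi>) - integral {0..t} (\<lambda>s. D (W w0 w s) \<bullet> \<gamma>))) {0..t}"
    unfolding eq
    by (intro has_integral_diff integrable_integral integrable_continuous_real continuous_intros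
        continuous_on_subset[OF continuous_src sub] D.continuous_on continuous_on_subset[OF continuous_W sub])
  ultimately have "R (W w0 w t) \<bullet> \<phi> - R (W w0 w 0) \<bullet> \<phi> =
     integral {0..t} (\<lambda>s. src w0 w s \<bullet> \<phi>) - integral {0..t} (\<lambda>s. D (W w0 w s) \<bullet> \<gamma>)"
    by (rule has_integral_unique)
  thus ?thesis by (simp add: W_0)
qed

text \<open>This integrates the derivative of \<open>exp (- 2 * l * s) * |R W|^2\<close>. Replacing
  \<open>R w\<close> by \<open>src - (W - R W)\<close> produces
  \<open>W \<bullet> R W - |R W|^2\<close>, which \<open>R_energy\<close> identifies as the squared
  gradient norm.\<close>

lemma weighted_energy:
  assumes t: "t \<in> {0..T}"
  shows "((\<lambda>s. exp (- 2 * l * s) * (2 * (src w0 w s \<bullet> R (W w0 w s)) - 2 * (norm (D (W w0 w s)))\<^sup>2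
      - 2 * l * (norm (R (W w0 w s)))\<^sup>2)) has_integral
    (exp (- 2 * l * t) * (norm (R (W w0 w t)))\<^sup>2 - (norm (R w0))\<^sup>2)) {0..t}"
proof -
  have sub: "{0..t} \<subseteq> {0..T}" using t by auto
  have "((\<lambda>s. exp (- 2 * l * s) * (2 * (src w0 w s \<bullet> R (W w0 w s)) - 2 * (norm (D (W w0 w s)))\<^sup>2
      - 2 * l * (norm (R (W w0 w s)))\<^sup>2)) has_integral
    (exp (- 2 * l * t) * (R (W w0 w t) \<bullet> R (W w0 w t)) - exp (- 2 * l * 0) * (R (W w0 w 0) \<bullet> R (W w0 w 0)))) {0..t}"
  proof (rule fundamental_theorem_of_calculus)
    show "0 \<le> t" using t by simp
    fix s assume s: "s \<in> {0..t}"
    define y where "y = (\<lambda>s. R (W w0 w s))"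
    have d: "(y has_vector_derivative R (w s)) (at s within {0..t})" unfolding y_def
      by (intro has_vector_derivative_within_subset[OF RW_deriv sub]) (use sub s in auto)
    hence d2: "((\<lambda>s. y s \<bullet> y s) has_real_derivative (y s \<bullet> R (w s) + R (w s) \<bullet> y s)) (at s within {0..t})"
      using bounded_bilinear.has_vector_derivative[OF bounded_bilinear_inner d d]
      by (simp add: has_real_derivative_iff_has_vector_derivative)
    have e: "src w0 w s \<bullet> y s = R (w s) \<bullet> y s + (norm (D (W w0 w s)))\<^sup>2"
      using R_energy[of "W w0 w s"]
      by (simp add: src_def inner_diff_left inner_add_left power2_norm_eq_inner y_def)
    have c: "y s \<bullet> R (w s) = R (w s) \<bullet> y s" by (rule inner_commute)
    have "((\<lambda>s. exp (- 2 * l * s) * (y s \<bullet> y s)) has_real_derivative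
        exp (- 2 * l * s) * (2 * (src w0 w s \<bullet> y s) - 2 * (norm (D (W w0 w s)))\<^sup>2 - 2 * l * (norm (y s))\<^sup>2))
        (at s within {0..t})"
      by (rule derivative_eq_intros d2 refl | simp)+
         (simp add: e c power2_norm_eq_inner algebra_simps)
    thus "((\<lambda>s. exp (- 2 * l * s) * (R (W w0 w s) \<bullet> R (W w0 w s))) has_vector_derivative
        exp (- 2 * l * s) * (2 * (src w0 w s \<bullet> R (W w0 w s)) - 2 * (norm (D (W w0 w s)))\<^sup>2
          - 2 * l * (norm (R (W w0 w s)))\<^sup>2)) (at s within {0..t})"
      by (simp add: has_real_derivative_iff_has_vector_derivative y_def)
  qed
  thus ?thesis by (simp add: W_0 power2_norm_eq_inner)
qed

lemma continuous_RW: "continuous_on {0..T} (\<lambda>s. R (W w0 w s))"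
  and continuous_DW: "continuous_on {0..T} (\<lambda>s. D (W w0 w s))"
  by (intro R.continuous_on D.continuous_on continuous_W)+

text \<open>The final value and the gradient term are dropped by sign. The factor \<open>l\<close>
  on the left can be taken large enough to absorb a bounded potential.\<close>

lemma weighted_energy_le:
  "l * integral {0..T} (\<lambda>s. exp (- 2 * l * s) * (norm (R (W w0 w s)))\<^sup>2)
    \<le> (norm (R w0))\<^sup>2 / 2 + integral {0..T} (\<lambda>s. exp (- 2 * l * s) * (src w0 w s \<bullet> R (W w0 w s)))"
proof -
  have i1: "((\<lambda>s. exp (- 2 * l * s) * (src w0 w s \<bullet> R (W w0 w s))) has_integral
      integral {0..T} (\<lambda>s. exp (- 2 * l * s) * (src w0 w s \<bullet> R (W w0 w s)))) {0..T}"
    by (intro integrable_integral integrable_continuous_real continuous_intros continuous_src continuous_RW)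
  have i2: "((\<lambda>s. exp (- 2 * l * s) * (norm (R (W w0 w s)))\<^sup>2) has_integral
      integral {0..T} (\<lambda>s. exp (- 2 * l * s) * (norm (R (W w0 w s)))\<^sup>2)) {0..T}"
    by (intro integrable_integral integrable_continuous_real continuous_intros continuous_RW)
  have "exp (- 2 * l * T) * (norm (R (W w0 w T)))\<^sup>2 - (norm (R w0))\<^sup>2 \<le>
    2 * integral {0..T} (\<lambda>s. exp (- 2 * l * s) * (src w0 w s \<bullet> R (W w0 w s)))
    - 2 * l * integral {0..T} (\<lambda>s. exp (- 2 * l * s) * (norm (R (W w0 w s)))\<^sup>2)"
    by (rule has_integral_le[OF weighted_energy
          has_integral_diff[OF has_integral_mult_right[OF i1] has_integral_mult_right[OF i2]]])
       (use T in \<open>auto simp: algebra_simps\<close>)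
  moreover have "0 \<le> exp (- 2 * l * T) * (norm (R (W w0 w T)))\<^sup>2" by simp
  ultimately show ?thesis by linarith
qed

text \<open>The unweighted identity with \<open>2 x y <= x^2 + y^2\<close>. The trajectory is
  allowed to reappear on the right in the space-time norm, since the weighted inequality controls it
  there.\<close>

lemma energy_le:
  assumes t: "t \<in> {0..T}"
  shows "(norm (R (W w0 w t)))\<^sup>2 + 2 * integral {0..t} (\<lambda>s. (norm (D (W w0 w s)))\<^sup>2)
    \<le> (norm (R w0))\<^sup>2 + (integral {0..T} (\<lambda>s. (norm (src w0 w s))\<^sup>2) + integral {0..T} (\<lambda>s. (norm (R (W w0 w s)))\<^sup>2))"
proof -
  have sub: "{0..t} \<subseteq> {0..T}" using t by auto
  define q where "q s = (norm (src w0 w s))\<^sup>2 + (norm (R (W w0 w s)))\<^sup>2" for s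
  have cq: "continuous_on {0..T} q" unfolding q_def by (intro continuous_intros continuous_src continuous_RW)
  have i1: "(q has_integral integral {0..t} q) {0..t}"
    by (intro integrable_integral integrable_continuous_real continuous_on_subset[OF cq sub])
  have i2: "((\<lambda>s. (norm (D (W w0 w s)))\<^sup>2) has_integral integral {0..t} (\<lambda>s. (norm (D (W w0 w s)))\<^sup>2)) {0..t}"
    by (intro integrable_integral integrable_continuous_real continuous_intros
        continuous_on_subset[OF continuous_DW sub])
  have pt: "2 * (src w0 w s \<bullet> R (W w0 w s)) \<le> q s" for s
  proof -
    have "0 \<le> (norm (src w0 w s - R (W w0 w s)))\<^sup>2" by simp
    also have "\<dots> = q s - 2 * (src w0 w s \<bullet> R (W w0 w s))"
      unfolding q_def power2_norm_eq_inner by (simp add: inner_diff_left inner_diff_right inner_commute)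
    finally show ?thesis by simp
  qed
  have "exp (- 2 * 0 * t) * (norm (R (W w0 w t)))\<^sup>2 - (norm (R w0))\<^sup>2 \<le> integral {0..t} q
    - 2 * integral {0..t} (\<lambda>s. (norm (D (W w0 w s)))\<^sup>2)"
    by (rule has_integral_le[OF weighted_energy[OF t, of 0] has_integral_diff[OF i1 has_integral_mult_right[OF i2]]])
       (use pt in simp)
  moreover have "integral {0..t} q \<le> integral {0..T} q"
    by (rule integral_subset_le[OF sub])
       (auto intro!: integrable_continuous_real continuous_on_subset[OF cq sub] cq simp: q_def)
  moreover have "integral {0..T} q = integral {0..T} (\<lambda>s. (norm (src w0 w s))\<^sup>2) + integral {0..T} (\<lambda>s. (norm (R (W w0 w s)))\<^sup>2)"
    unfolding q_def
    by (intro integral_add integrable_continuous_real continuous_intros continuous_src continuous_RW)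
  ultimately show ?thesis by simp
qed

end

text \<open>With \<open>X = W 0 w\<close>, the remaining term \<open>(X - R X) \<bullet> w\<close>
  is by symmetry of \<open>R\<close> the derivative of \<open>(|X|^2 - R X \<bullet> X) / 2\<close>,
  which vanishes at 0 and is nonnegative at \<open>T\<close> because \<open>R\<close> is a
  contraction.\<close>

lemma src_accretive:
  assumes T: "T \<ge> 0" and w: "continuous_on {0..T} w"
  shows "integral {0..T} (\<lambda>s. R (w s) \<bullet> w s) \<le> integral {0..T} (\<lambda>s. src 0 w s \<bullet> w s)"
proof -
  define X where "X = W 0 w"
  have X: "(X has_vector_derivative w t) (at t within {0..T})" if "t \<in> {0..T}" for t
    unfolding X_def by (rule W_deriv[OF T w that])
  have cX: "continuous_on {0..T} X" unfolding X_def by (rule continuous_W[OF T w])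
  have "((\<lambda>s. X s \<bullet> w s - R (X s) \<bullet> w s) has_integral
      ((X T \<bullet> X T - R (X T) \<bullet> X T) / 2 - (X 0 \<bullet> X 0 - R (X 0) \<bullet> X 0) / 2)) {0..T}"
  proof (rule fundamental_theorem_of_calculus[OF T])
    fix s assume s: "s \<in> {0..T}"
    note d = X[OF s] and dR = R.has_vector_derivative[OF X[OF s]]
    show "((\<lambda>s. (X s \<bullet> X s - R (X s) \<bullet> X s) / 2) has_vector_derivative X s \<bullet> w s - R (X s) \<bullet> w s)
        (at s within {0..T})"
      using has_vector_derivative_diff[OF bounded_bilinear.has_vector_derivative[OF bounded_bilinear_inner d d]
          bounded_bilinear.has_vector_derivative[OF bounded_bilinear_inner dR d]]
      unfolding has_real_derivative_iff_has_vector_derivative[symmetric]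
      by (rule DERIV_cong[OF DERIV_cdivide]) (use R_sym[of "X s" "w s"] in \<open>simp add: inner_commute\<close>)
  qed
  note FTC = this
  have eq: "(\<lambda>s. src 0 w s \<bullet> w s - R (w s) \<bullet> w s) = (\<lambda>s. X s \<bullet> w s - R (X s) \<bullet> w s)"
    by (auto simp: src_def X_def inner_add_left inner_diff_left)
  have "((\<lambda>s. src 0 w s \<bullet> w s - R (w s) \<bullet> w s) has_integral
     (integral {0..T} (\<lambda>s. src 0 w s \<bullet> w s) - integral {0..T} (\<lambda>s. R (w s) \<bullet> w s))) {0..T}"
    by (intro has_integral_diff integrable_integral integrable_continuous_real continuous_intros
         continuous_src R.continuous_on T w)
  from has_integral_unique[OF FTC this[unfolded eq]]
  have "(X T \<bullet> X T - R (X T) \<bullet> X T) / 2 - (X 0 \<bullet> X 0 - R (X 0) \<bullet> X 0) / 2 =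
     integral {0..T} (\<lambda>s. src 0 w s \<bullet> w s) - integral {0..T} (\<lambda>s. R (w s) \<bullet> w s)"
    .
  moreover have "X 0 = 0" by (simp add: X_def W_def)
  moreover have "R (X T) \<bullet> X T \<le> X T \<bullet> X T" using R_contr[of "X T"] by (simp add: power2_norm_eq_inner)
  ultimately show ?thesis by simp
qed

end

section \<open>Space-time functions and curves of square integrable functions\<close>

lemma L2_prod_integrable:
  fixes f g :: "real \<times> 'a::euclidean_space \<Rightarrow> 'b::euclidean_space"
  assumes "f \<in> L2 lborel" "g \<in> L2 lborel"
  shows "integrable (lborel \<Otimes>\<^sub>M lborel) (\<lambda>z. f z \<bullet> g z)"
  unfolding lborel_prod by (rule L2_integrable_inner[OF assms])

lemma AE_L2_section:
  fixes f :: "real \<times> 'a::euclidean_space \<Rightarrow> 'b::euclidean_space"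
  assumes f: "f \<in> L2 lborel"
  shows "AE t in lborel. (\<lambda>x. f (t, x)) \<in> L2 lborel"
proof -
  have [measurable]: "f \<in> borel_measurable borel" using f by (auto simp: L2_def)
  have "f \<in> borel_measurable (lborel \<Otimes>\<^sub>M lborel)" unfolding lborel_prod by simp
  from measurable_Pair2[OF this] have m: "(\<lambda>x. f (t, x)) \<in> borel_measurable lborel" for t by simp
  have "AE t in lborel. integrable lborel (\<lambda>x. f (t, x) \<bullet> f (t, x))"
    using lborel_pair.AE_integrable_fst'[OF L2_prod_integrable[OF f f]] by simp
  thus ?thesis by eventually_elim (use m in \<open>auto simp: L2_def power2_norm_eq_inner\<close>)
qed

lemma inner_cls_sections:
  fixes f g :: "real \<times> 'a::euclidean_space \<Rightarrow> 'b::euclidean_space"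
  assumes f: "f \<in> L2 lborel" and g: "g \<in> L2 lborel"
  shows "cls f \<bullet> cls g = (\<integral>t. (\<integral>x. f (t, x) \<bullet> g (t, x) \<partial>lborel) \<partial>lborel)"
    "integrable lborel (\<lambda>t. \<integral>x. f (t, x) \<bullet> g (t, x) \<partial>lborel)"
  using lborel_pair.integral_fst'[OF L2_prod_integrable[OF assms]]
    lborel_pair.integrable_fst'[OF L2_prod_integrable[OF assms]]
  by (simp_all add: inner_cls[OF assms] lborel_prod)

text \<open>The default 0 concerns only a null set of times. Up to null sets the slices do not
  depend on the representative (\<open>slice_cls\<close>).\<close>

definition slice :: "(real \<times> 'a::euclidean_space, 'b::euclidean_space) l2 \<Rightarrow> real \<Rightarrow> ('a, 'b) l2" where
  "slice F t = (if (\<lambda>x. rep F (t, x)) \<in> L2 lborel then cls (\<lambda>x. rep F (t, x)) else 0)"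

lemma AE_lborel_sections:
  fixes P :: "real \<times> 'a::euclidean_space \<Rightarrow> bool"
  assumes "AE z in lborel. P z"
  shows "AE t in lborel. AE x in lborel. P (t, x)"
proof -
  have "AE z in lborel \<Otimes>\<^sub>M lborel. P z" unfolding lborel_prod by (rule assms)
  thus ?thesis by (rule lborel_pair.AE_pair)
qed

lemma slice_cls:
  fixes f :: "real \<times> 'a::euclidean_space \<Rightarrow> 'b::euclidean_space"
  assumes f: "f \<in> L2 lborel"
  shows "AE t in lborel. slice (cls f) t = cls (\<lambda>x. f (t, x))"
  using AE_lborel_sections[OF rep_cls[OF f]] AE_L2_section[OF f] AE_L2_section[OF rep_L2[of "cls f"]]
  by eventually_elim (simp add: slice_def cls_eq_iff)

lemma sets_L2_sections:
  fixes f :: "real \<times> 'a::euclidean_space \<Rightarrow> 'b::euclidean_space"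
  assumes f[measurable]: "f \<in> borel_measurable borel"
  shows "{t. (\<lambda>x. f (t, x)) \<in> L2 lborel} \<in> sets borel"
proof -
  have [measurable]: "f \<in> borel_measurable (lborel \<Otimes>\<^sub>M lborel)" unfolding lborel_prod by simp
  have m: "(\<lambda>x. f (t, x)) \<in> borel_measurable lborel" for t
    using measurable_Pair2[of f lborel lborel borel t] by simp
  have "(\<lambda>x. f (t, x)) \<in> L2 lborel \<longleftrightarrow> (\<integral>\<^sup>+x. ennreal ((norm (f (t, x)))\<^sup>2) \<partial>lborel) < \<infinity>" for t
    using m[of t] by (auto simp: L2_def integrable_iff_bounded)
  moreover have "{t \<in> space lborel. (\<integral>\<^sup>+x. ennreal ((norm (f (t, x)))\<^sup>2) \<partial>lborel) < \<infinity>} \<in> sets lborel"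
    by measurable
  ultimately show ?thesis by simp
qed

text \<open>Slices enter time integrals only through inner products. These are parametric integrals
  on the measurable set of times at which both sections are square integrable, and 0
  elsewhere.\<close>

lemma borel_measurable_inner_slice[measurable]:
  fixes F G :: "(real \<times> 'a::euclidean_space, 'b::euclidean_space) l2"
  shows "(\<lambda>t. slice F t \<bullet> slice G t) \<in> borel_measurable borel"
proof -
  have [measurable]: "rep F \<in> borel_measurable (lborel \<Otimes>\<^sub>M lborel)" "rep G \<in> borel_measurable (lborel \<Otimes>\<^sub>M lborel)"
    unfolding lborel_prod by simp_all
  have *: "slice F t \<bullet> slice G t = (if t \<in> {t. (\<lambda>x. rep F (t, x)) \<in> L2 lborel} \<inter> {t. (\<lambda>x. rep G (t, x)) \<in> L2 lborel}
      then \<integral>x. rep F (t, x) \<bullet> rep G (t, x) \<partial>lborel else 0)" for t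
    by (auto simp: slice_def inner_cls)
  have [measurable]: "{t. (\<lambda>x. rep F (t, x)) \<in> L2 lborel} \<in> sets borel" "{t. (\<lambda>x. rep G (t, x)) \<in> L2 lborel} \<in> sets borel"
    by (rule sets_L2_sections, simp)+
  have "(\<lambda>t. \<integral>x. rep F (t, x) \<bullet> rep G (t, x) \<partial>lborel) \<in> borel_measurable lborel" by measurable
  hence [measurable]: "(\<lambda>t. \<integral>x. rep F (t, x) \<bullet> rep G (t, x) \<partial>lborel) \<in> borel_measurable borel" by simp
  show ?thesis unfolding * by measurable
qed

lemma integrable_inner_slice: "integrable lborel (\<lambda>t. slice F t \<bullet> slice G t)" (is ?A)
  and inner_slice: "F \<bullet> G = (\<integral>t. slice F t \<bullet> slice G t \<partial>lborel)" (is ?B)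
  for F G :: "(real \<times> 'a::euclidean_space, 'b::euclidean_space) l2"
proof -
  note i = inner_cls_sections[OF rep_L2[of F] rep_L2[of G]]
  have eq: "AE t in lborel. (\<integral>x. rep F (t, x) \<bullet> rep G (t, x) \<partial>lborel) = slice F t \<bullet> slice G t"
    using AE_L2_section[OF rep_L2[of F]] AE_L2_section[OF rep_L2[of G]]
    by eventually_elim (simp add: slice_def inner_cls)
  show ?A using integrable_cong_AE[THEN iffD1, OF _ _ eq i(2)] borel_measurable_integrable[OF i(2)] by simp
  show ?B using integral_cong_AE[OF _ _ eq] i(1) borel_measurable_integrable[OF i(2)] by simp
qed

lemma norm_slice: "(norm F)\<^sup>2 = (\<integral>t. (norm (slice F t))\<^sup>2 \<partial>lborel)"
  and integrable_norm_slice: "integrable lborel (\<lambda>t. (norm (slice F t))\<^sup>2)"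
  using inner_slice[of F F] integrable_inner_slice[of F F] by (simp_all add: power2_norm_eq_inner)

lemma borel_measurable_norm_slice[measurable]: "(\<lambda>t. (norm (slice F t))\<^sup>2) \<in> borel_measurable borel"
  unfolding power2_norm_eq_inner by measurable

lemma slice_rep: "AE t in lborel. (\<lambda>x. rep F (t, x)) \<in> L2 lborel \<and> slice F t = cls (\<lambda>x. rep F (t, x))"
  using AE_L2_section[OF rep_L2[of F]] by eventually_elim (simp add: slice_def)

lemma slice_diff: "AE t in lborel. slice (F - G) t = slice F t - slice G t"
proof -
  have "AE t in lborel. slice (cls (\<lambda>z. rep F z - rep G z)) t = cls (\<lambda>x. rep F (t, x) - rep G (t, x))"
    by (rule slice_cls[OF L2_diff[OF rep_L2 rep_L2]])
  hence "AE t in lborel. slice (F - G) t = cls (\<lambda>x. rep F (t, x) - rep G (t, x))"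
    by (simp add: cls_diff rep_L2)
  with slice_rep[of F] slice_rep[of G] show ?thesis by eventually_elim (simp add: cls_diff)
qed

lemma slice_add: "AE t in lborel. slice (F + G) t = slice F t + slice G t"
proof -
  have "AE t in lborel. slice (cls (\<lambda>z. rep F z + rep G z)) t = cls (\<lambda>x. rep F (t, x) + rep G (t, x))"
    by (rule slice_cls[OF L2_add[OF rep_L2 rep_L2]])
  hence "AE t in lborel. slice (F + G) t = cls (\<lambda>x. rep F (t, x) + rep G (t, x))"
    by (simp add: cls_add rep_L2)
  with slice_rep[of F] slice_rep[of G] show ?thesis by eventually_elim (simp add: cls_add)
qed

lemma slice_eqI:
  assumes "AE t in lborel. slice F t = slice G t"
  shows "F = G"
proof -
  have "AE t in lborel. (norm (slice (F - G) t))\<^sup>2 = 0"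
    using assms slice_diff[of F G] by eventually_elim simp
  hence "(norm (F - G))\<^sup>2 = 0"
    unfolding norm_slice by (subst integral_cong_AE[where g="\<lambda>_. 0"])
      (auto simp del: power_eq_0_iff)
  thus ?thesis by simp
qed

text \<open>Norm convergence is \<open>L1\<close> convergence in time of
  \<open>|slice (X n - F) t|^2\<close>, so a subsequence converges for almost every time. This is
  how pointwise constraints on slices pass to limits.\<close>

lemma slice_LIMSEQ_subseq:
  assumes "X \<longlonglongrightarrow> F"
  obtains r where "strict_mono (r::nat \<Rightarrow> nat)" "AE t in lborel. (\<lambda>n. slice (X (r n)) t) \<longlonglongrightarrow> slice F t"
proof -
  have "(\<lambda>n. (norm (X n - F))\<^sup>2) \<longlonglongrightarrow> 0\<^sup>2"
    by (intro tendsto_power) (use LIM_zero[OF assms] in \<open>simp add: tendsto_norm_zero_iff\<close>)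
  hence "(\<lambda>n. \<integral>t. norm ((norm (slice (X n - F) t))\<^sup>2) \<partial>lborel) \<longlonglongrightarrow> 0" by (simp add: norm_slice)
  from tendsto_L1_AE_subseq[OF integrable_norm_slice this]
  obtain r where r: "strict_mono r" "AE t in lborel. (\<lambda>n. (norm (slice (X (r n) - F) t))\<^sup>2) \<longlonglongrightarrow> 0" by auto
  have "AE t in lborel. \<forall>n. slice (X (r n) - F) t = slice (X (r n)) t - slice F t"
    using slice_diff by (subst AE_all_countable) blast
  with r(2) have "AE t in lborel. (\<lambda>n. slice (X (r n)) t) \<longlonglongrightarrow> slice F t"
  proof eventually_elim
    case (elim t)
    hence "(\<lambda>n. sqrt ((norm (slice (X (r n)) t - slice F t))\<^sup>2)) \<longlonglongrightarrow> sqrt 0"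
      by (intro tendsto_real_sqrt) simp
    hence "(\<lambda>n. norm (slice (X (r n)) t - slice F t)) \<longlonglongrightarrow> 0"
      by (simp only: real_sqrt_abs abs_norm_cancel real_sqrt_zero)
    thus ?case by (rule LIM_zero_cancel[OF tendsto_norm_zero_cancel])
  qed
  with r(1) show ?thesis by (rule that)
qed

section \<open>Multiplication by bounded functions\<close>

definition mult :: "('a::euclidean_space \<Rightarrow> real) \<Rightarrow> ('a, 'b::euclidean_space) l2 \<Rightarrow> ('a, 'b) l2" where
  "mult m F = cls (\<lambda>z. m z *\<^sub>R rep F z)"

context
  fixes m :: "'a::euclidean_space \<Rightarrow> real" and C :: real
  assumes m: "m \<in> borel_measurable borel" and mC: "\<And>z. \<bar>m z\<bar> \<le> C"
begin

lemma mult_L2: "f \<in> L2 lborel \<Longrightarrow> (\<lambda>z. m z *\<^sub>R f z) \<in> L2 lborel"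
  by (rule L2_bounded_mult[OF _ _ mC]) (use m in auto)

lemma mult_cls: assumes "f \<in> L2 lborel" shows "mult m (cls f) = cls (\<lambda>z. m z *\<^sub>R f z)"
  unfolding mult_def
proof (subst cls_eq_iff)
  show "AE x in lborel. m x *\<^sub>R rep (cls f) x = m x *\<^sub>R f x"
    using rep_cls[OF assms] by eventually_elim simp
qed (intro mult_L2 rep_L2 assms)+

lemma mult_inner: "mult m F \<bullet> G = F \<bullet> mult m G"
  using inner_cls[OF mult_L2[OF rep_L2[of F]] rep_L2[of G]] inner_cls[OF rep_L2[of F] mult_L2[OF rep_L2[of G]]]
  unfolding mult_def by simp

lemma norm_mult_le: "norm (mult m F) \<le> C * norm F" for F :: "('a, 'b::euclidean_space) l2"
proof (rule power2_le_imp_le)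
  have C: "C \<ge> 0" using mC[of 0] by linarith
  have i: "integrable lborel (\<lambda>x. C\<^sup>2 * (norm (rep F x))\<^sup>2)" using rep_L2[of F] by (auto simp: L2_def)
  have "(norm (mult m F))\<^sup>2 = (\<integral>x. (norm (m x *\<^sub>R rep F x))\<^sup>2 \<partial>lborel)"
    unfolding mult_def by (rule norm_cls[OF mult_L2[OF rep_L2]])
  also have "\<dots> \<le> (\<integral>x. C\<^sup>2 * (norm (rep F x))\<^sup>2 \<partial>lborel)"
  proof (rule integral_mono[OF _ i])
    show "integrable lborel (\<lambda>x. (norm (m x *\<^sub>R rep F x))\<^sup>2)" using mult_L2[OF rep_L2[of F]] by (simp add: L2_def)
    show "(norm (m x *\<^sub>R rep F x))\<^sup>2 \<le> C\<^sup>2 * (norm (rep F x))\<^sup>2" for x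
      using power_mono[OF mC[of x], of 2] by (auto simp: power_mult_distrib intro!: mult_right_mono)
  qed
  also have "\<dots> = C\<^sup>2 * (norm F)\<^sup>2" using norm_cls[OF rep_L2[of F]] by simp
  finally show "(norm (mult m F))\<^sup>2 \<le> (C * norm F)\<^sup>2" by (simp add: power_mult_distrib)
  show "0 \<le> C * norm F" using C by simp
qed

lemma bounded_linear_mult: "bounded_linear (mult m :: ('a, 'b::euclidean_space) l2 \<Rightarrow> _)"
proof (rule bounded_linear_intro[of _ C])
  fix F G :: "('a, 'b) l2" and r :: real
  have "mult m (cls (\<lambda>z. rep F z + rep G z)) = mult m F + mult m G"
    by (subst mult_cls) (simp_all add: scaleR_add_right cls_add mult_L2 rep_L2 mult_def L2_add)
  thus "mult m (F + G) = mult m F + mult m G" by (simp add: cls_add rep_L2)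
  have "mult m (cls (\<lambda>z. r *\<^sub>R rep F z)) = r *\<^sub>R mult m F"
    unfolding mult_def[of m F]
    by (subst mult_cls) (simp_all add: mult.commute[of _ r] cls_scaleR[symmetric] mult_L2 rep_L2 L2_scaleR)
  thus "mult m (r *\<^sub>R F) = r *\<^sub>R mult m F" by (simp add: cls_scaleR rep_L2)
  show "norm (mult m F) \<le> norm F * C" using norm_mult_le[of F] by (simp add: mult.commute)
qed

end

lemma borel_measurable_compose_fst:
  fixes m :: "real \<Rightarrow> real"
  assumes "m \<in> borel_measurable borel"
  shows "(\<lambda>z::real \<times> 'a::euclidean_space. m (fst z)) \<in> borel_measurable borel"
  by (rule measurable_compose[OF _ assms]) (intro borel_measurable_continuous_onI continuous_intros)

lemma slice_mult:
  fixes F :: "(real \<times> 'a::euclidean_space, 'b::euclidean_space) l2"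
  assumes [measurable]: "m \<in> borel_measurable borel" and mC: "\<And>t. \<bar>m t\<bar> \<le> C"
  shows "AE t in lborel. slice (mult (\<lambda>z. m (fst z)) F) t = m t *\<^sub>R slice F t"
proof -
  have "AE t in lborel. slice (mult (\<lambda>z. m (fst z)) F) t = cls (\<lambda>x. m t *\<^sub>R rep F (t, x))"
    unfolding mult_def using slice_cls[OF mult_L2[OF _ _ rep_L2[of F], of "\<lambda>z. m (fst z)" C]] mC
      borel_measurable_compose_fst[OF assms(1), where 'a='a] by simp
  with slice_rep[of F] show ?thesis by eventually_elim (simp add: cls_scaleR)
qed

lemma slice_scaleR: "AE t in lborel. slice (c *\<^sub>R F) t = c *\<^sub>R slice F t"
proof -
  have "mult (\<lambda>z. c) F = c *\<^sub>R F" by (simp add: mult_def cls_scaleR rep_L2)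
  thus ?thesis using slice_mult[of "\<lambda>_. c" "\<bar>c\<bar>" F] by simp
qed

text \<open>Tonelli: the squared norms of the sections are dominated by a function that is
  continuous on a compact time interval and 0 outside it.\<close>

lemma L2_sectionsI:
  fixes f :: "real \<times> 'a::euclidean_space \<Rightarrow> 'b::euclidean_space"
  assumes f: "f \<in> borel_measurable borel" and c: "continuous_on {0..T} c" "\<And>t. 0 \<le> c t"
    and le: "AE t in lborel. (\<integral>\<^sup>+x. ennreal ((norm (f (t, x)))\<^sup>2) \<partial>lborel) \<le> ennreal (indicator {0..T} t *\<^sub>R c t)"
  shows "f \<in> L2 lborel"
proof (rule L2_nn_integralI)
  show "f \<in> borel_measurable lborel" using f by simp
  hence [measurable]: "f \<in> borel_measurable (lborel \<Otimes>\<^sub>M lborel)" unfolding lborel_prod .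
  have "integrable lborel (\<lambda>t. indicator {0..T} t *\<^sub>R c t)"
    by (rule borel_integrable_compact[OF compact_Icc c(1)])
  hence fin: "(\<integral>\<^sup>+t. ennreal (indicator {0..T} t *\<^sub>R c t) \<partial>lborel) < \<infinity>"
    by (subst nn_integral_eq_integral) (auto simp: c(2))
  have "(\<integral>\<^sup>+z. ennreal ((norm (f z))\<^sup>2) \<partial>lborel) = (\<integral>\<^sup>+z. ennreal ((norm (f z))\<^sup>2) \<partial>(lborel \<Otimes>\<^sub>M lborel))"
    by (simp add: lborel_prod)
  also have "\<dots> = (\<integral>\<^sup>+t. (\<integral>\<^sup>+x. ennreal ((norm (f (t, x)))\<^sup>2) \<partial>lborel) \<partial>lborel)"
    by (rule lborel.nn_integral_fst[symmetric]) measurable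
  also have "\<dots> \<le> (\<integral>\<^sup>+t. ennreal (indicator {0..T} t *\<^sub>R c t) \<partial>lborel)"
    by (rule nn_integral_mono_AE[OF le])
  finally show "(\<integral>\<^sup>+z. ennreal ((norm (f z))\<^sup>2) \<partial>lborel) < \<infinity>" using fin by (rule le_less_trans)
qed

text \<open>The representative is the pointwise limit of step curves converging fast.\<close>

lemma curve_joint_representative:
  fixes w :: "real \<Rightarrow> ('a::euclidean_space, 'b::euclidean_space) l2"
  assumes w: "continuous_on {0..T} w"
  shows "\<exists>f::real \<times> 'a \<Rightarrow> 'b. f \<in> borel_measurable borel \<and>
    (\<forall>t\<in>{0..T}. (\<lambda>x. f (t, x)) \<in> L2 lborel \<and> cls (\<lambda>x. f (t, x)) = w t) \<and>
    (\<forall>t x. t \<notin> {0..T} \<longrightarrow> f (t, x) = 0)"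
proof -
  have uc: "uniformly_continuous_on {0..T} w"
    by (rule compact_uniformly_continuous[OF w]) simp
  \<comment> \<open>The tolerance is half of \<open>(1/2)^n\<close> because consecutive step curves
    are compared through \<open>w\<close>, and the two errors together must stay below
    \<open>(1/2)^n\<close>.\<close>
  have "\<exists>d>0. \<forall>s\<in>{0..T}. \<forall>t\<in>{0..T}. dist s t < d \<longrightarrow> dist (w s) (w t) < (1/2)^n / 2" for n :: nat
  proof -
    have "0 < (1/2::real)^n / 2" by simp
    then obtain d where "d > 0" "\<forall>s\<in>{0..T}. \<forall>t\<in>{0..T}. dist t s < d \<longrightarrow> dist (w t) (w s) < (1/2)^n / 2"
      using uc unfolding uniformly_continuous_on_def by blast
    thus ?thesis by (intro exI[of _ d]) auto
  qed
  then obtain d where d: "\<And>n. d n > 0"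
    "\<And>n s t. s \<in> {0..T} \<Longrightarrow> t \<in> {0..T} \<Longrightarrow> dist s t < d n \<Longrightarrow> dist (w s) (w t) < (1/2)^n / 2"
    by metis
  define e where "e n = d n / 2" for n
  have e: "e n > 0" for n using d(1) by (simp add: e_def)
  \<comment> \<open>Times are rounded down to the grid of width \<open>e n\<close>, so a sample of a
    time in \<open>[0, T]\<close> stays in \<open>[0, T]\<close>.\<close>
  define \<tau> where "\<tau> n t = e n * real_of_int \<lfloor>t / e n\<rfloor>" for n t
  have \<tau>: "\<tau> n t \<in> {0..T}" "dist (\<tau> n t) t < d n" if "t \<in> {0..T}" for n t
  proof -
    have "\<tau> n t \<le> t" unfolding \<tau>_def using e[of n] mult_left_mono[OF of_int_floor_le[of "t / e n"], of "e n"] by simp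
    moreover have "t - \<tau> n t < e n"
      unfolding \<tau>_def using e[of n] floor_correct[of "t / e n"] by (simp add: field_simps)
    moreover have "0 \<le> \<tau> n t" unfolding \<tau>_def using that e[of n] by simp
    ultimately show "\<tau> n t \<in> {0..T}" "dist (\<tau> n t) t < d n"
      using that d(1)[of n] by (auto simp: dist_real_def e_def)
  qed
  define F where "F n z = indicator {0..T} (fst z) *\<^sub>R rep (w (\<tau> n (fst z))) (snd z)" for n z
  have meas: "F n \<in> borel_measurable (lborel \<Otimes>\<^sub>M lborel)" for n
  proof -
    \<comment> \<open>For a fixed grid index the function depends on \<open>x\<close> only; the step
      curve selects among countably many such functions by a measurable integer index, which gives
      joint measurability.\<close>
    have 1: "(\<lambda>z::real \<times> 'a. rep (w (e n * real_of_int i)) (snd z)) \<in> borel_measurable (lborel \<Otimes>\<^sub>M lborel)" for i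
      by measurable
    have 2: "(\<lambda>z::real \<times> 'a. \<lfloor>fst z / e n\<rfloor>) \<in> measurable (lborel \<Otimes>\<^sub>M lborel) (count_space UNIV)"
      by measurable
    have "(\<lambda>z::real \<times> 'a. rep (w (\<tau> n (fst z))) (snd z)) \<in> borel_measurable (lborel \<Otimes>\<^sub>M lborel)"
      unfolding \<tau>_def by (rule measurable_compose_countable[OF 1 2])
    thus ?thesis unfolding F_def[abs_def] by measurable
  qed
  have sec: "(\<lambda>x. F n (t, x)) = rep (w (\<tau> n t))" if "t \<in> {0..T}" for n t
    using that by (auto simp: F_def)
  have close: "norm (w (\<tau> n t) - w t) \<le> (1/2)^n / 2" if "t \<in> {0..T}" for n t
    using d(2)[OF \<tau>(1)[OF that, of n] that \<tau>(2)[OF that, of n]] by (simp add: dist_norm)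
  have fast: "norm (cls (\<lambda>x. F (Suc n) (t, x)) - cls (\<lambda>x. F n (t, x))) \<le> (1/2)^n" if "t \<in> {0..T}" for n t
  proof -
    have "norm (w (\<tau> (Suc n) t) - w (\<tau> n t)) \<le> norm (w (\<tau> (Suc n) t) - w t) + norm (w (\<tau> n t) - w t)"
      using norm_triangle_ineq4[of "w (\<tau> (Suc n) t) - w t" "w (\<tau> n t) - w t"] by simp
    also have "\<dots> \<le> (1/2)^Suc n / 2 + (1/2)^n / 2" using close[OF that] by (intro add_mono)
    also have "\<dots> \<le> (1/2)^n" by simp
    finally show ?thesis by (simp add: sec[OF that])
  qed
  show ?thesis
  proof (intro exI[of _ "plim F"] conjI ballI allI impI)
    show "plim F \<in> borel_measurable borel"
      using borel_measurable_plim[OF meas] unfolding lborel_prod by simp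
    fix t assume t: "t \<in> {0..T}"
    have eq: "(\<lambda>x. plim F (t, x)) = plim (\<lambda>n x. F n (t, x))" by (simp add: plim_def fun_eq_iff)
    have L: "(\<lambda>x. F n (t, x)) \<in> L2 lborel" for n by (simp add: sec[OF t] rep_L2)
    show "(\<lambda>x. plim F (t, x)) \<in> L2 lborel"
      unfolding eq by (rule fast_Cauchy_plim(1)[OF L fast[OF t]])
    have "(\<lambda>n. w (\<tau> n t)) \<longlonglongrightarrow> cls (\<lambda>x. plim F (t, x))"
      unfolding eq using fast_Cauchy_plim_tendsto[OF L fast[OF t]] by (simp add: sec[OF t])
    moreover have "(\<lambda>n. w (\<tau> n t)) \<longlonglongrightarrow> w t"
    proof (rule LIM_zero_cancel, rule Lim_null_comparison)
      show "\<forall>\<^sub>F n in sequentially. norm (w (\<tau> n t) - w t) \<le> (1/2) * (1/2)^n"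
        using close[OF t] by simp
      show "(\<lambda>n. (1/2) * (1/2)^n :: real) \<longlonglongrightarrow> 0"
        using tendsto_mult_right_zero[OF LIMSEQ_power_zero[of "1/2::real"], of "1/2"] by simp
    qed
    ultimately show "cls (\<lambda>x. plim F (t, x)) = w t" by (rule LIMSEQ_unique)
  next
    fix t x assume "t \<notin> {0..T}"
    thus "plim F (t, x) = 0" by (intro plim_eq) (simp add: F_def)
  qed
qed

definition curve_rep :: "real \<Rightarrow> (real \<Rightarrow> ('a::euclidean_space, 'b::euclidean_space) l2) \<Rightarrow> real \<times> 'a \<Rightarrow> 'b" where
  "curve_rep T w = (SOME f. f \<in> borel_measurable borel \<and>
    (\<forall>t\<in>{0..T}. (\<lambda>x. f (t, x)) \<in> L2 lborel \<and> cls (\<lambda>x. f (t, x)) = w t) \<and>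
    (\<forall>t x. t \<notin> {0..T} \<longrightarrow> f (t, x) = 0))"

text \<open>The embedding of \<open>C([0,T]; L2)\<close> into space-time \<open>L2\<close>, extended
  by 0 in time.\<close>

definition J :: "real \<Rightarrow> (real \<Rightarrow> ('a::euclidean_space, 'b::euclidean_space) l2) \<Rightarrow> (real \<times> 'a, 'b) l2" where
  "J T w = cls (curve_rep T w)"

context
  fixes T :: real and w :: "real \<Rightarrow> ('a::euclidean_space, 'b::euclidean_space) l2"
  assumes w: "continuous_on {0..T} w"
begin

lemma curve_rep_measurable: "curve_rep T w \<in> borel_measurable borel"
  and curve_rep_section: "t \<in> {0..T} \<Longrightarrow> (\<lambda>x. curve_rep T w (t, x)) \<in> L2 lborel"
    "t \<in> {0..T} \<Longrightarrow> cls (\<lambda>x. curve_rep T w (t, x)) = w t"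
  and curve_rep_outside: "t \<notin> {0..T} \<Longrightarrow> curve_rep T w (t, x) = 0"
  using someI_ex[OF curve_joint_representative[OF w]] unfolding curve_rep_def by blast+

lemma curve_rep_L2: "curve_rep T w \<in> L2 lborel"
proof (rule L2_sectionsI[OF curve_rep_measurable])
  show "continuous_on {0..T} (\<lambda>t. (norm (w t))\<^sup>2)" by (intro continuous_intros w)
  have "(\<integral>\<^sup>+x. ennreal ((norm (curve_rep T w (t, x)))\<^sup>2) \<partial>lborel) = ennreal (indicator {0..T} t *\<^sub>R (norm (w t))\<^sup>2)" for t
    using nn_integral_cls[OF curve_rep_section(1)] curve_rep_section(2) curve_rep_outside
    by (cases "t \<in> {0..T}") auto
  thus "AE t in lborel. (\<integral>\<^sup>+x. ennreal ((norm (curve_rep T w (t, x)))\<^sup>2) \<partial>lborel)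
      \<le> ennreal (indicator {0..T} t *\<^sub>R (norm (w t))\<^sup>2)" by simp
qed simp

lemma slice_J: "AE t in lborel. slice (J T w) t = indicator {0..T} t *\<^sub>R w t"
  using slice_cls[OF curve_rep_L2] unfolding J_def
proof eventually_elim
  case (elim t)
  thus ?case using curve_rep_section(2)[of t] curve_rep_outside[of t] cls_zero
    by (cases "t \<in> {0..T}") auto
qed

text \<open>Measurability of \<open>w t \<bullet> slice F t\<close> comes from the joint
  representative of \<open>w\<close>; the curve itself may then stand in for the slices of
  \<open>J T w\<close> in every pairing.\<close>

lemma inner_J_left:
  "J T w \<bullet> F = (\<integral>t. indicator {0..T} t *\<^sub>R (w t \<bullet> slice F t) \<partial>lborel)"
  "integrable lborel (\<lambda>t. indicator {0..T} t *\<^sub>R (w t \<bullet> slice F t))"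
proof -
  have m: "(\<lambda>t. indicator {0..T} t *\<^sub>R (w t \<bullet> slice F t)) \<in> borel_measurable borel"
  proof -
    have "(\<lambda>t. indicator {0..T} t *\<^sub>R (w t \<bullet> slice F t)) = (\<lambda>t. if t \<in> {0..T} \<and> (\<lambda>x. rep F (t, x)) \<in> L2 lborel
      then \<integral>x. curve_rep T w (t, x) \<bullet> rep F (t, x) \<partial>lborel else 0)"
    proof
      fix t
      have "w t \<bullet> cls (\<lambda>x. rep F (t, x)) = (\<integral>x. curve_rep T w (t, x) \<bullet> rep F (t, x) \<partial>lborel)"
        if "t \<in> {0..T}" "(\<lambda>x. rep F (t, x)) \<in> L2 lborel"
        using inner_cls[OF curve_rep_section(1)[OF that(1)] that(2)] curve_rep_section(2)[OF that(1)] by simp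
      thus "indicator {0..T} t *\<^sub>R (w t \<bullet> slice F t) = (if t \<in> {0..T} \<and> (\<lambda>x. rep F (t, x)) \<in> L2 lborel
        then \<integral>x. curve_rep T w (t, x) \<bullet> rep F (t, x) \<partial>lborel else 0)"
        by (auto simp: slice_def)
    qed
    moreover have [measurable]: "{t. (\<lambda>x. rep F (t, x)) \<in> L2 lborel} \<in> sets borel"
      by (rule sets_L2_sections) simp
    have [measurable]: "curve_rep T w \<in> borel_measurable (lborel \<Otimes>\<^sub>M lborel)" "rep F \<in> borel_measurable (lborel \<Otimes>\<^sub>M lborel)"
      unfolding lborel_prod using curve_rep_measurable by simp_all
    have "(\<lambda>t. \<integral>x. curve_rep T w (t, x) \<bullet> rep F (t, x) \<partial>lborel) \<in> borel_measurable lborel" by measurable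
    hence [measurable]: "(\<lambda>t. \<integral>x. curve_rep T w (t, x) \<bullet> rep F (t, x) \<partial>lborel) \<in> borel_measurable borel" by simp
    have "(\<lambda>t. if t \<in> {0..T} \<inter> {t. (\<lambda>x. rep F (t, x)) \<in> L2 lborel}
      then \<integral>x. curve_rep T w (t, x) \<bullet> rep F (t, x) \<partial>lborel else 0) \<in> borel_measurable borel" by measurable
    ultimately show ?thesis by simp
  qed
  have eq: "AE t in lborel. slice (J T w) t \<bullet> slice F t = indicator {0..T} t *\<^sub>R (w t \<bullet> slice F t)"
    using slice_J by eventually_elim simp
  show "J T w \<bullet> F = (\<integral>t. indicator {0..T} t *\<^sub>R (w t \<bullet> slice F t) \<partial>lborel)"
    unfolding inner_slice by (rule integral_cong_AE[OF _ _ eq]) (use m in auto)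
  show "integrable lborel (\<lambda>t. indicator {0..T} t *\<^sub>R (w t \<bullet> slice F t))"
    by (rule integrable_cong_AE[THEN iffD1, OF _ _ eq integrable_inner_slice]) (use m in auto)
qed

end

lemma inner_J:
  assumes w: "continuous_on {0..T} w" and v: "continuous_on {0..T} v"
  shows "J T w \<bullet> J T v = integral {0..T} (\<lambda>t. w t \<bullet> v t)"
proof -
  have c: "continuous_on {0..T} (\<lambda>t. w t \<bullet> v t)" by (intro continuous_intros w v)
  have "integrable lborel (\<lambda>t. indicator {0..T} t *\<^sub>R (w t \<bullet> v t))"
    by (rule borel_integrable_compact[OF compact_Icc c])
  hence s: "set_integrable lborel {0..T} (\<lambda>t. w t \<bullet> v t)" by (simp add: set_integrable_def)
  have "J T w \<bullet> J T v = (\<integral>t. indicator {0..T} t *\<^sub>R (w t \<bullet> v t) \<partial>lborel)"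
    unfolding inner_slice
  proof (rule integral_cong_AE)
    show "AE t in lborel. slice (J T w) t \<bullet> slice (J T v) t = indicator {0..T} t *\<^sub>R (w t \<bullet> v t)"
      using slice_J[OF w] slice_J[OF v] by eventually_elim (auto simp: indicator_def)
  qed (use s in \<open>auto simp: set_integrable_def\<close>)
  also have "\<dots> = integral {0..T} (\<lambda>t. w t \<bullet> v t)"
    using set_borel_integral_eq_integral(2)[OF s] by (simp add: set_lebesgue_integral_def)
  finally show ?thesis .
qed

lemma norm_J: "continuous_on {0..T} w \<Longrightarrow> (norm (J T w))\<^sup>2 = integral {0..T} (\<lambda>t. (norm (w t))\<^sup>2)"
  by (simp add: power2_norm_eq_inner inner_J)

text \<open>The predicate that selects \<open>curve_rep\<close> sees the curve only on
  \<open>[0, T]\<close>, so the two choices are literally the same function.\<close>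

lemma J_cong: "(\<And>t. t \<in> {0..T} \<Longrightarrow> w t = v t) \<Longrightarrow> J T w = J T v"
  unfolding J_def curve_rep_def by (metis (no_types, lifting))

lemma J_add:
  assumes w: "continuous_on {0..T} w" and v: "continuous_on {0..T} v"
  shows "J T (\<lambda>t. w t + v t) = J T w + J T v"
proof (rule slice_eqI)
  note slice_J[OF w] slice_J[OF v] slice_J[OF continuous_on_add[OF w v]] slice_add[of "J T w" "J T v"]
  thus "AE t in lborel. slice (J T (\<lambda>t. w t + v t)) t = slice (J T w + J T v) t"
    by eventually_elim (simp add: scaleR_add_right)
qed

lemma J_diff:
  assumes w: "continuous_on {0..T} w" and v: "continuous_on {0..T} v"
  shows "J T (\<lambda>t. w t - v t) = J T w - J T v"
proof (rule slice_eqI)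
  note slice_J[OF w] slice_J[OF v] slice_J[OF continuous_on_diff[OF w v]] slice_diff[of "J T w" "J T v"]
  thus "AE t in lborel. slice (J T (\<lambda>t. w t - v t)) t = slice (J T w - J T v) t"
    by eventually_elim (simp add: scaleR_diff_right)
qed

lemma mult_J:
  assumes w: "continuous_on {0..T} w" and m: "continuous_on UNIV m" and C: "\<And>t. \<bar>m t\<bar> \<le> C"
  shows "mult (\<lambda>z. m (fst z)) (J T w) = J T (\<lambda>t. m t *\<^sub>R w t)"
proof (rule slice_eqI)
  have "continuous_on {0..T} (\<lambda>t. m t *\<^sub>R w t)"
    by (intro continuous_intros w continuous_on_subset[OF m]) auto
  note slice_J[OF this] slice_J[OF w] slice_mult[OF borel_measurable_continuous_onI[OF m] C, of "J T w"]
  thus "AE t in lborel. slice (mult (\<lambda>z. m (fst z)) (J T w)) t = slice (J T (\<lambda>t. m t *\<^sub>R w t)) t"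
    by eventually_elim (simp add: indicator_def)
qed

lemma J_scaleR:
  assumes w: "continuous_on {0..T} w"
  shows "J T (\<lambda>t. c *\<^sub>R w t) = c *\<^sub>R J T w"
proof (rule slice_eqI)
  note slice_J[OF w] slice_J[OF continuous_on_scaleR[OF continuous_on_const w, of c]] slice_scaleR[of c "J T w"]
  thus "AE t in lborel. slice (J T (\<lambda>t. c *\<^sub>R w t)) t = slice (c *\<^sub>R J T w) t"
    by eventually_elim simp
qed

lemma inner_J_const_left:
  "J t (\<lambda>_. v) \<bullet> F = (\<integral>s. indicator {0..t} s *\<^sub>R (v \<bullet> slice F s) \<partial>lborel)"
  by (rule inner_J_left(1)) simp

text \<open>Continuous cutoffs fall linearly from 1 to 0 on \<open>[t, t + 1 / (n + 1)]\<close>, and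
  the error is supported there. They bring the discontinuous test elements
  \<open>J t (\<lambda>_. v)\<close> into closures of continuous curves.\<close>

lemma J_const_approx:
  assumes t: "0 \<le> t" "t \<le> T"
  shows "(\<lambda>n. J T (\<lambda>s. max 0 (min 1 (1 - real (Suc n) * (s - t))) *\<^sub>R v)) \<longlonglongrightarrow> J t (\<lambda>_. v)"
proof (rule LIM_zero_cancel, rule tendsto_norm_zero_cancel)
  define c where "c n s = max 0 (min 1 (1 - real (Suc n) * (s - t)))" for n s
  have cc: "continuous_on {0..T} (\<lambda>s. c n s *\<^sub>R v)" for n unfolding c_def by (intro continuous_intros)
  have c1: "c n s = 1" if "s \<le> t" for n s
  proof -
    have "real (Suc n) * (s - t) \<le> 0" using that by (intro mult_nonneg_nonpos) auto
    thus ?thesis by (simp add: c_def)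
  qed
  have c0: "c n s = 0" if "t + 1 / real (Suc n) \<le> s" for n s
  proof -
    have "real (Suc n) * (s - t) \<ge> real (Suc n) * (1 / real (Suc n))" using that by (intro mult_left_mono) auto
    thus ?thesis by (simp add: c_def)
  qed
  have c01: "0 \<le> c n s" "c n s \<le> 1" for n s by (auto simp: c_def)
  have bd: "norm (J T (\<lambda>s. c n s *\<^sub>R v) - J t (\<lambda>_. v)) \<le> sqrt ((1 / real (Suc n)) * (norm v)\<^sup>2)" for n
  proof (rule real_le_rsqrt)
    let ?I = "\<lambda>s. indicator {t..t + 1 / real (Suc n)} s *\<^sub>R (norm v)\<^sup>2"
    have "(norm (J T (\<lambda>s. c n s *\<^sub>R v) - J t (\<lambda>_. v)))\<^sup>2 \<le> (\<integral>s. ?I s \<partial>lborel)"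
      unfolding norm_slice
    proof (rule integral_mono_AE[OF integrable_norm_slice])
      show "integrable lborel ?I"
        by (rule integrable_scaleR_left) (auto intro!: integrable_real_indicator simp: emeasure_lborel_Icc_eq)
      show "AE s in lborel. (norm (slice (J T (\<lambda>s. c n s *\<^sub>R v) - J t (\<lambda>_. v)) s))\<^sup>2 \<le> ?I s"
        using slice_J[OF cc[of n]] slice_J[of t "\<lambda>_. v", OF continuous_on_const] slice_diff[of "J T (\<lambda>s. c n s *\<^sub>R v)" "J t (\<lambda>_. v)"]
      proof eventually_elim
        case (elim s)
        have "\<bar>indicator {0..T} s * c n s - indicator {0..t} s\<bar> \<le> indicator {t..t + 1 / real (Suc n)} s"
          using c1[of s n] c0[of n s] c01[of n s] t by (auto simp: indicator_def)
        hence "(indicator {0..T} s * c n s - indicator {0..t} s)\<^sup>2 \<le> (indicator {t..t + 1 / real (Suc n)} s :: real)\<^sup>2"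
          by (metis abs_ge_zero power2_abs power_mono)
        hence "(indicator {0..T} s * c n s - indicator {0..t} s)\<^sup>2 * (norm v)\<^sup>2
            \<le> (indicator {t..t + 1 / real (Suc n)} s :: real)\<^sup>2 * (norm v)\<^sup>2"
          by (rule mult_right_mono) simp
        moreover have "(indicator {t..t + 1 / real (Suc n)} s :: real)\<^sup>2 = indicator {t..t + 1 / real (Suc n)} s"
          by (simp add: indicator_def)
        moreover have "slice (J T (\<lambda>s. c n s *\<^sub>R v) - J t (\<lambda>_. v)) s = (indicator {0..T} s * c n s - indicator {0..t} s) *\<^sub>R v"
          using elim by (simp add: scaleR_diff_left)
        ultimately show ?case by (simp only: norm_scaleR power_mult_distrib power2_abs real_scaleR_def)
      qed
    qed
    also have "\<dots> = (1 / real (Suc n)) * (norm v)\<^sup>2" by simp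
    finally show "(norm (J T (\<lambda>s. c n s *\<^sub>R v) - J t (\<lambda>_. v)))\<^sup>2 \<le> (1 / real (Suc n)) * (norm v)\<^sup>2" .
  qed
  have "(\<lambda>n. sqrt (inverse (real (Suc n)) * (norm v)\<^sup>2)) \<longlonglongrightarrow> sqrt (0 * (norm v)\<^sup>2)"
    by (intro tendsto_intros LIMSEQ_inverse_real_of_nat)
  hence "(\<lambda>n. sqrt ((1 / real (Suc n)) * (norm v)\<^sup>2)) \<longlonglongrightarrow> 0" by (simp add: divide_inverse)
  thus "(\<lambda>n. norm (J T (\<lambda>s. max 0 (min 1 (1 - real (Suc n) * (s - t))) *\<^sub>R v) - J t (\<lambda>_. v))) \<longlonglongrightarrow> 0"
    unfolding c_def[symmetric]
    by (rule Lim_null_comparison[rotated]) (use bd in simp)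
qed

section \<open>Density of the data of smooth trajectories\<close>

text \<open>Telescoping over a uniform partition of mesh below \<open>d\<close>: the increments of
  \<open>\<Gamma>\<close> add up exactly, so the factor \<open>e\<close> is not multiplied by the
  number of intervals.\<close>

lemma partition_increment_bound:
  fixes \<phi> \<Gamma> :: "real \<Rightarrow> real"
  assumes T: "T \<ge> 0" and \<phi>: "\<phi> 0 = 0" and d: "d > 0"
    and inc: "\<And>s t. 0 \<le> s \<Longrightarrow> s \<le> t \<Longrightarrow> t \<le> T \<Longrightarrow> t - s < d \<Longrightarrow> \<bar>\<phi> t - \<phi> s\<bar> \<le> e * (\<Gamma> t - \<Gamma> s)"
  shows "\<bar>\<phi> T\<bar> \<le> e * (\<Gamma> T - \<Gamma> 0)"
proof -
  obtain n :: nat where n: "T / d < real n" using reals_Archimedean2 by blast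
  hence n0: "n > 0" using T d by (cases n) (auto simp: field_simps divide_less_0_iff)
  define h where "h = T / real n"
  have h: "0 \<le> h" "h < d" "real n * h = T" using n n0 T d by (auto simp: h_def field_simps)
  have "k \<le> n \<Longrightarrow> \<bar>\<phi> (real k * h)\<bar> \<le> e * (\<Gamma> (real k * h) - \<Gamma> 0)" for k
  proof (induction k)
    case (Suc k)
    have eq: "real (Suc k) * h = real k * h + h" by (simp add: algebra_simps)
    have le: "real (Suc k) * h \<le> T" unfolding h(3)[symmetric]
      using Suc.prems h(1) by (intro mult_right_mono) auto
    have k0: "0 \<le> real k * h" using h(1) by simp
    have "\<bar>\<phi> (real (Suc k) * h) - \<phi> (real k * h)\<bar> \<le> e * (\<Gamma> (real (Suc k) * h) - \<Gamma> (real k * h))"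
      by (rule inc[OF k0 _ le]) (use eq h in linarith)+
    with Suc show ?case by (simp add: right_diff_distrib)
  qed (simp add: \<phi>)
  from this[of n] show ?thesis by (simp add: h(3))
qed

text \<open>The bound on \<open>a\<close> is required everywhere, so that \<open>mult a\<close> is a
  bounded operator at once; an essentially bounded potential is clipped first
  (\<open>pot\<close>).\<close>

locale heat_form = form_graph V
  for V :: "(('a::euclidean_space, real) l2 \<times> ('a, 'a) l2) set" +
  fixes T :: real and a :: "real \<times> 'a \<Rightarrow> real" and A :: real
  assumes T: "T > 0" and a_meas: "a \<in> borel_measurable borel" and a_le: "\<And>z. \<bar>a z\<bar> \<le> A"
begin

lemma A_nonneg: "A \<ge> 0" using a_le[of 0] by linarith

text \<open>Only the projection of a source onto \<open>Q0\<close> enters the weak formulation.\<close>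

definition curves :: "(real \<Rightarrow> ('a, real) l2) set" where
  "curves = {w. continuous_on {0..T} w \<and> (\<forall>t\<in>{0..T}. w t \<in> Hb)}"

definition Q0 :: "(real \<times> 'a, real) l2 set" where "Q0 = closure (J T ` curves)"

lemma curvesD: "w \<in> curves \<Longrightarrow> continuous_on {0..T} w" "w \<in> curves \<Longrightarrow> t \<in> {0..T} \<Longrightarrow> w t \<in> Hb"
  by (auto simp: curves_def)

lemma curves_add: "w \<in> curves \<Longrightarrow> v \<in> curves \<Longrightarrow> (\<lambda>t. w t + v t) \<in> curves"
  and curves_diff: "w \<in> curves \<Longrightarrow> v \<in> curves \<Longrightarrow> (\<lambda>t. w t - v t) \<in> curves"
  by (simp_all add: curves_def continuous_on_add continuous_on_diff subspace_add[OF subspace_Hb] subspace_diff[OF subspace_Hb])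

lemma curves_mult: "continuous_on {0..T} m \<Longrightarrow> w \<in> curves \<Longrightarrow> (\<lambda>t. m t *\<^sub>R w t) \<in> curves"
  by (simp add: curves_def continuous_on_scaleR subspace_scale[OF subspace_Hb])

lemma curves_const: "h \<in> Hb \<Longrightarrow> (\<lambda>_. h) \<in> curves"
  by (auto simp: curves_def)

lemma curves_R: "w \<in> curves \<Longrightarrow> (\<lambda>t. R (w t)) \<in> curves"
  by (simp add: curves_def R_in_Hb R.continuous_on)

text \<open>The projection onto \<open>Hb\<close> commutes with the integral and fixes the
  integrand, so the integral stays in \<open>Hb\<close>.\<close>

lemma curves_W: assumes w: "w \<in> curves" "w0 \<in> Hb" shows "W w0 w \<in> curves"
proof -
  have "integral {0..t} w \<in> Hb" if t: "t \<in> {0..T}" for t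
  proof -
    have i: "w integrable_on {0..t}"
      by (intro integrable_continuous_real continuous_on_subset[OF curvesD(1)[OF w(1)]]) (use t in auto)
    have "proj Hb (integral {0..t} w) = integral {0..t} (proj Hb \<circ> w)"
      by (rule integral_linear[OF i bounded_linear_proj[OF subspace_Hb closed_Hb], symmetric])
    also have "\<dots> = integral {0..t} w"
      by (rule integral_cong) (use curvesD(2)[OF w(1)] t in \<open>auto simp: proj_id[OF subspace_Hb closed_Hb]\<close>)
    finally show ?thesis using proj_in[OF subspace_Hb closed_Hb] by metis
  qed
  thus ?thesis using continuous_W[OF less_imp_le[OF T] curvesD(1)[OF w(1)]] w(2)
    by (auto simp: curves_def W_def intro: subspace_add[OF subspace_Hb])
qed

lemma curves_src: "w \<in> curves \<Longrightarrow> w0 \<in> Hb \<Longrightarrow> src w0 w \<in> curves"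
  using curves_diff[OF curves_add[OF curves_R curves_W] curves_R[OF curves_W]] by (simp add: src_def[abs_def])

lemma subspace_J_curves: "subspace (J T ` curves)"
proof (rule subspaceI)
  have z: "(\<lambda>_. 0) \<in> curves" by (rule curves_const[OF subspace_0[OF subspace_Hb]])
  have "J T (\<lambda>_. 0) = (0 :: (real \<times> 'a, real) l2)" using J_scaleR[of T "\<lambda>_. 0" 0] by simp
  with z show "0 \<in> J T ` curves" by force
  show "x + y \<in> J T ` curves" if "x \<in> J T ` curves" "y \<in> J T ` curves" for x y
    using that by (auto simp: J_add[symmetric] curvesD intro!: imageI curves_add)
  show "c *\<^sub>R x \<in> J T ` curves" if "x \<in> J T ` curves" for c x
    using that by (auto simp: J_scaleR[symmetric] curvesD intro!: imageI curves_mult)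
qed

lemma subspace_Q0: "subspace Q0"
  unfolding Q0_def by (rule subspace_closure[OF subspace_J_curves])

lemma closed_Q0: "closed Q0"
  unfolding Q0_def by (rule closed_closure)

lemma J_in_Q0: "w \<in> curves \<Longrightarrow> J T w \<in> Q0"
  unfolding Q0_def by (rule subsetD[OF closure_subset imageI])

lemma J_const_in_Q0: assumes "h \<in> Hb" "t \<in> {0..T}" shows "J t (\<lambda>_. h) \<in> Q0"
proof (rule closed_sequentially[OF closed_Q0])
  show "(\<lambda>n. J T (\<lambda>s. max 0 (min 1 (1 - real (Suc n) * (s - t))) *\<^sub>R h)) \<longlonglongrightarrow> J t (\<lambda>_. h)"
    by (rule J_const_approx) (use assms in auto)
  show "J T (\<lambda>s. max 0 (min 1 (1 - real (Suc n) * (s - t))) *\<^sub>R h) \<in> Q0" for n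
    by (intro J_in_Q0 curves_mult curves_const assms continuous_intros)
qed

text \<open>The component of \<open>h\<close> orthogonal to the closed range stays in
  \<open>Hb\<close> and is orthogonal to every \<open>R k\<close>, so \<open>R_dense\<close> makes
  it vanish.\<close>

lemma R_range_dense: "Hb \<subseteq> closure (range R)"
proof
  have S: "subspace (closure (range R))" "closed (closure (range R))"
    by (auto intro!: subspace_closure linear_subspace_image bounded_linear.linear bounded_linear_R)
  fix h assume h: "h \<in> Hb"
  have "closure (range R) \<subseteq> Hb" by (rule closure_minimal) (auto simp: R_in_Hb closed_Hb)
  hence "h - proj (closure (range R)) h \<in> Hb"
    using h proj_in[OF S] by (intro subspace_diff[OF subspace_Hb]) auto
  moreover have "(h - proj (closure (range R)) h) \<bullet> R k = 0" for k
    by (rule proj_orth[OF S subsetD[OF closure_subset rangeI]])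
  ultimately have "h - proj (closure (range R)) h = 0" by (rule R_dense)
  thus "h \<in> closure (range R)" using proj_in[OF S, of h] by (simp only: right_minus_eq)
qed

text \<open>On short intervals a curve is nearly constant.\<close>

lemma orth_steps_imp_orth_curve:
  assumes g: "\<And>t h. t \<in> {0..T} \<Longrightarrow> h \<in> Hb \<Longrightarrow> g \<bullet> J t (\<lambda>_. h) = 0" and w: "w \<in> curves"
  shows "g \<bullet> J T w = 0"
proof -
  have cw: "continuous_on {0..t} w" if "t \<le> T" for t
    by (rule continuous_on_subset[OF curvesD(1)[OF w]]) (use that in auto)
  have ng: "integrable lborel (\<lambda>s. indicator {0..t} s *\<^sub>R norm (slice g s))" for t
  proof (rule Bochner_Integration.integrable_bound)
    have "integrable lborel (\<lambda>s. indicator {0..t} s :: real)"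
      by (auto intro!: integrable_real_indicator simp: emeasure_lborel_Icc_eq)
    thus "integrable lborel (\<lambda>s. indicator {0..t} s + (norm (slice g s))\<^sup>2)"
      using integrable_norm_slice[of g] by (intro Bochner_Integration.integrable_add)
    have "norm (slice g s) = sqrt ((norm (slice g s))\<^sup>2)" for s by simp
    moreover have "(\<lambda>s. sqrt ((norm (slice g s))\<^sup>2)) \<in> borel_measurable borel" by measurable
    ultimately have [measurable]: "(\<lambda>s. norm (slice g s)) \<in> borel_measurable borel" by simp
    show "(\<lambda>s. indicator {0..t} s *\<^sub>R norm (slice g s)) \<in> borel_measurable lborel" by measurable
    have "r \<le> 1 + r\<^sup>2" if "r \<ge> 0" for r :: real
      using sum_squares_bound[of r 1] that by simp
    thus "AE s in lborel. norm (indicator {0..t} s *\<^sub>R norm (slice g s)) \<le> norm (indicator {0..t} s + (norm (slice g s))\<^sup>2)"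
      by (auto simp: indicator_def)
  qed
  define \<Gamma> where "\<Gamma> t = (\<integral>s. indicator {0..t} s *\<^sub>R norm (slice g s) \<partial>lborel)" for t
  define \<phi> where "\<phi> t = J t w \<bullet> g" for t
  have \<phi>0: "\<phi> 0 = 0"
  proof -
    have "(norm (J 0 w))\<^sup>2 = 0" by (subst norm_J) (use cw[of 0] T in auto)
    thus ?thesis by (simp add: \<phi>_def)
  qed
  have "\<bar>\<phi> T\<bar> \<le> e * (\<Gamma> T - \<Gamma> 0)" if e: "e > 0" for e
  proof -
    have "uniformly_continuous_on {0..T} w"
      by (rule compact_uniformly_continuous[OF curvesD(1)[OF w]]) simp
    then obtain d where d: "d > 0" "\<And>s t. s \<in> {0..T} \<Longrightarrow> t \<in> {0..T} \<Longrightarrow> dist t s < d \<Longrightarrow> dist (w t) (w s) < e"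
      using e unfolding uniformly_continuous_on_def by blast
    show ?thesis
    proof (rule partition_increment_bound[where d=d and \<phi>=\<phi> and \<Gamma>=\<Gamma>, OF less_imp_le[OF T] \<phi>0 d(1)])
      fix s t assume st: "0 \<le> s" "s \<le> t" "t \<le> T" "t - s < d"
      have z: "J r (\<lambda>_. w s) \<bullet> g = 0" if "r \<in> {0..T}" for r
        using g[OF that curvesD(2)[OF w, of s]] st by (simp add: inner_commute)
      \<comment> \<open>The curve is compared with the constant \<open>w s\<close>, whose pairings
        with \<open>g\<close> vanish by hypothesis. Only \<open>w r - w s\<close> on
        \<open>(s, t]\<close> survives, and uniform continuity makes it smaller than
        \<open>e\<close>.\<close>
      let ?f = "\<lambda>r. indicator {0..t} r *\<^sub>R (w r \<bullet> slice g r) - indicator {0..s} r *\<^sub>R (w r \<bullet> slice g r)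
         - (indicator {0..t} r *\<^sub>R (w s \<bullet> slice g r) - indicator {0..s} r *\<^sub>R (w s \<bullet> slice g r))"
      note i = inner_J_left[OF cw[of t], of g] inner_J_left[OF cw[of s], of g]
        inner_J_left[of t "\<lambda>_. w s", OF continuous_on_const, of g] inner_J_left[of s "\<lambda>_. w s", OF continuous_on_const, of g]
      have eq1: "\<phi> t - \<phi> s = (J t w \<bullet> g - J s w \<bullet> g) - (J t (\<lambda>_. w s) \<bullet> g - J s (\<lambda>_. w s) \<bullet> g)"
        using z[of t] z[of s] st by (simp add: \<phi>_def)
      have eq2: "(J t w \<bullet> g - J s w \<bullet> g) - (J t (\<lambda>_. w s) \<bullet> g - J s (\<lambda>_. w s) \<bullet> g) = (\<integral>r. ?f r \<partial>lborel)"
        using i st by (simp add: Bochner_Integration.integral_diff Bochner_Integration.integrable_diff)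
      have "\<bar>\<phi> t - \<phi> s\<bar> \<le> (\<integral>r. e * (indicator {0..t} r *\<^sub>R norm (slice g r) - indicator {0..s} r *\<^sub>R norm (slice g r)) \<partial>lborel)"
        unfolding eq1 eq2
      proof (rule integral_abs_bound_integral)
        show "integrable lborel ?f" using i st by (intro Bochner_Integration.integrable_diff) auto
        show "integrable lborel (\<lambda>r. e * (indicator {0..t} r *\<^sub>R norm (slice g r) - indicator {0..s} r *\<^sub>R norm (slice g r)))"
          by (intro integrable_mult_right Bochner_Integration.integrable_diff ng)
        fix r :: real
        have f: "?f r = (indicator {0..t} r - indicator {0..s} r) * ((w r - w s) \<bullet> slice g r)"
          by (simp add: inner_diff_left algebra_simps)
        show "\<bar>?f r\<bar> \<le> e * (indicator {0..t} r *\<^sub>R norm (slice g r) - indicator {0..s} r *\<^sub>R norm (slice g r))"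
        proof (cases "s < r \<and> r \<le> t")
          case True
          have "\<bar>(w r - w s) \<bullet> slice g r\<bar> \<le> norm (w r - w s) * norm (slice g r)" by (rule Cauchy_Schwarz_ineq2)
          also have "\<dots> \<le> e * norm (slice g r)"
            using d(2)[of s r] True st by (intro mult_right_mono) (auto simp: dist_norm)
          finally show ?thesis using True st by (simp add: f inner_diff_left)
        next
          case False
          hence "indicator {0..t} r = (indicator {0..s} r :: real)" using st by (auto simp: indicator_def)
          thus ?thesis by (simp add: f)
        qed
      qed
      also have "\<dots> = e * (\<Gamma> t - \<Gamma> s)"
        unfolding \<Gamma>_def Bochner_Integration.integral_diff[OF ng[of t] ng[of s], symmetric]
        by (rule integral_mult_right_zero)
      finally show "\<bar>\<phi> t - \<phi> s\<bar> \<le> e * (\<Gamma> t - \<Gamma> s)" .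
    qed
  qed
  note le = this
  have "\<bar>\<phi> T\<bar> \<le> 0"
  proof (rule field_le_epsilon)
    fix e :: real assume e: "e > 0"
    define G where "G = \<Gamma> T - \<Gamma> 0"
    have le': "\<bar>\<phi> T\<bar> \<le> e * G" if "e > 0" for e using le[OF that] by (simp add: G_def)
    have G: "G \<ge> 0" using le'[OF zero_less_one] abs_ge_zero[of "\<phi> T"] by linarith
    \<comment> \<open>Dividing by \<open>1 + G\<close> rather than by \<open>G\<close> also covers
      \<open>G = 0\<close>.\<close>
    have "e / (1 + G) > 0" using e G by (intro divide_pos_pos) linarith+
    from le'[OF this] have "\<bar>\<phi> T\<bar> \<le> e * (G / (1 + G))" by (simp only: times_divide_eq_left times_divide_eq_right)
    also have "\<dots> \<le> e * 1" using e G by (intro mult_left_mono) (simp_all add: divide_le_eq_1)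
    finally show "\<bar>\<phi> T\<bar> \<le> 0 + e" by simp
  qed
  hence "J T w \<bullet> g = 0" by (simp add: \<phi>_def)
  thus ?thesis by (metis inner_commute)
qed

text \<open>Scalar cutoffs commute with \<open>R\<close>, so \<open>g\<close> is orthogonal to steps
  with values in the range of \<open>R\<close>. This range is dense in \<open>Hb\<close>, hence all
  \<open>Hb\<close>-valued steps, then all curves, then \<open>Q0\<close> itself are orthogonal to
  \<open>g\<close>.\<close>

lemma orth_R_curves_imp_0:
  assumes g: "g \<in> Q0" and orth: "\<And>k. k \<in> curves \<Longrightarrow> g \<bullet> J T (\<lambda>t. R (k t)) = 0"
  shows "g = 0"
proof -
  have step: "g \<bullet> J t (\<lambda>_. h) = 0" if t: "t \<in> {0..T}" and h: "h \<in> Hb" for t h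
  proof -
    have R0: "g \<bullet> J t (\<lambda>_. R k) = 0" if k: "k \<in> Hb" for k
    proof (rule LIMSEQ_unique)
      show "(\<lambda>n. g \<bullet> J T (\<lambda>s. max 0 (min 1 (1 - real (Suc n) * (s - t))) *\<^sub>R R k)) \<longlonglongrightarrow> g \<bullet> J t (\<lambda>_. R k)"
        by (intro tendsto_intros J_const_approx) (use t in auto)
      have "g \<bullet> J T (\<lambda>s. max 0 (min 1 (1 - real (Suc n) * (s - t))) *\<^sub>R R k) = 0" for n
      proof -
        have "(\<lambda>s. max 0 (min 1 (1 - real (Suc n) * (s - t))) *\<^sub>R k) \<in> curves"
          by (intro curves_mult curves_const k continuous_intros)
        from orth[OF this] show ?thesis by (simp only: R.scaleR)
      qed
      thus "(\<lambda>n. g \<bullet> J T (\<lambda>s. max 0 (min 1 (1 - real (Suc n) * (s - t))) *\<^sub>R R k)) \<longlonglongrightarrow> 0" by simp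
    qed
    have lin: "J t (\<lambda>_. x - y) = J t (\<lambda>_. x) - J t (\<lambda>_. y)" for x y :: "('a, real) l2"
      by (rule J_diff) auto
    have nrm: "norm (J t (\<lambda>_. x)) = sqrt t * norm x" for x :: "('a, real) l2"
    proof (rule power2_eq_imp_eq)
      show "(norm (J t (\<lambda>_. x)))\<^sup>2 = (sqrt t * norm x)\<^sup>2"
        using norm_J[of t "\<lambda>_. x"] t by (simp add: power_mult_distrib)
    qed (use t in auto)
    obtain x where x: "\<And>n. x n \<in> range R" "x \<longlonglongrightarrow> h"
      using subsetD[OF R_range_dense h] unfolding closure_sequential by auto
    have "\<exists>k\<in>Hb. x n = R k" for n
    proof -
      obtain k where k: "x n = R k" using x(1)[of n] by blast
      \<comment> \<open>By symmetry, \<open>R\<close> annihilates the orthogonal complement of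
        \<open>Hb\<close>, so preimages may be taken in \<open>Hb\<close>.\<close>
      have "R (k - proj Hb k) = 0"
      proof -
        have "R (k - proj Hb k) \<bullet> R (k - proj Hb k) = (k - proj Hb k) \<bullet> R (R (k - proj Hb k))" by (rule R_sym)
        also have "\<dots> = 0" by (rule proj_orth[OF subspace_Hb closed_Hb R_in_Hb])
        finally show ?thesis by simp
      qed
      thus ?thesis using k proj_in[OF subspace_Hb closed_Hb, of k] by (auto simp: R.diff)
    qed
    hence x0: "g \<bullet> J t (\<lambda>_. x n) = 0" for n using R0 by metis
    have "(\<lambda>n. J t (\<lambda>_. x n)) \<longlonglongrightarrow> J t (\<lambda>_. h)"
    proof (rule LIM_zero_cancel, rule tendsto_norm_zero_cancel)
      have "(\<lambda>n. sqrt t * norm (x n - h)) \<longlonglongrightarrow> sqrt t * norm (h - h)" by (intro tendsto_intros x)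
      thus "(\<lambda>n. norm (J t (\<lambda>_. x n) - J t (\<lambda>_. h))) \<longlonglongrightarrow> 0" by (simp add: lin[symmetric] nrm)
    qed
    hence "(\<lambda>n. g \<bullet> J t (\<lambda>_. x n)) \<longlonglongrightarrow> g \<bullet> J t (\<lambda>_. h)" by (intro tendsto_intros)
    thus ?thesis using x0 by (simp add: LIMSEQ_const_iff)
  qed
  have "g \<bullet> x = 0" if "x \<in> Q0" for x
  proof -
    have "closed {x. g \<bullet> x = 0}" by (intro closed_Collect_eq continuous_intros)
    hence "Q0 \<subseteq> {x. g \<bullet> x = 0}"
      unfolding Q0_def by (intro closure_minimal) (auto intro: orth_steps_imp_orth_curve[OF step])
    thus ?thesis using that by auto
  qed
  from this[OF g] show ?thesis by simp
qed

lemma norm_J_mono: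
  assumes w: "continuous_on {0..T} (w :: real \<Rightarrow> ('b::euclidean_space, 'c::euclidean_space) l2)" and t: "t \<in> {0..T}"
  shows "norm (J t w) \<le> norm (J T w)"
proof (rule power2_le_imp_le)
  have sub: "{0..t} \<subseteq> {0..T}" using t by auto
  have "integral {0..t} (\<lambda>t. (norm (w t))\<^sup>2) \<le> integral {0..T} (\<lambda>t. (norm (w t))\<^sup>2)"
    by (rule integral_subset_le[OF sub])
       (auto intro!: integrable_continuous_real continuous_intros w continuous_on_subset[OF w sub])
  thus "(norm (J t w))\<^sup>2 \<le> (norm (J T w))\<^sup>2"
    by (simp add: norm_J[OF w] norm_J[OF continuous_on_subset[OF w sub]])
qed simp

lemma norm_J_le:
  assumes w: "continuous_on {0..T} (w :: real \<Rightarrow> ('b::euclidean_space, 'c::euclidean_space) l2)"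
    and le: "\<And>t. t \<in> {0..T} \<Longrightarrow> norm (w t) \<le> C"
  shows "norm (J T w) \<le> sqrt T * C"
proof (rule power2_le_imp_le)
  have C: "C \<ge> 0" by (rule order_trans[OF norm_ge_zero le[of 0]]) (use T in auto)
  have "(norm (J T w))\<^sup>2 = integral {0..T} (\<lambda>t. (norm (w t))\<^sup>2)" by (rule norm_J[OF w])
  also have "\<dots> \<le> integral {0..T} (\<lambda>t. C\<^sup>2)"
    by (intro integral_le integrable_continuous_real continuous_intros w power_mono le) auto
  also have "\<dots> = (sqrt T * C)\<^sup>2" using T by (simp add: power_mult_distrib)
  finally show "(norm (J T w))\<^sup>2 \<le> (sqrt T * C)\<^sup>2" .
  show "0 \<le> sqrt T * C" using T C by simp
qed

lemma norm_J_R_le: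
  assumes w: "continuous_on {0..T} w"
  shows "norm (J T (\<lambda>t. R (w t))) \<le> norm (J T w)"
proof (rule power2_le_imp_le)
  have "integral {0..T} (\<lambda>t. (norm (R (w t)))\<^sup>2) \<le> integral {0..T} (\<lambda>t. (norm (w t))\<^sup>2)"
    by (intro integral_le integrable_continuous_real continuous_intros w R.continuous_on power_mono norm_R_le) auto
  thus "(norm (J T (\<lambda>t. R (w t))))\<^sup>2 \<le> (norm (J T w))\<^sup>2"
    by (simp add: norm_J[OF w] norm_J[OF R.continuous_on[OF w]])
qed simp

text \<open>Cauchy-Schwarz in time: the integral \<open>h\<close> is paired with itself, and
  \<open>|h|^2\<close> becomes the space-time product of \<open>w\<close> with the constant curve
  \<open>h\<close>.\<close>

lemma norm_integral_le_J:
  assumes w: "continuous_on {0..T} w" and t: "t \<in> {0..T}"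
  shows "norm (integral {0..t} w) \<le> sqrt T * norm (J T w)"
proof -
  have sub: "{0..t} \<subseteq> {0..T}" using t by auto
  have wt: "continuous_on {0..t} w" by (rule continuous_on_subset[OF w sub])
  define h where "h = integral {0..t} w"
  have "(norm h)\<^sup>2 = h \<bullet> integral {0..t} w" by (simp add: h_def power2_norm_eq_inner)
  also have "\<dots> = integral {0..t} ((\<lambda>x. h \<bullet> x) \<circ> w)"
    by (rule integral_linear[OF integrable_continuous_real[OF wt] bounded_linear_inner_right, symmetric])
  also have "\<dots> = J t (\<lambda>_. h) \<bullet> J t w" by (simp add: inner_J wt o_def)
  also have "\<dots> \<le> norm (J t (\<lambda>_. h)) * norm (J t w)" by (rule norm_cauchy_schwarz)
  also have "\<dots> \<le> (sqrt T * norm h) * norm (J T w)"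
    by (intro mult_mono norm_J_mono[OF w t] order_trans[OF norm_J_mono[OF continuous_on_const t]
        norm_J_le[OF continuous_on_const order_refl]]) (use T in auto)
  finally have "norm h * norm h \<le> norm h * (sqrt T * norm (J T w))"
    by (simp add: power2_eq_square mult_ac)
  thus ?thesis unfolding h_def[symmetric] using T by (cases "norm h = 0") (auto simp: mult_le_cancel_left)
qed

text \<open>The 1 comes from \<open>R w\<close>, and one \<open>T\<close> from each of
  \<open>W\<close> and \<open>R W\<close>: integrating in time costs \<open>sqrt T\<close>, and so
  does the passage from a uniform bound to the space-time norm.\<close>

lemma norm_J_src_le:
  assumes w: "continuous_on {0..T} w"
  shows "norm (J T (src 0 w)) \<le> (1 + 2 * T) * norm (J T w)"
proof -
  have T0: "0 \<le> T" using T by simp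
  have cW: "continuous_on {0..T} (W 0 w)" by (rule continuous_W[OF T0 w])
  have "norm (J T (W 0 w)) \<le> sqrt T * (sqrt T * norm (J T w))"
    by (rule norm_J_le[OF cW]) (use norm_integral_le_J[OF w] in \<open>simp add: W_def\<close>)
  hence 1: "norm (J T (W 0 w)) \<le> T * norm (J T w)" using T by (simp add: mult.assoc[symmetric])
  have "J T (src 0 w) = J T (\<lambda>t. R (w t)) + J T (W 0 w) - J T (\<lambda>t. R (W 0 w t))"
    unfolding src_def[abs_def]
    by (simp add: J_diff J_add continuous_on_add R.continuous_on w cW)
  hence "norm (J T (src 0 w)) \<le> norm (J T (\<lambda>t. R (w t)) + J T (W 0 w)) + norm (J T (\<lambda>t. R (W 0 w t)))"
    by (simp add: norm_triangle_ineq4)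
  also have "\<dots> \<le> norm (J T (\<lambda>t. R (w t))) + norm (J T (W 0 w)) + norm (J T (\<lambda>t. R (W 0 w t)))"
    by (intro add_right_mono norm_triangle_ineq)
  also have "\<dots> \<le> norm (J T w) + T * norm (J T w) + T * norm (J T w)"
    by (intro add_mono norm_J_R_le w 1 order_trans[OF norm_J_R_le 1] cW)
  finally show ?thesis by (simp add: algebra_simps)
qed

text \<open>Accretivity: testing with an approximation \<open>J T w\<close> of \<open>g\<close> forces \<open>R g = 0\<close>.\<close>

lemma src_dense:
  assumes g: "g \<in> Q0" and orth: "\<And>w. w \<in> curves \<Longrightarrow> g \<bullet> J T (src 0 w) = 0"
  shows "g = 0"
proof -
  have T0: "0 \<le> T" using T by simp
  obtain X where X: "\<And>n. X n \<in> J T ` curves" "X \<longlonglongrightarrow> g"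
    using g unfolding Q0_def closure_sequential by auto
  have "\<exists>w\<in>curves. X n = J T w" for n using X(1)[of n] by auto
  then obtain w where w: "\<And>n. w n \<in> curves" "\<And>n. X n = J T (w n)" by metis
  note cw = curvesD(1)[OF w(1)]
  have lim: "(\<lambda>n. J T (w n)) \<longlonglongrightarrow> g" using X(2) unfolding w(2)[symmetric] .
  have R_le: "(norm (J T (\<lambda>t. R (w n t))))\<^sup>2 \<le> J T (src 0 (w n)) \<bullet> J T (w n)" for n
  proof -
    have "(norm (J T (\<lambda>t. R (w n t))))\<^sup>2 = integral {0..T} (\<lambda>t. (norm (R (w n t)))\<^sup>2)"
      by (rule norm_J[OF R.continuous_on[OF cw]])
    also have "\<dots> \<le> integral {0..T} (\<lambda>t. R (w n t) \<bullet> w n t)"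
    proof (intro integral_le integrable_continuous_real continuous_intros cw R.continuous_on)
      show "(norm (R (w n t)))\<^sup>2 \<le> R (w n t) \<bullet> w n t" for t
        using R_energy[of "w n t"] by (simp add: inner_commute)
    qed
    also have "\<dots> \<le> integral {0..T} (\<lambda>t. src 0 (w n) t \<bullet> w n t)" by (rule src_accretive[OF T0 cw])
    also have "\<dots> = J T (src 0 (w n)) \<bullet> J T (w n)" by (rule inner_J[OF continuous_src[OF T0 cw] cw, symmetric])
    finally show ?thesis .
  qed
  \<comment> \<open>Since \<open>g\<close> is orthogonal to the source of \<open>w n\<close>, it can
    be subtracted from \<open>J T (w n)\<close>, and the pairing tends to 0.\<close>
  have sm: "J T (src 0 (w n)) \<bullet> J T (w n) \<le> (1 + 2 * T) * norm (J T (w n)) * norm (J T (w n) - g)" for n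
  proof -
    have "J T (src 0 (w n)) \<bullet> J T (w n) = J T (src 0 (w n)) \<bullet> (J T (w n) - g)"
      using orth[OF w(1)[of n]] by (simp add: inner_diff_left inner_diff_right inner_commute)
    also have "\<dots> \<le> norm (J T (src 0 (w n))) * norm (J T (w n) - g)" by (rule norm_cauchy_schwarz)
    also have "\<dots> \<le> (1 + 2 * T) * norm (J T (w n)) * norm (J T (w n) - g)"
      by (intro mult_right_mono norm_J_src_le cw) simp
    finally show ?thesis .
  qed
  have "(\<lambda>n. (1 + 2 * T) * norm (J T (w n)) * norm (J T (w n) - g)) \<longlonglongrightarrow> (1 + 2 * T) * norm g * norm (g - g)"
    by (intro tendsto_intros lim)
  hence z: "(\<lambda>n. (1 + 2 * T) * norm (J T (w n)) * norm (J T (w n) - g)) \<longlonglongrightarrow> 0" by simp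
  have "(\<lambda>n. (norm (J T (\<lambda>t. R (w n t))))\<^sup>2) \<longlonglongrightarrow> 0"
    by (rule tendsto_sandwich[OF _ _ tendsto_const z])
       (auto intro!: always_eventually order_trans[OF R_le sm])
  hence "(\<lambda>n. sqrt ((norm (J T (\<lambda>t. R (w n t))))\<^sup>2)) \<longlonglongrightarrow> sqrt 0" by (rule tendsto_real_sqrt)
  hence R0: "(\<lambda>n. J T (\<lambda>t. R (w n t))) \<longlonglongrightarrow> 0"
    by (simp only: real_sqrt_abs abs_norm_cancel real_sqrt_zero tendsto_norm_zero_iff)
  show ?thesis
  proof (rule orth_R_curves_imp_0[OF g])
    fix k assume k: "k \<in> curves"
    note ck = curvesD(1)[OF k]
    have "J T (w n) \<bullet> J T (\<lambda>t. R (k t)) = J T (\<lambda>t. R (w n t)) \<bullet> J T k" for n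
      unfolding inner_J[OF cw R.continuous_on[OF ck]] inner_J[OF R.continuous_on[OF cw] ck] R_sym ..
    moreover have "(\<lambda>n. J T (\<lambda>t. R (w n t)) \<bullet> J T k) \<longlonglongrightarrow> 0 \<bullet> J T k" by (rule tendsto_inner[OF R0 tendsto_const])
    ultimately have "(\<lambda>n. J T (w n) \<bullet> J T (\<lambda>t. R (k t))) \<longlonglongrightarrow> 0" by simp
    from LIMSEQ_unique[OF tendsto_inner[OF lim tendsto_const] this] show "g \<bullet> J T (\<lambda>t. R (k t)) = 0" .
  qed
qed

section \<open>Linearity of the trajectories, and exponential weights in time\<close>

lemma linear_W:
  assumes "continuous_on {0..T} w" "continuous_on {0..T} v" "t \<in> {0..T}"
  shows "W (w0 + c *\<^sub>R v0) (\<lambda>t. w t + c *\<^sub>R v t) t = W w0 w t + c *\<^sub>R W v0 v t"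
proof -
  have i: "w integrable_on {0..t}" "v integrable_on {0..t}"
    using assms by (auto intro!: integrable_continuous_real intro: continuous_on_subset)
  thus ?thesis unfolding W_def
    by (simp add: integral_add integrable_cmul scaleR_add_right)
qed

lemma linear_src:
  assumes "continuous_on {0..T} w" "continuous_on {0..T} v" "t \<in> {0..T}"
  shows "src (w0 + c *\<^sub>R v0) (\<lambda>t. w t + c *\<^sub>R v t) t = src w0 w t + c *\<^sub>R src v0 v t"
  unfolding src_def linear_W[OF assms] by (simp add: R.add R.scaleR algebra_simps)

text \<open>Clipping \<open>s\<close> to \<open>[0, T]\<close> only serves to make the weight \<open>exp (- l * s)\<close> bounded.\<close>

definition weight :: "real \<Rightarrow> real \<Rightarrow> real" where "weight l s = exp (- l * max 0 (min T s))"

definition E :: "real \<Rightarrow> (real \<times> 'a, real) l2 \<Rightarrow> (real \<times> 'a, real) l2" where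
  "E l = mult (\<lambda>z. weight l (fst z))"

lemma continuous_weight: "continuous_on S (weight l)"
  unfolding weight_def[abs_def] by (intro continuous_intros)

lemma weight_bound: "\<bar>weight l s\<bar> \<le> exp (\<bar>l\<bar> * T)"
proof -
  have "- l * max 0 (min T s) \<le> \<bar>l\<bar> * max 0 (min T s)" by (intro mult_right_mono) auto
  also have "\<dots> \<le> \<bar>l\<bar> * T" using T by (intro mult_left_mono) auto
  finally show ?thesis by (simp add: weight_def)
qed

lemma weight_meas: "(\<lambda>z::real \<times> 'a. weight l (fst z)) \<in> borel_measurable borel"
  by (intro borel_measurable_compose_fst borel_measurable_continuous_onI continuous_weight)

lemma E_inner: "E l F \<bullet> G = F \<bullet> E l G"
  unfolding E_def by (rule mult_inner[OF weight_meas weight_bound])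

lemma norm_E_le: "norm (E l F) \<le> exp (\<bar>l\<bar> * T) * norm F"
  unfolding E_def by (rule norm_mult_le[OF weight_meas weight_bound])

lemma bounded_linear_E: "bounded_linear (E l)"
  unfolding E_def by (rule bounded_linear_mult[OF weight_meas weight_bound])

lemma E_E: "E l (E (- l) F) = F"
proof -
  have "E l (E (- l) F) = cls (\<lambda>z. weight l (fst z) *\<^sub>R (weight (- l) (fst z) *\<^sub>R rep F z))"
    unfolding E_def mult_def[of _ F]
    by (rule mult_cls[OF weight_meas weight_bound mult_L2[OF weight_meas weight_bound rep_L2]])
  also have "(\<lambda>z. weight l (fst z) *\<^sub>R (weight (- l) (fst z) *\<^sub>R rep F z)) = rep F"
    by (auto simp: weight_def exp_add[symmetric])
  finally show ?thesis by simp
qed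

lemma E_mult_a: "E l (mult a F) = mult a (E l F)"
proof -
  have "E l (mult a F) = cls (\<lambda>z. weight l (fst z) *\<^sub>R (a z *\<^sub>R rep F z))"
    unfolding E_def mult_def[of _ F]
    by (rule mult_cls[OF weight_meas weight_bound mult_L2[OF a_meas a_le rep_L2]])
  moreover have "mult a (E l F) = cls (\<lambda>z. a z *\<^sub>R (weight l (fst z) *\<^sub>R rep F z))"
    unfolding E_def mult_def[of _ F]
    by (rule mult_cls[OF a_meas a_le mult_L2[OF weight_meas weight_bound rep_L2]])
  ultimately show ?thesis by (simp add: mult_ac)
qed

lemma E_J: "continuous_on {0..T} w \<Longrightarrow> E l (J T w) = J T (\<lambda>t. weight l t *\<^sub>R w t)"
  unfolding E_def by (rule mult_J[OF _ continuous_weight weight_bound])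

lemma E_in_Q0: assumes "F \<in> Q0" shows "E l F \<in> Q0"
proof -
  obtain X where X: "\<And>n. X n \<in> J T ` curves" "X \<longlonglongrightarrow> F"
    using assms unfolding Q0_def closure_sequential by auto
  show ?thesis
  proof (rule closed_sequentially[OF closed_Q0])
    show "(\<lambda>n. E l (X n)) \<longlonglongrightarrow> E l F" by (rule bounded_linear.tendsto[OF bounded_linear_E X(2)])
    show "E l (X n) \<in> Q0" for n
    proof -
      obtain w where w: "w \<in> curves" "X n = J T w" using X(1)[of n] by auto
      show ?thesis unfolding w(2) E_J[OF curvesD(1)[OF w(1)]]
        by (intro J_in_Q0 curves_mult continuous_weight w(1))
    qed
  qed
qed

definition PQ :: "(real \<times> 'a, real) l2 \<Rightarrow> (real \<times> 'a, real) l2" where "PQ = proj Q0"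

text \<open>A self-adjoint operator that maps \<open>Q0\<close> into itself commutes with the
  projection onto \<open>Q0\<close>.\<close>

lemma E_PQ: "PQ (E l F) = E l (PQ F)"
  unfolding PQ_def
proof (rule proj_unique[OF subspace_Q0 closed_Q0])
  show "E l (proj Q0 F) \<in> Q0" by (intro E_in_Q0 proj_in[OF subspace_Q0 closed_Q0])
  show "E l (proj Q0 F) \<bullet> s = E l F \<bullet> s" if "s \<in> Q0" for s
    by (simp add: E_inner inner_proj_left[OF subspace_Q0 closed_Q0 E_in_Q0[OF that]])
qed

text \<open>The potential followed by the projection keeps the data in \<open>Q0\<close>; against
  the test elements of the weak formulation it acts like \<open>mult a\<close>
  (\<open>J_const_Q0_inner\<close>).\<close>

definition B :: "(real \<times> 'a, real) l2 \<Rightarrow> (real \<times> 'a, real) l2" where "B F = PQ (mult a F)"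

lemma bounded_linear_B: "bounded_linear B"
  unfolding B_def[abs_def] PQ_def
  by (intro bounded_linear_compose[OF bounded_linear_proj[OF subspace_Q0 closed_Q0]] bounded_linear_mult[OF a_meas a_le])

lemma norm_B_le: "norm (B F) \<le> A * norm F"
  unfolding B_def PQ_def
  by (rule order_trans[OF norm_proj_le[OF subspace_Q0 closed_Q0] norm_mult_le[OF a_meas a_le]])

lemma E_B: "E l (B F) = B (E l F)"
  unfolding B_def E_PQ[symmetric] E_mult_a ..

lemma B_in_Q0: "B F \<in> Q0" unfolding B_def PQ_def by (rule proj_in[OF subspace_Q0 closed_Q0])

abbreviation traj :: "('a, real) l2 \<Rightarrow> (real \<Rightarrow> ('a, real) l2) \<Rightarrow> real \<Rightarrow> ('a, real) l2" where
  "traj w0 w \<equiv> \<lambda>t. R (W w0 w t)"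

lemma continuous_traj: "continuous_on {0..T} w \<Longrightarrow> continuous_on {0..T} (traj w0 w)"
  by (rule continuous_RW[OF less_imp_le[OF T]])

text \<open>On \<open>[0, T]\<close> the clipping is inactive and two weights multiply to
  \<open>exp (- 2 * l * s)\<close>. In operator form the inequality can be combined with
  \<open>B\<close>, which commutes with \<open>E l\<close>.\<close>

lemma weighted_energy_J:
  assumes w: "continuous_on {0..T} w"
  shows "l * (norm (E l (J T (traj w0 w))))\<^sup>2
    \<le> (norm (R w0))\<^sup>2 / 2 + E l (J T (src w0 w)) \<bullet> E l (J T (traj w0 w))"
proof -
  have T0: "0 \<le> T" using T by simp
  note cs = continuous_src[OF T0 w, of w0] and cy = continuous_traj[OF w, of w0]
  have sq: "weight l s * weight l s = exp (- 2 * l * s)" if "s \<in> {0..T}" for s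
    using that by (simp add: weight_def exp_add[symmetric])
  have 1: "(norm (E l (J T (traj w0 w))))\<^sup>2 = integral {0..T} (\<lambda>s. exp (- 2 * l * s) * (norm (traj w0 w s))\<^sup>2)"
    unfolding E_J[OF cy] norm_J[OF continuous_on_scaleR[OF continuous_weight cy]]
  proof (rule integral_cong)
    fix s assume s: "s \<in> {0..T}"
    show "(norm (weight l s *\<^sub>R traj w0 w s))\<^sup>2 = exp (- 2 * l * s) * (norm (traj w0 w s))\<^sup>2"
      unfolding sq[OF s, symmetric] by (simp add: power_mult_distrib power2_eq_square)
  qed
  have 2: "E l (J T (src w0 w)) \<bullet> E l (J T (traj w0 w)) =
      integral {0..T} (\<lambda>s. exp (- 2 * l * s) * (src w0 w s \<bullet> traj w0 w s))"
    unfolding E_J[OF cy] E_J[OF cs]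
      inner_J[OF continuous_on_scaleR[OF continuous_weight cs] continuous_on_scaleR[OF continuous_weight cy]]
  proof (rule integral_cong)
    fix s assume s: "s \<in> {0..T}"
    show "weight l s *\<^sub>R src w0 w s \<bullet> weight l s *\<^sub>R traj w0 w s = exp (- 2 * l * s) * (src w0 w s \<bullet> traj w0 w s)"
      unfolding sq[OF s, symmetric] by simp
  qed
  show ?thesis unfolding 1 2 by (rule weighted_energy_le[OF T0 w])
qed

text \<open>If \<open>g\<close> is orthogonal to the perturbed sources, its pairing with a pure
  source equals minus its pairing with the potential term, which the weighted estimate bounds by
  \<open>A / l\<close> times a weighted norm of that source. Testing along pure sources that
  approximate a reweighted \<open>g\<close> yields \<open>l * |g'|^2 <= A * |g'|^2\<close>,
  impossible for \<open>l = A + 1\<close> unless \<open>g' = 0\<close>.\<close>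

lemma src_potential_dense:
  assumes g: "g \<in> Q0" and orth: "\<And>w. w \<in> curves \<Longrightarrow> g \<bullet> (J T (src 0 w) + B (J T (traj 0 w))) = 0"
  shows "g = 0"
proof -
  define l where "l = A + 1"
  have l: "l > 0" using A_nonneg by (simp add: l_def)
  define g' where "g' = E (- l) g"
  \<comment> \<open>Weighting \<open>g\<close> twice makes \<open>g \<bullet> f = |g'|^2\<close>
    while \<open>E l f = g'\<close>, so both sides of the final inequality are in terms of
    \<open>g'\<close>.\<close>
  define f where "f = E (- l) g'"
  have f: "f \<in> Q0" unfolding f_def g'_def by (intro E_in_Q0 g)
  have Eg: "E l f = g'" unfolding f_def by (rule E_E)
  define S where "S = closure ((\<lambda>w. J T (src 0 w)) ` curves)"
  have S: "subspace S" "closed S"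
  proof -
    have "subspace ((\<lambda>w. J T (src 0 w)) ` curves)"
    proof (rule subspaceI)
      have comb: "J T (src 0 w) + c *\<^sub>R J T (src 0 v) \<in> (\<lambda>w. J T (src 0 w)) ` curves"
        if "w \<in> curves" "v \<in> curves" for w v c
      proof -
        note cw = curvesD(1)[OF that(1)] and cv = curvesD(1)[OF that(2)]
        have "J T (src 0 (\<lambda>t. w t + c *\<^sub>R v t)) = J T (\<lambda>t. src 0 w t + c *\<^sub>R src 0 v t)"
          by (rule J_cong) (use linear_src[OF cw cv, of _ 0 c 0] in simp)
        also have "\<dots> = J T (src 0 w) + c *\<^sub>R J T (src 0 v)"
          using T cw cv by (simp add: J_add J_scaleR continuous_src continuous_on_scaleR)
        finally show ?thesis
          using that by (intro image_eqI[of _ _ "\<lambda>t. w t + c *\<^sub>R v t"]) (auto intro!: curves_add curves_mult)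
      qed
      have z: "(\<lambda>_. 0) \<in> curves" by (rule curves_const[OF subspace_0[OF subspace_Hb]])
      show "0 \<in> (\<lambda>w. J T (src 0 w)) ` curves" using comb[OF z z, of "-1"] by simp
      show "x + y \<in> (\<lambda>w. J T (src 0 w)) ` curves"
        if "x \<in> (\<lambda>w. J T (src 0 w)) ` curves" "y \<in> (\<lambda>w. J T (src 0 w)) ` curves" for x y
        using that comb[of _ _ 1] by auto
      have "src 0 (\<lambda>_. 0) = (\<lambda>_. 0)" by (simp add: src_def[abs_def] W_def)
      hence "J T (src 0 (\<lambda>_. 0)) = 0" using J_scaleR[of T "\<lambda>_. 0" 0] by simp
      thus "c *\<^sub>R x \<in> (\<lambda>w. J T (src 0 w)) ` curves" if "x \<in> (\<lambda>w. J T (src 0 w)) ` curves" for c x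
        using that comb[OF z, of _ c] by auto
    qed
    thus "subspace S" "closed S" unfolding S_def by (simp_all add: subspace_closure)
  qed
  have SQ: "S \<subseteq> Q0" unfolding S_def
    by (rule closure_minimal[OF _ closed_Q0]) (auto intro!: J_in_Q0 curves_src subspace_0 subspace_Hb)
  \<comment> \<open>Density without potential: by \<open>src_dense\<close> no nonzero element of
    \<open>Q0\<close> is orthogonal to all pure sources.\<close>
  have "f - proj S f = 0"
  proof (rule src_dense)
    show "f - proj S f \<in> Q0" using subspace_diff[OF subspace_Q0 f] proj_in[OF S] SQ by auto
    show "(f - proj S f) \<bullet> J T (src 0 w) = 0" if "w \<in> curves" for w
      by (rule proj_orth[OF S]) (unfold S_def, rule subsetD[OF closure_subset imageI[OF that]])
  qed
  hence "f \<in> S" using proj_in[OF S, of f] by simp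
  then obtain X where X: "\<And>n. X n \<in> (\<lambda>w. J T (src 0 w)) ` curves" "X \<longlonglongrightarrow> f"
    unfolding S_def closure_sequential by auto
  have bd: "l * (g \<bullet> X n) \<le> A * (norm g' * norm (E l (X n)))" for n
  proof -
    obtain w where w: "w \<in> curves" and Xn: "X n = J T (src 0 w)" using X(1)[of n] by auto
    define x where "x = E l (J T (traj 0 w))"
    have "l * (norm x)\<^sup>2 \<le> E l (X n) \<bullet> x"
      using weighted_energy_J[OF curvesD(1)[OF w], of l 0] by (simp add: x_def Xn R.zero)
    also have "\<dots> \<le> norm (E l (X n)) * norm x" by (rule norm_cauchy_schwarz)
    finally have x_le: "l * norm x \<le> norm (E l (X n))"
      by (cases "norm x = 0") (auto simp: power2_eq_square)
    have "g \<bullet> B (J T (traj 0 w)) = E l (E (- l) g) \<bullet> B (J T (traj 0 w))" by (simp add: E_E)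
    also have "\<dots> = g' \<bullet> B x" unfolding E_inner g'_def x_def E_B ..
    finally have "g \<bullet> X n = g' \<bullet> (- B x)" using orth[OF w] Xn by (simp add: inner_add_right)
    also have "\<dots> \<le> norm g' * norm (- B x)" by (rule norm_cauchy_schwarz)
    also have "\<dots> \<le> norm g' * (A * norm x)" using norm_B_le[of x] by (intro mult_left_mono) auto
    finally have "l * (g \<bullet> X n) \<le> l * (norm g' * (A * norm x))" using l by simp
    also have "\<dots> = A * (norm g' * (l * norm x))" by simp
    also have "\<dots> \<le> A * (norm g' * norm (E l (X n)))"
      by (intro mult_left_mono x_le A_nonneg norm_ge_zero)
    finally show ?thesis .
  qed
  have "l * (g \<bullet> f) \<le> A * (norm g' * norm (E l f))"
    by (rule LIMSEQ_le[of "\<lambda>n. l * (g \<bullet> X n)" _ "\<lambda>n. A * (norm g' * norm (E l (X n)))"])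
       (use bd in \<open>auto intro!: tendsto_intros bounded_linear.tendsto[OF bounded_linear_E] X(2)\<close>)
  moreover have "g \<bullet> f = (norm g')\<^sup>2"
    unfolding f_def power2_norm_eq_inner by (simp add: E_inner[symmetric] g'_def[symmetric])
  ultimately have "l * (norm g')\<^sup>2 \<le> A * (norm g')\<^sup>2" by (simp add: Eg power2_eq_square)
  hence "(norm g')\<^sup>2 \<le> 0" by (simp add: l_def algebra_simps)
  hence "g' = 0" by simp
  hence "E l g' = 0" using bounded_linear.linear[OF bounded_linear_E] by (simp add: linear_0)
  thus ?thesis using E_E[of l g] by (simp add: g'_def)
qed

end

section \<open>Existence, uniqueness and continuous dependence of weak solutions\<close>

lemma inner_J_restrict:
  assumes w: "continuous_on {0..T} w" and v: "continuous_on {0..t} v" and t: "t \<in> {0..T}"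
  shows "J T w \<bullet> J t v = integral {0..t} (\<lambda>s. w s \<bullet> v s)"
proof -
  have wt: "continuous_on {0..t} w" by (rule continuous_on_subset[OF w]) (use t in auto)
  have "J T w \<bullet> J t v = J t v \<bullet> J T w" by (rule inner_commute)
  also have "\<dots> = J t v \<bullet> J t w"
    unfolding inner_J_left(1)[OF v]
  proof (rule integral_cong_AE)
    show "AE s in lborel. indicator {0..t} s *\<^sub>R (v s \<bullet> slice (J T w) s) = indicator {0..t} s *\<^sub>R (v s \<bullet> slice (J t w) s)"
      using slice_J[OF w] slice_J[OF wt] by eventually_elim (use t in \<open>auto simp: indicator_def\<close>)
  qed (use inner_J_left(2)[OF v] in \<open>auto dest: borel_measurable_integrable\<close>)
  also have "\<dots> = integral {0..t} (\<lambda>s. w s \<bullet> v s)" by (simp add: inner_J[OF v wt] inner_commute)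
  finally show ?thesis .
qed

lemma norm_slice_mult_le:
  fixes F :: "(real \<times> 'a::euclidean_space, 'b::euclidean_space) l2"
  assumes m: "m \<in> borel_measurable borel" and C: "\<And>z. \<bar>m z\<bar> \<le> C"
  shows "AE t in lborel. norm (slice (mult m F) t) \<le> C * norm (slice F t)"
proof -
  have [measurable]: "m \<in> borel_measurable (lborel \<Otimes>\<^sub>M lborel)" unfolding lborel_prod using m by simp
  have mt: "(\<lambda>x. m (t, x)) \<in> borel_measurable borel" for t
    using measurable_Pair2[of m lborel lborel borel t] by simp
  have "AE t in lborel. slice (mult m F) t = cls (\<lambda>x. m (t, x) *\<^sub>R rep F (t, x))"
    unfolding mult_def using slice_cls[OF mult_L2[OF m C rep_L2[of F]]] by simp
  with slice_rep[of F] show ?thesis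
  proof eventually_elim
    case (elim t)
    hence "slice (mult m F) t = mult (\<lambda>x. m (t, x)) (slice F t)"
      using mult_cls[OF mt C, of "\<lambda>x. rep F (t, x)"] by simp
    thus ?case using norm_mult_le[OF mt C, of t "slice F t"] by simp
  qed
qed

text \<open>Iterating the one-step inequality on a fine grid gives factors
  \<open>1 + c * h <= exp (c * h)\<close>. Only a one-sided first-order bound, uniform on short
  intervals, is asked of \<open>N\<close>; it need not be differentiable.\<close>

lemma discrete_gronwall:
  fixes N :: "real \<Rightarrow> real"
  assumes c: "c \<ge> 0" and N0: "N 0 \<le> 0" and t: "t \<in> {0..T}"
    and step: "\<And>e. e > 0 \<Longrightarrow> \<exists>d>0. \<forall>s r. 0 \<le> s \<longrightarrow> s \<le> r \<longrightarrow> r \<le> T \<longrightarrow> r - s < d \<longrightarrow> N r \<le> N s + (r - s) * (c * N s + e)"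
  shows "N t \<le> 0"
proof (rule field_le_epsilon)
  fix e0 :: real assume e0: "e0 > 0"
  \<comment> \<open>Chosen so that the accumulated bound \<open>exp (c * t) * ((1 + t) * e)\<close>
    equals \<open>e0\<close>; the 1 avoids division by 0 at \<open>t = 0\<close>.\<close>
  define e where "e = e0 / (exp (c * t) * (1 + t))"
  have e: "e > 0" using e0 t by (simp add: e_def)
  obtain d where d: "d > 0" "\<And>s r. 0 \<le> s \<Longrightarrow> s \<le> r \<Longrightarrow> r \<le> T \<Longrightarrow> r - s < d \<Longrightarrow> N r \<le> N s + (r - s) * (c * N s + e)"
    using step[OF e] by blast
  obtain n :: nat where n: "t / d < real n" using reals_Archimedean2 by blast
  hence n0: "n > 0" using t d by (cases n) (auto simp: field_simps divide_less_0_iff)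
  define h where "h = t / real n"
  have h: "0 \<le> h" "h < d" "real n * h = t" using n n0 t d by (auto simp: h_def field_simps)
  have "k \<le> n \<Longrightarrow> N (real k * h) \<le> exp (c * (real k * h)) * (real k * h * e)" for k
  proof (induction k)
    case (Suc k)
    have eq: "real (Suc k) * h = real k * h + h" by (simp add: algebra_simps)
    have "real (Suc k) * h \<le> t" unfolding h(3)[symmetric]
      using Suc.prems h(1) by (intro mult_right_mono) auto
    hence le: "real (Suc k) * h \<le> T" using t by simp
    have k0: "0 \<le> real k * h" using h(1) by simp
    let ?a = "exp (c * (real k * h))" and ?b = "real k * h * e"
    have "N (real (Suc k) * h) \<le> N (real k * h) + (real (Suc k) * h - real k * h) * (c * N (real k * h) + e)"
      by (rule d(2)[OF k0 _ le]) (use eq h in linarith)+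
    also have "\<dots> = (1 + c * h) * N (real k * h) + h * e" by (simp add: eq algebra_simps)
    also have "\<dots> \<le> (1 + c * h) * (?a * ?b) + h * e"
      using Suc c h by (intro add_right_mono mult_left_mono) auto
    also have "\<dots> \<le> exp (c * h) * (?a * ?b) + exp (c * h) * ?a * (h * e)"
    proof (intro add_mono mult_right_mono)
      show "1 + c * h \<le> exp (c * h)" by simp
      show "0 \<le> ?a * ?b" using h e by simp
      have "1 \<le> exp (c * h) * ?a" using c h k0 by (simp add: exp_add[symmetric])
      thus "h * e \<le> exp (c * h) * ?a * (h * e)" using mult_right_mono[of 1 "exp (c * h) * ?a" "h * e"] h e by simp
    qed
    also have "\<dots> = exp (c * h) * ?a * (?b + h * e)" by (simp add: algebra_simps)
    also have "\<dots> = exp (c * (real (Suc k) * h)) * (real (Suc k) * h * e)"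
      unfolding eq by (simp add: exp_add[symmetric] algebra_simps)
    finally show ?case .
  qed (simp add: N0)
  from this[of n] have "N t \<le> exp (c * t) * (t * e)" by (simp add: h(3))
  also have "\<dots> \<le> exp (c * t) * ((1 + t) * e)" using e by (intro mult_left_mono mult_right_mono) auto
  also have "\<dots> = e0" using t by (simp add: e_def)
  finally show "N t \<le> 0 + e0" by simp
qed

section \<open>Weak solutions in the Hilbert space setting\<close>

context heat_form
begin

text \<open>\<open>J t (\<lambda>_. v)\<close> equals \<open>v\<close> on \<open>[0, t]\<close> and vanishes elsewhere, so that inner products with it are
  integrals over \<open>(0, t)\<close>.\<close>

definition wsol :: "(real \<times> 'a, real) l2 \<Rightarrow> ('a, real) l2 \<Rightarrow> (real \<Rightarrow> ('a, real) l2) \<Rightarrow> (real \<times> 'a, 'a) l2 \<Rightarrow> bool" where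
  "wsol F y0 y G \<longleftrightarrow> continuous_on {0..T} y \<and> y 0 = y0 \<and>
     (AE t in lborel. t \<in> {0..T} \<longrightarrow> (y t, slice G t) \<in> V) \<and>
     (\<forall>\<phi> \<gamma> t. (\<phi>, \<gamma>) \<in> V \<longrightarrow> t \<in> {0..T} \<longrightarrow>
        y t \<bullet> \<phi> + G \<bullet> J t (\<lambda>_. \<gamma>) + mult a (J T y) \<bullet> J t (\<lambda>_. \<phi>) = y0 \<bullet> \<phi> + F \<bullet> J t (\<lambda>_. \<phi>))"

lemma wsol_lincomb:
  assumes "wsol F y0 y G" "wsol F' y0' y' G'"
  shows "wsol (F + c *\<^sub>R F') (y0 + c *\<^sub>R y0') (\<lambda>t. y t + c *\<^sub>R y' t) (G + c *\<^sub>R G')"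
proof -
  have cy: "continuous_on {0..T} y" "continuous_on {0..T} y'" using assms by (auto simp: wsol_def)
  have Jy: "mult a (J T (\<lambda>t. y t + c *\<^sub>R y' t)) = mult a (J T y) + c *\<^sub>R mult a (J T y')"
  proof -
    have "J T (\<lambda>t. y t + c *\<^sub>R y' t) = J T y + c *\<^sub>R J T y'"
      by (simp add: J_add J_scaleR cy continuous_on_scaleR)
    moreover have "linear (mult a :: (real \<times> 'a, real) l2 \<Rightarrow> _)"
      by (rule bounded_linear.linear[OF bounded_linear_mult[OF a_meas a_le]])
    ultimately show ?thesis by (simp add: linear_add linear_scale)
  qed
  have "AE t in lborel. t \<in> {0..T} \<longrightarrow> (y t + c *\<^sub>R y' t, slice (G + c *\<^sub>R G') t) \<in> V"
  proof -
    have "AE t in lborel. t \<in> {0..T} \<longrightarrow> (y t, slice G t) \<in> V" "AE t in lborel. t \<in> {0..T} \<longrightarrow> (y' t, slice G' t) \<in> V"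
      using assms by (auto simp: wsol_def)
    with slice_add[of G "c *\<^sub>R G'"] slice_scaleR[of c G'] show ?thesis
    proof eventually_elim
      case (elim t)
      show ?case
      proof
        assume "t \<in> {0..T}"
        hence "(y t, slice G t) + c *\<^sub>R (y' t, slice G' t) \<in> V"
          using elim by (intro subspace_add subspace_scale subspace_V) auto
        thus "(y t + c *\<^sub>R y' t, slice (G + c *\<^sub>R G') t) \<in> V" using elim by simp
      qed
    qed
  qed
  moreover have "(y t + c *\<^sub>R y' t) \<bullet> \<phi> + (G + c *\<^sub>R G') \<bullet> J t (\<lambda>_. \<gamma>) + mult a (J T (\<lambda>t. y t + c *\<^sub>R y' t)) \<bullet> J t (\<lambda>_. \<phi>)
      = (y0 + c *\<^sub>R y0') \<bullet> \<phi> + (F + c *\<^sub>R F') \<bullet> J t (\<lambda>_. \<phi>)"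
    if "(\<phi>, \<gamma>) \<in> V" "t \<in> {0..T}" for \<phi> \<gamma> t
  proof -
    have 1: "y t \<bullet> \<phi> + G \<bullet> J t (\<lambda>_. \<gamma>) + mult a (J T y) \<bullet> J t (\<lambda>_. \<phi>) = y0 \<bullet> \<phi> + F \<bullet> J t (\<lambda>_. \<phi>)"
      and 2: "y' t \<bullet> \<phi> + G' \<bullet> J t (\<lambda>_. \<gamma>) + mult a (J T y') \<bullet> J t (\<lambda>_. \<phi>) = y0' \<bullet> \<phi> + F' \<bullet> J t (\<lambda>_. \<phi>)"
      using assms that by (auto simp: wsol_def)
    show ?thesis unfolding Jy inner_add_left inner_scaleR_left
      using 1 arg_cong[OF 2, of "\<lambda>x. c * x"] by (simp add: distrib_left)
  qed
  ultimately show ?thesis using assms cy by (auto simp: wsol_def intro!: continuous_intros)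
qed

text \<open>Almost every \<open>y t\<close> lies in the form domain. The distance to
  \<open>Hb\<close> is thus a continuous function of time whose square has integral 0, and so it
  vanishes at every time.\<close>

lemma wsol_in_Hb:
  assumes y: "wsol F y0 y G" and t: "t \<in> {0..T}"
  shows "y t \<in> Hb"
proof -
  define z where "z t = y t - proj Hb (y t)" for t
  have cz: "continuous_on {0..T} z" unfolding z_def
    using y by (intro continuous_intros bounded_linear.continuous_on[OF bounded_linear_proj[OF subspace_Hb closed_Hb]])
       (auto simp: wsol_def)
  have "AE t in lborel. t \<in> {0..T} \<longrightarrow> (y t, slice G t) \<in> V" using y by (simp add: wsol_def)
  with slice_J[OF cz] have "AE t in lborel. slice (J T z) t = 0"
  proof eventually_elim
    case (elim t)
    have "z t = 0" if "t \<in> {0..T}"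
      using proj_id[OF subspace_Hb closed_Hb fst_in_Hb] elim(2) that by (auto simp: z_def)
    thus ?case using elim by (simp add: indicator_def)
  qed
  hence "(norm (J T z))\<^sup>2 = 0" unfolding norm_slice
    by (subst integral_cong_AE[where g="\<lambda>_. 0"]) auto
  hence "integral {0..T} (\<lambda>t. (norm (z t))\<^sup>2) = 0" by (simp add: norm_J[OF cz])
  moreover have "continuous_on {0..T} (\<lambda>t. (norm (z t))\<^sup>2)" by (intro continuous_intros cz)
  ultimately have "(norm (z t))\<^sup>2 = 0"
    using integral_eq_0_iff[of 0 T "\<lambda>t. (norm (z t))\<^sup>2"] T t by auto
  hence "y t = proj Hb (y t)" by (simp add: z_def)
  thus ?thesis using proj_in[OF subspace_Hb closed_Hb] by metis
qed

text \<open>The quadratic form of the resolvent along the solution obeys a Gronwall inequality; unlike the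
  norm itself, it can be differentiated using test functions in the range of \<open>R\<close> only.\<close>

lemma wsol_unique_0:
  assumes y: "wsol 0 0 y G" and t: "t \<in> {0..T}"
  shows "y t = 0"
proof -
  have cy: "continuous_on {0..T} y" and y0: "y 0 = 0" using y by (auto simp: wsol_def)
  have cIy: "continuous_on {0..T} (\<lambda>s. y s - R (y s))" by (intro continuous_intros cy R.continuous_on)
  define N where "N t = R (y t) \<bullet> y t" for t
  \<comment> \<open>In \<open>p = (q, s, r)\<close>, \<open>q\<close> is the integration time and
    \<open>s\<close>, \<open>r\<close> are the ends of an increment of \<open>N\<close>. Leaving
    them independent makes \<open>\<Psi>\<close> continuous on a compact cube, so it can be compared
    with its diagonal values.\<close>
  define \<Psi> where "\<Psi> p = A * norm (y (fst p)) * norm (R (y (snd (snd p)) + y (fst (snd p))))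
     - (y (fst p) - R (y (fst p))) \<bullet> (y (snd (snd p)) + y (fst (snd p)))" for p :: "real \<times> real \<times> real"
  let ?K = "{0..T} \<times> {0..T} \<times> {0..T}"
  have c\<Psi>: "continuous_on ?K \<Psi>"
    unfolding \<Psi>_def
    by (intro continuous_intros R.continuous_on continuous_on_compose2[OF cy]) auto
  have diag: "\<Psi> (s, s, s) \<le> (2 + A\<^sup>2) * N s" for s
  proof -
    have N_ge: "(norm (R (y s)))\<^sup>2 \<le> N s" using R_energy[of "y s"] by (simp add: N_def inner_commute)
    have "norm (R (y s + y s)) = 2 * norm (R (y s))"
      by (simp add: scaleR_2[symmetric] R.scaleR)
    hence "\<Psi> (s, s, s) = 2 * (A * norm (R (y s))) * norm (y s) - 2 * (norm (y s))\<^sup>2 + 2 * N s"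
      by (simp add: \<Psi>_def N_def inner_add_right inner_diff_left power2_norm_eq_inner algebra_simps)
    \<comment> \<open>Young's inequality for the potential term: the \<open>|y|^2\<close> it creates
      is absorbed by the dissipative \<open>- 2 * |y|^2\<close>, leaving only quantities bounded by
      \<open>N\<close>.\<close>
    also have "\<dots> \<le> (A * norm (R (y s)))\<^sup>2 + (norm (y s))\<^sup>2 - 2 * (norm (y s))\<^sup>2 + 2 * N s"
      using sum_squares_bound[of "A * norm (R (y s))" "norm (y s)"] by simp
    also have "\<dots> \<le> A\<^sup>2 * (norm (R (y s)))\<^sup>2 + 2 * N s" by (simp add: power_mult_distrib)
    also have "\<dots> \<le> A\<^sup>2 * N s + 2 * N s" using N_ge by (intro add_right_mono mult_left_mono) auto
    finally show ?thesis by (simp add: algebra_simps)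
  qed
  have incr: "N r - N s \<le> integral {s..r} (\<lambda>q. \<Psi> (q, s, r))" if sr: "0 \<le> s" "s \<le> r" "r \<le> T" for s r
  proof -
    define h where "h = y r + y s"
    have s: "s \<in> {0..T}" and r: "r \<in> {0..T}" using sr by auto
    \<comment> \<open>The weak formulation is tested with \<open>(R h, D h)\<close>. By
      \<open>RD_weak\<close> the unknown gradient drops out: \<open>D h \<bullet> slice G s\<close>
      becomes \<open>h \<bullet> (y s - R (y s))\<close>.\<close>
    have id: "y q \<bullet> R h = - J q (\<lambda>_. h) \<bullet> J T (\<lambda>s. y s - R (y s)) - mult a (J T y) \<bullet> J q (\<lambda>_. R h)" if q: "q \<in> {0..T}" for q
    proof -
      have "G \<bullet> J q (\<lambda>_. D h) = J q (\<lambda>_. D h) \<bullet> G" by (rule inner_commute)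
      also have "\<dots> = J q (\<lambda>_. h) \<bullet> J T (\<lambda>s. y s - R (y s))"
        unfolding inner_J_left(1)[OF continuous_on_const]
      proof (rule integral_cong_AE)
        have "AE t in lborel. t \<in> {0..T} \<longrightarrow> (y t, slice G t) \<in> V" using y by (simp add: wsol_def)
        with slice_J[OF cIy]
        show "AE s in lborel. indicator {0..q} s *\<^sub>R (D h \<bullet> slice G s) = indicator {0..q} s *\<^sub>R (h \<bullet> slice (J T (\<lambda>s. y s - R (y s))) s)"
        proof eventually_elim
          case (elim s)
          show ?case
          proof (cases "s \<in> {0..q}")
            case True
            hence sT: "s \<in> {0..T}" using q by auto
            hence "R h \<bullet> y s + D h \<bullet> slice G s = h \<bullet> y s" using elim(2) by (intro RD_weak) simp
            moreover have "slice (J T (\<lambda>s. y s - R (y s))) s = y s - R (y s)" using elim(1) sT by simp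
            ultimately show ?thesis using True by (simp add: inner_diff_right R_sym[symmetric])
          qed simp
        qed
      qed (rule borel_measurable_integrable[OF inner_J_left(2)[OF continuous_on_const]])+
      finally have "G \<bullet> J q (\<lambda>_. D h) = J q (\<lambda>_. h) \<bullet> J T (\<lambda>s. y s - R (y s))" .
      moreover have "y q \<bullet> R h + G \<bullet> J q (\<lambda>_. D h) + mult a (J T y) \<bullet> J q (\<lambda>_. R h) = 0"
        using y q RD_in[of h] by (simp add: wsol_def)
      ultimately show ?thesis by simp
    qed
    have 1: "J q (\<lambda>_. h) \<bullet> J T (\<lambda>s. y s - R (y s)) = integral {0..q} (\<lambda>q. (y q - R (y q)) \<bullet> h)" if "q \<in> {0..T}" for q
      using inner_J_restrict[OF cIy continuous_on_const that, of h] by (simp add: inner_commute)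
    have 2: "mult a (J T y) \<bullet> J s (\<lambda>_. R h) - mult a (J T y) \<bullet> J r (\<lambda>_. R h) \<le> integral {s..r} (\<lambda>q. A * norm (y q) * norm (R h))"
    proof -
      let ?f = "\<lambda>q. indicator {0..s} q *\<^sub>R (R h \<bullet> slice (mult a (J T y)) q) - indicator {0..r} q *\<^sub>R (R h \<bullet> slice (mult a (J T y)) q)"
      have csr: "continuous_on {s..r} (\<lambda>q. A * norm (y q) * norm (R h))"
        by (intro continuous_intros continuous_on_subset[OF cy]) (use sr in auto)
      have int: "integrable lborel (\<lambda>q. indicator {s..r} q *\<^sub>R (A * norm (y q) * norm (R h)))"
        by (rule borel_integrable_compact[OF compact_Icc csr])
      have i: "integrable lborel (\<lambda>q. indicator {0..p} q *\<^sub>R (R h \<bullet> slice (mult a (J T y)) q))" for p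
        by (rule inner_J_left(2)[OF continuous_on_const])
      have "mult a (J T y) \<bullet> J s (\<lambda>_. R h) - mult a (J T y) \<bullet> J r (\<lambda>_. R h)
          = J s (\<lambda>_. R h) \<bullet> mult a (J T y) - J r (\<lambda>_. R h) \<bullet> mult a (J T y)" by (simp add: inner_commute)
      also have "\<dots> = (\<integral>q. ?f q \<partial>lborel)"
        unfolding inner_J_left(1)[OF continuous_on_const] by (rule Bochner_Integration.integral_diff[OF i i, symmetric])
      also have "\<dots> \<le> (\<integral>q. indicator {s..r} q *\<^sub>R (A * norm (y q) * norm (R h)) \<partial>lborel)"
      proof (rule integral_mono_AE[OF Bochner_Integration.integrable_diff[OF i i] int])
        show "AE q in lborel. ?f q \<le> indicator {s..r} q *\<^sub>R (A * norm (y q) * norm (R h))"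
          using slice_J[OF cy] norm_slice_mult_le[OF a_meas a_le, of "J T y"]
        proof eventually_elim
          case (elim q)
          show ?case
          proof (cases "s < q \<and> q \<le> r")
            case True
            have "- (R h \<bullet> slice (mult a (J T y)) q) \<le> norm (R h) * norm (slice (mult a (J T y)) q)"
              using Cauchy_Schwarz_ineq2[of "R h" "slice (mult a (J T y)) q"] by linarith
            also have "\<dots> \<le> norm (R h) * (A * norm (slice (J T y) q))" using elim by (intro mult_left_mono) auto
            also have "\<dots> = A * norm (y q) * norm (R h)" using elim True sr by simp
            finally show ?thesis using True sr by simp
          next
            case False
            hence "?f q = 0" using sr by (auto simp: indicator_def)
            moreover have "0 \<le> indicator {s..r} q *\<^sub>R (A * norm (y q) * norm (R h))" using A_nonneg by simp
            ultimately show ?thesis by (rule ord_eq_le_trans)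
          qed
        qed
      qed
      also have "\<dots> = integral {s..r} (\<lambda>q. A * norm (y q) * norm (R h))"
        by (rule set_borel_integral_eq_integral(2)[unfolded set_lebesgue_integral_def set_integrable_def, OF int])
      finally show ?thesis .
    qed
    \<comment> \<open>Polarization: symmetry of \<open>R\<close> turns the difference of quadratic
      forms into a pairing of \<open>y r - y s\<close> with \<open>R (y r + y s)\<close>, which
      explains the choice of \<open>h\<close>.\<close>
    have "N r - N s = y r \<bullet> R h - y s \<bullet> R h"
      unfolding N_def h_def R.add using R_sym[of "y r" "y s"] by (simp add: inner_add_right inner_commute)
    also have "\<dots> = integral {0..s} (\<lambda>q. (y q - R (y q)) \<bullet> h) - integral {0..r} (\<lambda>q. (y q - R (y q)) \<bullet> h)
       + (mult a (J T y) \<bullet> J s (\<lambda>_. R h) - mult a (J T y) \<bullet> J r (\<lambda>_. R h))"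
      unfolding id[OF r] id[OF s] using 1[OF r] 1[OF s] by simp
    also have "integral {0..s} (\<lambda>q. (y q - R (y q)) \<bullet> h) - integral {0..r} (\<lambda>q. (y q - R (y q)) \<bullet> h)
       = - integral {s..r} (\<lambda>q. (y q - R (y q)) \<bullet> h)"
    proof -
      have "(\<lambda>q. (y q - R (y q)) \<bullet> h) integrable_on {0..r}"
        by (intro integrable_continuous_real continuous_intros continuous_on_subset[OF cIy]) (use sr in auto)
      from Henstock_Kurzweil_Integration.integral_combine[OF sr(1,2) this] show ?thesis by simp
    qed
    also have "- integral {s..r} (\<lambda>q. (y q - R (y q)) \<bullet> h)
       + (mult a (J T y) \<bullet> J s (\<lambda>_. R h) - mult a (J T y) \<bullet> J r (\<lambda>_. R h))
       \<le> - integral {s..r} (\<lambda>q. (y q - R (y q)) \<bullet> h) + integral {s..r} (\<lambda>q. A * norm (y q) * norm (R h))"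
      using 2 by simp
    also have "\<dots> = integral {s..r} (\<lambda>q. A * norm (y q) * norm (R h) - (y q - R (y q)) \<bullet> h)"
    proof -
      have "(\<lambda>q. (y q - R (y q)) \<bullet> h) integrable_on {s..r}"
        by (intro integrable_continuous_real continuous_intros continuous_on_subset[OF cIy]) (use sr in auto)
      moreover have "(\<lambda>q. A * norm (y q) * norm (R h)) integrable_on {s..r}"
        by (intro integrable_continuous_real continuous_intros continuous_on_subset[OF cy]) (use sr in auto)
      ultimately show ?thesis by (simp add: integral_diff)
    qed
    finally show ?thesis by (simp add: \<Psi>_def h_def)
  qed
  have "N t \<le> 0"
  proof (rule discrete_gronwall[where N = N and c = "2 + A\<^sup>2" and T = T])
    show "N 0 \<le> 0" by (simp add: N_def y0)
    show "\<exists>d>0. \<forall>s r. 0 \<le> s \<longrightarrow> s \<le> r \<longrightarrow> r \<le> T \<longrightarrow> r - s < d \<longrightarrow> N r \<le> N s + (r - s) * ((2 + A\<^sup>2) * N s + e)"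
      if e: "e > 0" for e
    proof -
      have "compact ?K" by (intro compact_Times compact_Icc)
      hence "uniformly_continuous_on ?K \<Psi>" by (rule compact_uniformly_continuous[OF c\<Psi>])
      then obtain d where d: "d > 0" "\<And>p p'. p \<in> ?K \<Longrightarrow> p' \<in> ?K \<Longrightarrow> dist p' p < d \<Longrightarrow> dist (\<Psi> p') (\<Psi> p) < e"
        using e unfolding uniformly_continuous_on_def by blast
      \<comment> \<open>The distance of \<open>(q, s, r)\<close> from \<open>(s, s, s)\<close> is at
        most the sum of two time differences, hence \<open>d / 2\<close>.\<close>
      have "N r \<le> N s + (r - s) * ((2 + A\<^sup>2) * N s + e)" if sr: "0 \<le> s" "s \<le> r" "r \<le> T" "r - s < d / 2" for s r
      proof -
        have le: "\<Psi> (q, s, r) \<le> (2 + A\<^sup>2) * N s + e" if q: "q \<in> {s..r}" for q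
        proof -
          have "dist (q, s, r) (s, s, s) \<le> dist q s + dist r s"
            using sqrt_sum_squares_le_sum[of "dist q s" "dist r s"] by (simp add: dist_Pair_Pair)
          also have "\<dots> < d" using q sr by (simp add: dist_real_def)
          finally have "dist (\<Psi> (q, s, r)) (\<Psi> (s, s, s)) < e"
            using q sr by (intro d(2)) auto
          thus ?thesis using diag[of s] by (simp add: dist_real_def)
        qed
        have c: "continuous_on {s..r} (\<lambda>q. \<Psi> (q, s, r))"
          by (rule continuous_on_compose2[OF c\<Psi>]) (use sr in \<open>auto intro!: continuous_intros\<close>)
        have "integral {s..r} (\<lambda>q. \<Psi> (q, s, r)) \<le> integral {s..r} (\<lambda>q. (2 + A\<^sup>2) * N s + e)"
          by (rule integral_le) (auto intro!: integrable_continuous_real c le)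
        also have "\<dots> = (r - s) * ((2 + A\<^sup>2) * N s + e)" using sr by simp
        finally show ?thesis using incr[OF sr(1-3)] by simp
      qed
      thus ?thesis using d(1) by (intro exI[of _ "d / 2"]) auto
    qed
  qed (use t in auto)
  moreover have "N t = (norm (R (y t)))\<^sup>2 + (norm (D (y t)))\<^sup>2" using R_energy[of "y t"] by (simp add: N_def inner_commute)
  ultimately have "(norm (R (y t)))\<^sup>2 \<le> 0" using zero_le_power2[of "norm (D (y t))"] by linarith
  hence "R (y t) = 0" by simp
  thus ?thesis by (rule R_eq_0_imp[OF _ wsol_in_Hb[OF y t]])
qed

text \<open>The pair of projected source and initial value for which \<open>traj w0 w\<close> solves
  the equation with potential.\<close>

definition dat :: "('a, real) l2 \<Rightarrow> (real \<Rightarrow> ('a, real) l2) \<Rightarrow> (real \<times> 'a, real) l2 \<times> ('a, real) l2" where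
  "dat w0 w = (J T (src w0 w) + B (J T (traj w0 w)), R w0)"

text \<open>The weighted inequality with \<open>l = A + 1\<close> absorbs the potential and bounds
  the trajectory in space-time norm by the data. Inserted into \<open>energy_le\<close>, this
  controls the trajectory at each time and its gradient.\<close>

lemma energy_estimate:
  obtains K where "K \<ge> 0"
    and "\<And>w0 w t. continuous_on {0..T} w \<Longrightarrow> t \<in> {0..T} \<Longrightarrow> norm (traj w0 w t) \<le> K * norm (dat w0 w)"
    and "\<And>w0 w. continuous_on {0..T} w \<Longrightarrow> norm (J T (\<lambda>t. D (W w0 w t))) \<le> K * norm (dat w0 w)"
proof -
  define l where "l = A + 1"
  define c where "c = exp (l * T)"
  \<comment> \<open>Putting the weight on and taking it off each cost a factor \<open>c\<close>, so
    squared norms pick up \<open>c ^ 4\<close>; \<open>2 * A^2\<close> comes from the potential in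
    the source, the 1 from the trajectory itself.\<close>
  define C where "C = 2 + (2 * A\<^sup>2 + 1) * c ^ 4"
  have l: "l > 0" "\<bar>l\<bar> = l" using A_nonneg by (simp_all add: l_def)
  have c1: "c \<ge> 1" using l T by (simp add: c_def)
  have C0: "C \<ge> 0" unfolding C_def by simp
  have main: "(norm (traj w0 w t))\<^sup>2 + 2 * integral {0..t} (\<lambda>s. (norm (D (W w0 w s)))\<^sup>2) \<le> C * (norm (dat w0 w))\<^sup>2"
    if w: "continuous_on {0..T} w" and t: "t \<in> {0..T}" for w0 w t
  proof -
    define F where "F = J T (src w0 w) + B (J T (traj w0 w))"
    define x where "x = E l (J T (traj w0 w))"
    define p q where "p = norm (R w0)" and "q = norm F"
    have nd: "(norm (dat w0 w))\<^sup>2 = q\<^sup>2 + p\<^sup>2"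
      unfolding dat_def F_def[symmetric] norm_Pair p_def q_def by simp
    have ES: "E l (J T (src w0 w)) = E l F - B x"
    proof -
      have "E l F = E l (J T (src w0 w)) + B x"
        unfolding F_def x_def E_B[symmetric] by (rule linear_add[OF bounded_linear.linear[OF bounded_linear_E]])
      thus ?thesis by simp
    qed
    have "l * (norm x)\<^sup>2 \<le> p\<^sup>2 / 2 + (E l F - B x) \<bullet> x"
      using weighted_energy_J[OF w, of l w0] unfolding x_def[symmetric] ES p_def[symmetric] .
    also have "(E l F - B x) \<bullet> x \<le> norm (E l F) * norm x + A * norm x * norm x"
    proof -
      have "(E l F - B x) \<bullet> x \<le> norm (E l F - B x) * norm x" by (rule norm_cauchy_schwarz)
      also have "\<dots> \<le> (norm (E l F) + A * norm x) * norm x"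
        by (intro mult_right_mono order_trans[OF norm_triangle_ineq4] add_left_mono norm_B_le) simp
      finally show ?thesis by (simp add: distrib_right)
    qed
    also have "norm (E l F) * norm x \<le> (norm (E l F))\<^sup>2 / 2 + (norm x)\<^sup>2 / 2"
      using sum_squares_bound[of "norm (E l F)" "norm x"] by simp
    finally have "(norm x)\<^sup>2 \<le> p\<^sup>2 + (norm (E l F))\<^sup>2"
      by (simp add: l_def power2_eq_square algebra_simps)
    also have "(norm (E l F))\<^sup>2 \<le> (c * q)\<^sup>2"
      using norm_E_le[of l F] by (intro power_mono) (simp_all add: c_def q_def l)
    finally have x_le: "(norm x)\<^sup>2 \<le> p\<^sup>2 + c\<^sup>2 * q\<^sup>2" by (simp add: power_mult_distrib)
    have "norm (J T (traj w0 w)) \<le> c * norm x"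
    proof -
      have "J T (traj w0 w) = E (- l) x" using E_E[of "- l" "J T (traj w0 w)"] by (simp add: x_def)
      thus ?thesis using norm_E_le[of "- l" x] by (simp add: c_def l)
    qed
    hence "(norm (J T (traj w0 w)))\<^sup>2 \<le> (c * norm x)\<^sup>2" by (rule power_mono) simp
    also have "\<dots> \<le> c\<^sup>2 * (p\<^sup>2 + c\<^sup>2 * q\<^sup>2)" using x_le by (simp add: power_mult_distrib mult_left_mono)
    also have "\<dots> \<le> c\<^sup>2 * (c\<^sup>2 * p\<^sup>2 + c\<^sup>2 * q\<^sup>2)"
    proof -
      have "1 * p\<^sup>2 \<le> c\<^sup>2 * p\<^sup>2" using c1 by (intro mult_right_mono) auto
      thus ?thesis by (intro mult_left_mono) auto
    qed
    also have "\<dots> = c ^ 4 * (q\<^sup>2 + p\<^sup>2)" by (simp add: algebra_simps power_add[symmetric] numeral_eq_Suc)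
    finally have y_le: "(norm (J T (traj w0 w)))\<^sup>2 \<le> c ^ 4 * (q\<^sup>2 + p\<^sup>2)" .
    have "norm (J T (src w0 w)) \<le> q + A * norm (J T (traj w0 w))"
    proof -
      have "J T (src w0 w) = F - B (J T (traj w0 w))" by (simp add: F_def)
      hence "norm (J T (src w0 w)) \<le> norm F + norm (B (J T (traj w0 w)))" by (simp add: norm_triangle_ineq4)
      thus ?thesis using norm_B_le[of "J T (traj w0 w)"] by (simp add: q_def)
    qed
    hence "(norm (J T (src w0 w)))\<^sup>2 \<le> (q + A * norm (J T (traj w0 w)))\<^sup>2" by (rule power_mono) simp
    also have "\<dots> \<le> 2 * q\<^sup>2 + 2 * (A * norm (J T (traj w0 w)))\<^sup>2"
      using sum_squares_bound[of q "A * norm (J T (traj w0 w))"] by (simp add: power2_sum)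
    also have "\<dots> \<le> 2 * q\<^sup>2 + 2 * (A\<^sup>2 * (c ^ 4 * (q\<^sup>2 + p\<^sup>2)))"
      using y_le by (simp add: power_mult_distrib mult_left_mono)
    finally have s_le: "(norm (J T (src w0 w)))\<^sup>2 \<le> 2 * q\<^sup>2 + 2 * (A\<^sup>2 * (c ^ 4 * (q\<^sup>2 + p\<^sup>2)))" .
    have T0: "0 \<le> T" using T by simp
    have "(norm (traj w0 w t))\<^sup>2 + 2 * integral {0..t} (\<lambda>s. (norm (D (W w0 w s)))\<^sup>2)
        \<le> p\<^sup>2 + ((norm (J T (src w0 w)))\<^sup>2 + (norm (J T (traj w0 w)))\<^sup>2)"
      using energy_le[OF T0 w t, of w0] by (simp add: norm_J[OF continuous_src[OF T0 w]] norm_J[OF continuous_traj[OF w]] p_def)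
    also have "\<dots> \<le> 2 * p\<^sup>2 + (2 * q\<^sup>2 + 2 * (A\<^sup>2 * (c ^ 4 * (q\<^sup>2 + p\<^sup>2))) + c ^ 4 * (q\<^sup>2 + p\<^sup>2))"
      using s_le y_le by (intro add_mono) auto
    also have "\<dots> = C * (q\<^sup>2 + p\<^sup>2)" by (simp add: C_def algebra_simps)
    finally show ?thesis by (simp add: nd)
  qed
  show thesis
  proof (rule that[of "sqrt C"])
    show "sqrt C \<ge> 0" using C0 by simp
    fix w0 and w :: "real \<Rightarrow> ('a, real) l2" assume w: "continuous_on {0..T} w"
    have cD: "continuous_on {0..T} (\<lambda>t. D (W w0 w t))" by (rule continuous_DW[OF less_imp_le[OF T] w])
    have nn: "0 \<le> integral {0..t} (\<lambda>s. (norm (D (W w0 w s)))\<^sup>2)" if "t \<in> {0..T}" for t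
      by (rule integral_nonneg)
         (use that in \<open>auto intro!: integrable_continuous_real continuous_intros continuous_on_subset[OF cD]\<close>)
    show "norm (traj w0 w t) \<le> sqrt C * norm (dat w0 w)" if t: "t \<in> {0..T}" for t
    proof (rule power2_le_imp_le)
      show "(norm (traj w0 w t))\<^sup>2 \<le> (sqrt C * norm (dat w0 w))\<^sup>2"
        using main[OF w t, of w0] nn[OF t] C0 by (simp add: power_mult_distrib)
    qed (use C0 in simp)
    show "norm (J T (\<lambda>t. D (W w0 w t))) \<le> sqrt C * norm (dat w0 w)"
    proof (rule power2_le_imp_le)
      have TT: "T \<in> {0..T}" using T by simp
      have "(norm (traj w0 w T))\<^sup>2 + 2 * (norm (J T (\<lambda>t. D (W w0 w t))))\<^sup>2 \<le> C * (norm (dat w0 w))\<^sup>2"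
        using main[OF w TT, of w0] by (simp add: norm_J[OF cD])
      hence "(norm (J T (\<lambda>t. D (W w0 w t))))\<^sup>2 \<le> C * (norm (dat w0 w))\<^sup>2"
        using zero_le_power2[of "norm (traj w0 w T)"] zero_le_power2[of "norm (J T (\<lambda>t. D (W w0 w t)))"] by linarith
      thus "(norm (J T (\<lambda>t. D (W w0 w t))))\<^sup>2 \<le> (sqrt C * norm (dat w0 w))\<^sup>2"
        using C0 by (simp add: power_mult_distrib)
    qed (use C0 in simp)
  qed
qed

lemma linear_traj:
  assumes "continuous_on {0..T} w" "continuous_on {0..T} v" "t \<in> {0..T}"
  shows "traj (w0 + c *\<^sub>R v0) (\<lambda>t. w t + c *\<^sub>R v t) t = traj w0 w t + c *\<^sub>R traj v0 v t"
  unfolding linear_W[OF assms] by (simp add: R.add R.scaleR)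

lemma linear_dat:
  assumes w: "continuous_on {0..T} w" and v: "continuous_on {0..T} v"
  shows "dat (w0 + c *\<^sub>R v0) (\<lambda>t. w t + c *\<^sub>R v t) = dat w0 w + c *\<^sub>R dat v0 v"
proof -
  have T0: "0 \<le> T" using T by simp
  have "J T (src (w0 + c *\<^sub>R v0) (\<lambda>t. w t + c *\<^sub>R v t)) = J T (\<lambda>t. src w0 w t + c *\<^sub>R src v0 v t)"
    by (rule J_cong) (rule linear_src[OF w v])
  also have "\<dots> = J T (src w0 w) + c *\<^sub>R J T (src v0 v)"
    by (simp add: J_add J_scaleR continuous_src[OF T0] w v continuous_on_scaleR)
  finally have 1: "J T (src (w0 + c *\<^sub>R v0) (\<lambda>t. w t + c *\<^sub>R v t)) = J T (src w0 w) + c *\<^sub>R J T (src v0 v)" .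
  have "J T (traj (w0 + c *\<^sub>R v0) (\<lambda>t. w t + c *\<^sub>R v t)) = J T (\<lambda>t. traj w0 w t + c *\<^sub>R traj v0 v t)"
    by (rule J_cong) (rule linear_traj[OF w v])
  also have "\<dots> = J T (traj w0 w) + c *\<^sub>R J T (traj v0 v)"
    by (simp add: J_add J_scaleR continuous_traj w v continuous_on_scaleR)
  finally have 2: "J T (traj (w0 + c *\<^sub>R v0) (\<lambda>t. w t + c *\<^sub>R v t)) = J T (traj w0 w) + c *\<^sub>R J T (traj v0 v)" .
  note lin = bounded_linear.linear[OF bounded_linear_B]
  show ?thesis unfolding dat_def 1 2
    by (simp add: linear_add[OF lin] linear_scale[OF lin] R.add R.scaleR scaleR_add_right)
qed

text \<open>Orthogonality to all data is tested one component at a time: \<open>w0 = 0\<close>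
  isolates the source and \<open>src_potential_dense\<close> kills it; then \<open>w = 0\<close>
  leaves pairings with \<open>R w0\<close>, which \<open>R_dense\<close> kills.\<close>

lemma dat_dense:
  assumes F: "F \<in> Q0" and y0: "y0 \<in> Hb"
  obtains w0 w where "\<And>n. w n \<in> curves" "(\<lambda>n::nat. dat (w0 n) (w n)) \<longlonglongrightarrow> (F, y0)"
proof -
  let ?N = "(\<lambda>(w0, w). dat w0 w) ` (Hb \<times> curves)"
  have comb: "x + c *\<^sub>R y \<in> ?N" if xN: "x \<in> ?N" and yN: "y \<in> ?N" for x y c
  proof -
    obtain w0 w where x: "x = dat w0 w" "w0 \<in> Hb" "w \<in> curves" using xN by auto
    obtain v0 v where y: "y = dat v0 v" "v0 \<in> Hb" "v \<in> curves" using yN by auto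
    note * = x y
    have "x + c *\<^sub>R y = dat (w0 + c *\<^sub>R v0) (\<lambda>t. w t + c *\<^sub>R v t)"
      using * by (simp add: linear_dat curvesD)
    moreover have "(w0 + c *\<^sub>R v0, \<lambda>t. w t + c *\<^sub>R v t) \<in> Hb \<times> curves"
      using * by (auto intro!: subspace_add subspace_scale subspace_Hb curves_add curves_mult)
    ultimately show ?thesis by (metis (mono_tags, lifting) case_prod_conv image_eqI)
  qed
  have z: "(\<lambda>_. 0) \<in> curves" "0 \<in> Hb" using subspace_0[OF subspace_Hb] curves_const by auto
  hence z2: "dat 0 (\<lambda>_. 0) \<in> ?N" by force
  have z0: "0 \<in> ?N" using comb[OF z2 z2, of "-1"] by simp
  define S where "S = closure ?N"
  have "subspace ?N"
  proof (rule subspaceI[OF z0])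
    show "x + y \<in> ?N" if "x \<in> ?N" "y \<in> ?N" for x y using comb[OF that, of 1] by simp
    show "c *\<^sub>R x \<in> ?N" if "x \<in> ?N" for c x using comb[OF z0 that, of c] by simp
  qed
  hence S: "subspace S" "closed S" unfolding S_def by (simp_all add: subspace_closure)
  have NS: "dat w0 w \<in> S" if "w0 \<in> Hb" "w \<in> curves" for w0 w
    unfolding S_def by (rule subsetD[OF closure_subset]) (use that in force)
  have SQ: "S \<subseteq> Q0 \<times> Hb" unfolding S_def
  proof (rule closure_minimal)
    show "?N \<subseteq> Q0 \<times> Hb"
      by (auto simp: dat_def R_in_Hb intro!: subspace_add[OF subspace_Q0] J_in_Q0 curves_src B_in_Q0)
    show "closed (Q0 \<times> Hb)" by (intro closed_Times closed_Q0 closed_Hb)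
  qed
  obtain g h where gh: "(F, y0) - proj S (F, y0) = (g, h)" by (metis surj_pair)
  have "proj S (F, y0) \<in> Q0 \<times> Hb" using proj_in[OF S] SQ by blast
  hence g: "g \<in> Q0" and h: "h \<in> Hb"
    using gh F y0 by (auto simp: minus_prod_def intro: subspace_diff[OF subspace_Q0] subspace_diff[OF subspace_Hb])
  have orth: "g \<bullet> (J T (src w0 w) + B (J T (traj w0 w))) + h \<bullet> R w0 = 0" if "w0 \<in> Hb" "w \<in> curves" for w0 w
    using proj_orth[OF S NS[OF that], of "(F, y0)"] unfolding gh by (simp add: dat_def)
  have g0: "g = 0"
    by (rule src_potential_dense[OF g]) (use orth[OF z(2)] in \<open>simp add: R.zero\<close>)
  have h0: "h = 0"
    by (rule R_dense[OF h]) (use orth[OF _ z(1)] g0 in simp)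
  have "(F, y0) = proj S (F, y0)" using gh g0 h0 by (simp add: zero_prod_def[symmetric])
  hence "(F, y0) \<in> S" using proj_in[OF S] by metis
  then obtain X where X: "\<And>n. X n \<in> ?N" "X \<longlonglongrightarrow> (F, y0)" unfolding S_def closure_sequential by auto
  have "\<exists>w0 w. w \<in> curves \<and> X n = dat w0 w" for n using X(1)[of n] by auto
  then obtain w0 w where ww: "\<And>n. w n \<in> curves" "\<And>n. X n = dat (w0 n) (w n)" by metis
  show ?thesis by (rule that[of w w0, OF ww(1)]) (use X(2) in \<open>simp add: ww(2)[symmetric]\<close>)
qed

lemma J_const_Q0_inner:
  assumes "(\<phi>, \<gamma>) \<in> V" "t \<in> {0..T}"
  shows "PQ F \<bullet> J t (\<lambda>_. \<phi>) = F \<bullet> J t (\<lambda>_. \<phi>)"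
  unfolding PQ_def
  by (rule inner_proj_left[OF subspace_Q0 closed_Q0 J_const_in_Q0[OF fst_in_Hb[OF assms(1)] assms(2)]])

lemma traj_weak:
  assumes w: "continuous_on {0..T} w" and V: "(\<phi>, \<gamma>) \<in> V" and t: "t \<in> {0..T}"
  shows "traj w0 w t \<bullet> \<phi> + J T (\<lambda>t. D (W w0 w t)) \<bullet> J t (\<lambda>_. \<gamma>) + B (J T (traj w0 w)) \<bullet> J t (\<lambda>_. \<phi>)
     = snd (dat w0 w) \<bullet> \<phi> + fst (dat w0 w) \<bullet> J t (\<lambda>_. \<phi>)"
proof -
  have T0: "0 \<le> T" using T by simp
  show ?thesis
    using weak_identity[OF T0 w V t, of w0]
      inner_J_restrict[OF continuous_DW[OF T0 w] continuous_on_const t, of w0 \<gamma>]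
      inner_J_restrict[OF continuous_src[OF T0 w] continuous_on_const t, of w0 \<phi>]
    by (simp add: dat_def inner_add_left)
qed

text \<open>By linearity the energy estimate applies to differences, so convergence of the data
  forces uniform convergence of the trajectories and norm convergence of the gradients. Closedness
  of \<open>V\<close> identifies the limit gradient.\<close>

lemma wsol_exists:
  obtains K where "\<And>F y0. y0 \<in> Hb \<Longrightarrow> \<exists>y G. wsol F y0 y G \<and> norm (y T) \<le> K * norm (F, y0)"
proof -
  obtain K where K: "K \<ge> 0"
    and Ky: "\<And>w0 w t. continuous_on {0..T} w \<Longrightarrow> t \<in> {0..T} \<Longrightarrow> norm (traj w0 w t) \<le> K * norm (dat w0 w)"
    and KD: "\<And>w0 w. continuous_on {0..T} w \<Longrightarrow> norm (J T (\<lambda>t. D (W w0 w t))) \<le> K * norm (dat w0 w)"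
    using energy_estimate by blast
  have T0: "0 \<le> T" using T by simp
  have "\<exists>y G. wsol F y0 y G \<and> norm (y T) \<le> K * norm (F, y0)" if y0: "y0 \<in> Hb" for F y0
  proof -
    \<comment> \<open>Only data in \<open>Q0\<close> can be approximated, so \<open>PQ F\<close> is
      solved for; \<open>J_const_Q0_inner\<close> restores \<open>F\<close> and the unprojected
      potential at the end.\<close>
    have "PQ F \<in> Q0" unfolding PQ_def by (rule proj_in[OF subspace_Q0 closed_Q0])
    then obtain w0 w where w: "\<And>n. w n \<in> curves" and lim: "(\<lambda>n::nat. dat (w0 n) (w n)) \<longlonglongrightarrow> (PQ F, y0)"
      using dat_dense[OF _ y0] by metis
    note cw = curvesD(1)[OF w]
    define yn where "yn n = traj (w0 n) (w n)" for n
    define Dn where "Dn n = (\<lambda>t. D (W (w0 n) (w n) t))" for n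
    have cyn: "continuous_on {0..T} (yn n)" for n unfolding yn_def by (rule continuous_traj[OF cw])
    have cDn: "continuous_on {0..T} (Dn n)" for n unfolding Dn_def by (rule continuous_DW[OF T0 cw])
    let ?d = "\<lambda>n. dat (w0 n) (w n)"
    have cdiff: "continuous_on {0..T} (\<lambda>t. w n t + (-1) *\<^sub>R w m t)" for n m
      by (intro continuous_intros cw)
    have dd: "dat (w0 n + (-1) *\<^sub>R w0 m) (\<lambda>t. w n t + (-1) *\<^sub>R w m t) = ?d n - ?d m" for n m
      using linear_dat[OF cw cw, of "w0 n" "-1" "w0 m" n m] by simp
    have ydiff: "norm (yn n t - yn m t) \<le> K * norm (?d n - ?d m)" if "t \<in> {0..T}" for n m t
      using Ky[OF cdiff that, of "w0 n + (-1) *\<^sub>R w0 m" n m]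
      unfolding dd linear_traj[OF cw cw that] by (simp add: yn_def)
    have Ddiff: "norm (J T (Dn n) - J T (Dn m)) \<le> K * norm (?d n - ?d m)" for n m
    proof -
      have "J T (Dn n) - J T (Dn m) = J T (\<lambda>t. Dn n t - Dn m t)" by (rule J_diff[OF cDn cDn, symmetric])
      also have "\<dots> = J T (\<lambda>t. D (W (w0 n + (-1) *\<^sub>R w0 m) (\<lambda>t. w n t + (-1) *\<^sub>R w m t) t))"
        by (rule J_cong) (simp only: linear_W[OF cw cw] Dn_def D.add D.scaleR, simp)
      finally show ?thesis using KD[OF cdiff, of "w0 n + (-1) *\<^sub>R w0 m" n m] unfolding dd by simp
    qed
    have "Cauchy ?d" using lim by (rule LIMSEQ_imp_Cauchy)
    hence Cd: "\<exists>N. \<forall>n\<ge>N. \<forall>m\<ge>N. K * norm (?d n - ?d m) < e" if e: "e > 0" for e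
    proof -
      have "e / (K + 1) > 0" using e K by simp
      then obtain N where N: "\<And>m n. m \<ge> N \<Longrightarrow> n \<ge> N \<Longrightarrow> norm (?d m - ?d n) < e / (K + 1)"
        using CauchyD[OF \<open>Cauchy ?d\<close>] by blast
      have "K * norm (?d n - ?d m) < e" if "n \<ge> N" "m \<ge> N" for n m
      proof -
        have "K * norm (?d n - ?d m) \<le> (K + 1) * norm (?d n - ?d m)" by (intro mult_right_mono) auto
        also have "\<dots> < e" using N[OF that] K by (simp add: field_simps)
        finally show ?thesis .
      qed
      thus ?thesis by blast
    qed
    have "uniformly_Cauchy_on {0..T} yn"
      unfolding uniformly_Cauchy_on_def
    proof (intro allI impI)
      fix e :: real assume "e > 0"
      from Cd[OF this] obtain N where N: "\<And>n m. n \<ge> N \<Longrightarrow> m \<ge> N \<Longrightarrow> K * norm (?d n - ?d m) < e" by blast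
      show "\<exists>M. \<forall>x\<in>{0..T}. \<forall>m\<ge>M. \<forall>n\<ge>M. dist (yn m x) (yn n x) < e"
        by (rule exI[of _ N]) (auto simp: dist_norm intro!: le_less_trans[OF ydiff] N)
    qed
    then obtain y where y: "uniform_limit {0..T} yn y sequentially"
      using Cauchy_uniformly_convergent unfolding uniformly_convergent_on_def by blast
    have cy: "continuous_on {0..T} y"
      by (rule uniform_limit_theorem[OF always_eventually[OF allI[OF cyn]] y]) simp
    have ylim: "(\<lambda>n. yn n t) \<longlonglongrightarrow> y t" if "t \<in> {0..T}" for t
      by (rule tendsto_uniform_limitI[OF y that])
    have "Cauchy (\<lambda>n. J T (Dn n))"
    proof (rule CauchyI)
      fix e :: real assume "e > 0"
      from Cd[OF this] obtain N where N: "\<And>n m. n \<ge> N \<Longrightarrow> m \<ge> N \<Longrightarrow> K * norm (?d n - ?d m) < e" by blast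
      show "\<exists>M. \<forall>m\<ge>M. \<forall>n\<ge>M. norm (J T (Dn m) - J T (Dn n)) < e"
        by (rule exI[of _ N]) (auto intro!: le_less_trans[OF Ddiff] N)
    qed
    then obtain G where G: "(\<lambda>n. J T (Dn n)) \<longlonglongrightarrow> G" by (auto simp: Cauchy_convergent_iff convergent_def)
    have Jy: "(\<lambda>n. J T (yn n)) \<longlonglongrightarrow> J T y"
    proof (rule metric_LIMSEQ_I)
      fix e :: real assume e: "e > 0"
      define e' where "e' = e / (sqrt T + 1)"
      have e': "e' > 0" "sqrt T * e' < e" using e T by (auto simp: e'_def field_simps add_pos_nonneg)
      then obtain N where N: "\<And>n t. n \<ge> N \<Longrightarrow> t \<in> {0..T} \<Longrightarrow> dist (yn n t) (y t) < e'"
        using y unfolding uniform_limit_sequentially_iff by blast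
      have "dist (J T (yn n)) (J T y) < e" if "n \<ge> N" for n
      proof -
        have "norm (J T (\<lambda>t. yn n t - y t)) \<le> sqrt T * e'"
          by (intro norm_J_le continuous_intros cyn cy) (use N[OF that] in \<open>auto simp: dist_norm intro: less_imp_le\<close>)
        thus ?thesis using e'(2) by (simp add: dist_norm J_diff[OF cyn cy, symmetric])
      qed
      thus "\<exists>N. \<forall>n\<ge>N. dist (J T (yn n)) (J T y) < e" by blast
    qed
    have fs: "(\<lambda>n. fst (?d n)) \<longlonglongrightarrow> PQ F" "(\<lambda>n. snd (?d n)) \<longlonglongrightarrow> y0"
      using tendsto_fst[OF lim] tendsto_snd[OF lim] by simp_all
    have "y 0 = y0"
    proof (rule LIMSEQ_unique[OF ylim])
      show "0 \<in> {0..T}" using T by simp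
      have "yn n 0 = snd (?d n)" for n by (simp add: yn_def dat_def W_0[OF T0 cw])
      thus "(\<lambda>n. yn n 0) \<longlonglongrightarrow> y0" using fs(2) by simp
    qed
    moreover have "AE t in lborel. t \<in> {0..T} \<longrightarrow> (y t, slice G t) \<in> V"
    proof -
      \<comment> \<open>Membership in \<open>V\<close> is a condition at single times, so norm
        convergence of gradients must first be turned into convergence of slices along a
        subsequence.\<close>
      obtain r where r: "strict_mono r" "AE t in lborel. (\<lambda>n. slice (J T (Dn (r n))) t) \<longlonglongrightarrow> slice G t"
        using slice_LIMSEQ_subseq[OF G] by blast
      have "AE t in lborel. \<forall>n. slice (J T (Dn (r n))) t = indicator {0..T} t *\<^sub>R Dn (r n) t"
        unfolding AE_all_countable using slice_J[OF cDn] by blast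
      with r(2) show ?thesis
      proof eventually_elim
        case (elim t)
        show ?case
        proof
          assume t: "t \<in> {0..T}"
          have "(\<lambda>n. Dn (r n) t) \<longlonglongrightarrow> slice G t" using elim t by simp
          moreover have "(\<lambda>n. yn (r n) t) \<longlonglongrightarrow> y t"
            using LIMSEQ_subseq_LIMSEQ[OF ylim[OF t] r(1)] by (simp add: o_def)
          ultimately have "(\<lambda>n. (yn (r n) t, Dn (r n) t)) \<longlonglongrightarrow> (y t, slice G t)" by (intro tendsto_Pair)
          moreover have "(yn (r n) t, Dn (r n) t) \<in> V" for n unfolding yn_def Dn_def by (rule RD_in)
          ultimately show "(y t, slice G t) \<in> V" by (rule closed_sequentially[OF closed_V, rotated])
        qed
      qed
    qed
    moreover have "y t \<bullet> \<phi> + G \<bullet> J t (\<lambda>_. \<gamma>) + mult a (J T y) \<bullet> J t (\<lambda>_. \<phi>) = y0 \<bullet> \<phi> + F \<bullet> J t (\<lambda>_. \<phi>)"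
      if V: "(\<phi>, \<gamma>) \<in> V" and t: "t \<in> {0..T}" for \<phi> \<gamma> t
    proof -
      have "(\<lambda>n. yn n t \<bullet> \<phi> + J T (Dn n) \<bullet> J t (\<lambda>_. \<gamma>) + B (J T (yn n)) \<bullet> J t (\<lambda>_. \<phi>))
          \<longlonglongrightarrow> y t \<bullet> \<phi> + G \<bullet> J t (\<lambda>_. \<gamma>) + B (J T y) \<bullet> J t (\<lambda>_. \<phi>)"
        by (intro tendsto_add tendsto_inner tendsto_const ylim t G bounded_linear.tendsto[OF bounded_linear_B Jy])
      moreover have "(\<lambda>n. snd (?d n) \<bullet> \<phi> + fst (?d n) \<bullet> J t (\<lambda>_. \<phi>)) \<longlonglongrightarrow> y0 \<bullet> \<phi> + PQ F \<bullet> J t (\<lambda>_. \<phi>)"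
        by (intro tendsto_add tendsto_inner tendsto_const fs)
      ultimately have "y t \<bullet> \<phi> + G \<bullet> J t (\<lambda>_. \<gamma>) + B (J T y) \<bullet> J t (\<lambda>_. \<phi>) = y0 \<bullet> \<phi> + PQ F \<bullet> J t (\<lambda>_. \<phi>)"
        unfolding yn_def Dn_def traj_weak[OF cw V t] by (rule LIMSEQ_unique)
      thus ?thesis unfolding B_def J_const_Q0_inner[OF V t] .
    qed
    ultimately have "wsol F y0 y G" using cy by (simp add: wsol_def)
    moreover have "norm (y T) \<le> K * norm (F, y0)"
    proof -
      have "norm (y T) \<le> K * norm (PQ F, y0)"
      proof (rule LIMSEQ_le[OF tendsto_norm[OF ylim] tendsto_mult[OF tendsto_const tendsto_norm[OF lim]]])
        show "T \<in> {0..T}" using T by simp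
        thus "\<exists>N. \<forall>n\<ge>N. norm (yn n T) \<le> K * norm (?d n)" using Ky[OF cw] by (simp add: yn_def)
      qed
      also have "norm (PQ F, y0) \<le> norm (F, y0)"
        unfolding norm_Pair PQ_def
        by (intro real_sqrt_le_mono add_right_mono power_mono norm_proj_le[OF subspace_Q0 closed_Q0]) simp
      hence "K * norm (PQ F, y0) \<le> K * norm (F, y0)" using K by (rule mult_left_mono)
      finally show ?thesis .
    qed
    ultimately show ?thesis by blast
  qed
  thus thesis by (rule that)
qed

text \<open>Here \<open>z\<close> is the endpoint for source 0 and \<open>L\<close> the endpoint map
  for initial value 0. Uniqueness makes \<open>L\<close> well defined and linear, and the estimate
  in \<open>wsol_exists\<close> makes it bounded.\<close>

theorem endpoint_affine:
  assumes y0: "y0 \<in> Hb"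
  obtains L z where "bounded_linear L" "\<And>F. \<exists>y G. wsol F y0 y G" "\<And>F y G. wsol F y0 y G \<Longrightarrow> y T = z + L F"
proof -
  obtain K where K: "\<And>F y0. y0 \<in> Hb \<Longrightarrow> \<exists>y G. wsol F y0 y G \<and> norm (y T) \<le> K * norm (F, y0)"
    using wsol_exists by blast
  have TT: "T \<in> {0..T}" using T by simp
  have z: "0 \<in> Hb" by (rule subspace_0[OF subspace_Hb])
  have uniq: "y T = y' T" if "wsol F y0 y G" "wsol F y0 y' G'" for F y0 y y' G G'
  proof -
    have "wsol 0 0 (\<lambda>t. y t - y' t) (G - G')" using wsol_lincomb[OF that, of "-1"] by simp
    from wsol_unique_0[OF this TT] show ?thesis by simp
  qed
  define L where "L F = (SOME v. \<exists>y G. wsol F 0 y G \<and> v = y T)" for F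
  have "\<exists>y G. wsol F 0 y G \<and> L F = y T" for F
    unfolding L_def by (rule someI_ex) (use K[OF z, of F] in blast)
  then have L: "L F = y T" if "wsol F 0 y G" for F y G using uniq that by metis
  obtain yh Gh where h: "wsol 0 y0 yh Gh" using K[OF y0] by blast
  have "bounded_linear L"
  proof (rule bounded_linear_intro)
    fix F F' and r :: real
    obtain y G y' G' where s: "wsol F 0 y G" "wsol F' 0 y' G'" using K[OF z] by blast
    show "L (F + F') = L F + L F'"
      using L[of "F + F'"] wsol_lincomb[OF s, of 1] L[OF s(1)] L[OF s(2)] by simp
    obtain y0' G0 where s0: "wsol 0 0 y0' G0" using K[OF z] by blast
    show "L (r *\<^sub>R F) = r *\<^sub>R L F"
      using L[of "r *\<^sub>R F"] wsol_lincomb[OF s0 s(1), of r] L[OF s(1)] wsol_unique_0[OF s0 TT] by simp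
    obtain y2 G2 where "wsol F 0 y2 G2" "norm (y2 T) \<le> K * norm (F, 0::('a, real) l2)" using K[OF z, of F] by blast
    thus "norm (L F) \<le> norm F * K" using L by (simp add: norm_Pair mult.commute)
  qed
  moreover have "\<exists>y G. wsol F y0 y G" for F using K[OF y0] by blast
  moreover have "y T = yh T + L F" if "wsol F y0 y G" for F y G
    using L[of F] wsol_lincomb[OF that h, of "-1"] by simp
  ultimately show ?thesis by (rule that)
qed

end

section \<open>The form of the Dirichlet Laplacian\<close>

text \<open>The product of two restricted measures is identified with a restriction of Lebesgue
  measure on the product space, so that functions on the cylinder become classes of the same type
  \<open>l2\<close>.\<close>

lemma cylinder_eq:
  fixes \<Omega> :: "'a::euclidean_space set"
  assumes \<Omega>: "\<Omega> \<in> sets borel"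
  shows "cylinder T \<Omega> = restrict_space lborel ({0<..<T} \<times> \<Omega>)"
proof (rule pair_measure_eqI)
  let ?I = "{0<..<T}"
  have I\<Omega>: "?I \<times> \<Omega> \<in> sets lborel"
  proof -
    have "?I \<times> \<Omega> \<in> sets (lborel \<Otimes>\<^sub>M lborel)" using \<Omega> by (intro pair_measureI) auto
    thus ?thesis by (simp only: lborel_prod)
  qed
  show "sigma_finite_measure (borel_on ?I)" "sigma_finite_measure (borel_on \<Omega>)"
    by (rule sigma_finite_measure_restrict_space[OF lborel.sigma_finite_measure_axioms], use \<Omega> in simp)+
  show "sets (cylinder T \<Omega>) = sets (restrict_space lborel (?I \<times> \<Omega>))"
  proof
    have "sigma_sets (space (borel_on ?I) \<times> space (borel_on \<Omega>)) {a \<times> b |a b. a \<in> sets (borel_on ?I) \<and> b \<in> sets (borel_on \<Omega>)}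
       \<subseteq> sets (restrict_space lborel (?I \<times> \<Omega>))"
    proof -
      have sp: "space (borel_on ?I) \<times> space (borel_on \<Omega>) = space (restrict_space lborel (?I \<times> \<Omega>))"
        by (simp add: space_restrict_space)
      have "a \<times> b \<in> sets (restrict_space lborel (?I \<times> \<Omega>))"
        if ab: "a \<in> sets (borel_on ?I)" "b \<in> sets (borel_on \<Omega>)" for a b
      proof -
        obtain a' b' where a': "a' \<in> sets lborel" "a = ?I \<inter> a'" and b': "b' \<in> sets lborel" "b = \<Omega> \<inter> b'"
          using ab by (auto simp: sets_restrict_space)
        have "a' \<times> b' \<in> sets (lborel \<Otimes>\<^sub>M lborel)" by (rule pair_measureI[OF a'(1) b'(1)])
        hence "a' \<times> b' \<in> sets lborel" by (simp only: lborel_prod)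
        moreover have "a \<times> b = (?I \<times> \<Omega>) \<inter> (a' \<times> b')" using a' b' by auto
        ultimately show ?thesis unfolding sets_restrict_space by blast
      qed
      hence "{a \<times> b |a b. a \<in> sets (borel_on ?I) \<and> b \<in> sets (borel_on \<Omega>)} \<subseteq> sets (restrict_space lborel (?I \<times> \<Omega>))"
        by auto
      thus ?thesis unfolding sp by (rule sets.sigma_sets_subset)
    qed
    thus "sets (cylinder T \<Omega>) \<subseteq> sets (restrict_space lborel (?I \<times> \<Omega>))" by (simp only: sets_pair_measure)
    show "sets (restrict_space lborel (?I \<times> \<Omega>)) \<subseteq> sets (cylinder T \<Omega>)"
    proof
      fix X assume "X \<in> sets (restrict_space lborel (?I \<times> \<Omega>))"
      then obtain X' where X': "X' \<in> sets lborel" "X = (?I \<times> \<Omega>) \<inter> X'" unfolding sets_restrict_space by blast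
      have "fst \<in> measurable (cylinder T \<Omega>) lborel" "snd \<in> measurable (cylinder T \<Omega>) lborel"
        by (auto intro!: measurable_compose[OF measurable_fst measurable_restrict_space1]
              measurable_compose[OF measurable_snd measurable_restrict_space1])
      hence "(\<lambda>z. z) \<in> measurable (cylinder T \<Omega>) (lborel \<Otimes>\<^sub>M lborel)"
        using measurable_Pair[of fst "cylinder T \<Omega>" lborel snd lborel] by simp
      moreover have "X' \<in> sets (lborel \<Otimes>\<^sub>M lborel)" using X'(1) by (simp only: lborel_prod)
      ultimately have "(\<lambda>z. z) -` X' \<inter> space (cylinder T \<Omega>) \<in> sets (cylinder T \<Omega>)" by (rule measurable_sets)
      moreover have "(\<lambda>z. z) -` X' \<inter> space (cylinder T \<Omega>) = X"
        unfolding X'(2) by (auto simp: space_pair_measure space_restrict_space)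
      ultimately show "X \<in> sets (cylinder T \<Omega>)" by simp
    qed
  qed
  show "emeasure (borel_on ?I) a * emeasure (borel_on \<Omega>) b = emeasure (restrict_space lborel (?I \<times> \<Omega>)) (a \<times> b)"
    if a: "a \<in> sets (borel_on ?I)" and b: "b \<in> sets (borel_on \<Omega>)" for a b
  proof -
    have a2: "a \<subseteq> ?I" "a \<in> sets lborel" and b2: "b \<subseteq> \<Omega>" "b \<in> sets lborel"
    proof -
      obtain a' b' where "a' \<in> sets lborel" "a = ?I \<inter> a'" "b' \<in> sets lborel" "b = \<Omega> \<inter> b'"
        using a b by (auto simp: sets_restrict_space)
      thus "a \<subseteq> ?I" "a \<in> sets lborel" "b \<subseteq> \<Omega>" "b \<in> sets lborel" using \<Omega> by simp_all
    qed
    have "emeasure (restrict_space lborel (?I \<times> \<Omega>)) (a \<times> b) = emeasure lborel (a \<times> b)"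
      by (rule emeasure_restrict_space) (use I\<Omega> a2 b2 in auto)
    also have "\<dots> = emeasure (lborel \<Otimes>\<^sub>M lborel) (a \<times> b)" by (simp only: lborel_prod)
    also have "\<dots> = emeasure lborel a * emeasure lborel b"
      by (rule lborel.emeasure_pair_measure_Times[OF a2(2) b2(2)])
    also have "\<dots> = emeasure (borel_on ?I) a * emeasure (borel_on \<Omega>) b"
      by (subst (1 2) emeasure_restrict_space) (use a2 b2 \<Omega> in auto)
    finally show ?thesis ..
  qed
qed

section \<open>Extension by zero\<close>

definition zext :: "'c set \<Rightarrow> ('c \<Rightarrow> 'b::real_vector) \<Rightarrow> 'c \<Rightarrow> 'b" where
  "zext S f x = (if x \<in> S then f x else 0)"

lemma zext_eq: "zext S f = (\<lambda>x. indicator S x *\<^sub>R f x)"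
  by (auto simp: zext_def indicator_def)

lemma L2_restrict_iff:
  fixes f :: "'c::euclidean_space \<Rightarrow> 'b::euclidean_space"
  assumes S: "S \<in> sets borel"
  shows "f \<in> L2 (restrict_space lborel S) \<longleftrightarrow> zext S f \<in> L2 lborel"
proof -
  have "(\<lambda>x. indicator S x *\<^sub>R (norm (f x))\<^sup>2) = (\<lambda>x. (norm (indicator S x *\<^sub>R f x))\<^sup>2)"
    by (auto simp: indicator_def)
  thus ?thesis using S
    by (simp add: L2_def borel_measurable_restrict_space_iff integrable_restrict_space zext_eq)
qed

lemma L2_norm_restrict:
  fixes f :: "'c::euclidean_space \<Rightarrow> 'b::euclidean_space"
  assumes S: "S \<in> sets borel" and f: "zext S f \<in> L2 lborel"
  shows "L2_norm (restrict_space lborel S) f = norm (cls (zext S f))"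
proof -
  have "(\<lambda>x. indicator S x *\<^sub>R (norm (f x))\<^sup>2) = (\<lambda>x. (norm (zext S f x))\<^sup>2)"
    by (auto simp: indicator_def zext_def)
  hence "L2_norm (restrict_space lborel S) f = sqrt ((norm (cls (zext S f)))\<^sup>2)"
    unfolding L2_norm_def norm_cls[OF f] using S by (simp add: integral_restrict_space)
  thus ?thesis by simp
qed

lemma zext_L2:
  assumes S: "S \<in> sets borel" and f: "f \<in> L2 lborel"
  shows "zext S f \<in> L2 lborel"
  unfolding zext_eq by (rule L2_bounded_mult[OF f, of _ 1]) (use S in auto)

lemma zext_diff: "zext S (\<lambda>x. f x - g x) = (\<lambda>x. zext S f x - zext S g x)"
  by (auto simp: zext_def)

lemma norm_cls_zext_le:
  assumes S: "S \<in> sets borel" and f: "f \<in> L2 lborel"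
  shows "norm (cls (zext S f)) \<le> norm (cls f)"
proof -
  have m: "indicator S \<in> borel_measurable borel" using S by auto
  have "cls (zext S f) = mult (indicator S) (cls f)"
    unfolding zext_eq by (subst mult_cls[OF m, of 1, OF _ f]) auto
  thus ?thesis using norm_mult_le[OF m, of 1 "cls f"] by simp
qed

section \<open>Test functions and the graph of the gradient\<close>

lemma C_k_add_scale: "C_k k f \<Longrightarrow> C_k k g \<Longrightarrow> C_k k (\<lambda>x. f x + c * g x)"
proof (induction k arbitrary: f g)
  case 0
  thus ?case by (auto intro!: continuous_intros)
next
  case (Suc k)
  have d: "f differentiable at x" "g differentiable at x" for x using Suc.prems by auto
  have "((\<lambda>x. f x + c * g x) has_derivative
      (\<lambda>h. frechet_derivative f (at x) h + c * frechet_derivative g (at x) h)) (at x)" for x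
    using d[of x] unfolding frechet_derivative_works by (intro has_derivative_add has_derivative_mult_right)
  hence "frechet_derivative (\<lambda>x. f x + c * g x) (at x) = (\<lambda>h. frechet_derivative f (at x) h + c * frechet_derivative g (at x) h)" for x
    using frechet_derivative_at by metis
  thus ?case using Suc d by (auto intro!: derivative_intros)
qed

lemma grad_add_scale:
  assumes "f differentiable at x" "g differentiable at x"
  shows "grad (\<lambda>x. f x + c * g x) x = grad f x + c *\<^sub>R grad g x"
proof -
  have "((\<lambda>x. f x + c * g x) has_derivative
      (\<lambda>h. frechet_derivative f (at x) h + c * frechet_derivative g (at x) h)) (at x)"
    using assms unfolding frechet_derivative_works by (intro has_derivative_add has_derivative_mult_right)
  hence "frechet_derivative (\<lambda>x. f x + c * g x) (at x) = (\<lambda>h. frechet_derivative f (at x) h + c * frechet_derivative g (at x) h)"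
    using frechet_derivative_at by metis
  thus ?thesis by (simp add: grad_def scaleR_add_left sum.distrib scaleR_sum_right)
qed

lemma test_fun_differentiable: "\<phi> \<in> test_fun \<Omega> \<Longrightarrow> \<phi> differentiable at x"
proof -
  assume "\<phi> \<in> test_fun \<Omega>"
  hence "C_k (Suc 0) \<phi>" by (simp add: test_fun_def del: C_k.simps)
  thus ?thesis by simp
qed

lemma test_fun_add_scale:
  assumes f: "f \<in> test_fun \<Omega>" and g: "g \<in> test_fun \<Omega>"
  shows "(\<lambda>x. f x + c * g x) \<in> test_fun \<Omega>"
proof -
  let ?Sf = "closure {x. f x \<noteq> 0}" and ?Sg = "closure {x. g x \<noteq> 0}" and ?S = "closure {x. f x + c * g x \<noteq> 0}"
  have sub: "?S \<subseteq> ?Sf \<union> ?Sg"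
    unfolding closure_Un[symmetric] by (rule closure_mono) auto
  have "compact (?Sf \<union> ?Sg)" using f g by (intro compact_Un) (auto simp: test_fun_def)
  hence "compact ((?Sf \<union> ?Sg) \<inter> ?S)" by (rule compact_Int_closed) simp
  moreover have "(?Sf \<union> ?Sg) \<inter> ?S = ?S" using sub by auto
  ultimately have "compact ?S" by simp
  moreover have "?S \<subseteq> \<Omega>" using sub f g by (auto simp: test_fun_def)
  moreover have "\<forall>k. C_k k (\<lambda>x. f x + c * g x)"
    by (intro allI C_k_add_scale) (use f g in \<open>auto simp: test_fun_def\<close>)
  ultimately show ?thesis unfolding test_fun_def by (intro CollectI conjI)
qed

lemma C_k_zero: "C_k k (\<lambda>x::'a::euclidean_space. 0)"
  by (induction k) simp_all

lemma test_fun_zero: "(\<lambda>x. 0) \<in> test_fun \<Omega>"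
  by (simp add: test_fun_def C_k_zero)

text \<open>The complement of the closed support is open, so the function is locally constant there
  and its gradient vanishes too.\<close>

lemma test_fun_outside:
  assumes "\<phi> \<in> test_fun \<Omega>" "x \<notin> closure {x. \<phi> x \<noteq> 0}"
  shows "\<phi> x = 0" "grad \<phi> x = 0"
proof -
  show "\<phi> x = 0" using assms(2) closure_subset[of "{x. \<phi> x \<noteq> 0}"] by auto
  have "((\<lambda>x. 0::real) has_derivative (\<lambda>h. 0)) (at x)" by simp
  hence "(\<phi> has_derivative (\<lambda>h. 0)) (at x)"
  proof (rule has_derivative_transform_within_open)
    show "open (- closure {x. \<phi> x \<noteq> 0})" "x \<in> - closure {x. \<phi> x \<noteq> 0}" using assms(2) by auto
    show "0 = \<phi> x'" if "x' \<in> - closure {x. \<phi> x \<noteq> 0}" for x'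
      using that closure_subset[of "{x. \<phi> x \<noteq> 0}"] by auto
  qed
  hence "frechet_derivative \<phi> (at x) = (\<lambda>h. 0)" by (rule frechet_derivative_at[symmetric])
  thus "grad \<phi> x = 0" by (simp add: grad_def)
qed

lemma test_fun_outside_domain:
  assumes "\<phi> \<in> test_fun \<Omega>" "x \<notin> \<Omega>"
  shows "\<phi> x = 0" "grad \<phi> x = 0"
  using test_fun_outside[OF assms(1), of x] assms by (auto simp: test_fun_def)

lemma L2_continuous_compact_support:
  fixes f :: "'a::euclidean_space \<Rightarrow> 'b::euclidean_space"
  assumes f: "continuous_on UNIV f" and K: "compact K" and z: "\<And>x. x \<notin> K \<Longrightarrow> f x = 0"
  shows "f \<in> L2 lborel"
proof -
  have "integrable lborel (\<lambda>x. indicator K x *\<^sub>R (norm (f x))\<^sup>2)"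
    by (rule borel_integrable_compact[OF K]) (intro continuous_intros continuous_on_subset[OF f] subset_UNIV)
  moreover have "(\<lambda>x. indicator K x *\<^sub>R (norm (f x))\<^sup>2) = (\<lambda>x. (norm (f x))\<^sup>2)"
  proof (rule HOL.ext)
    show "indicator K x *\<^sub>R (norm (f x))\<^sup>2 = (norm (f x))\<^sup>2" for x
      using z[of x] by (cases "x \<in> K") auto
  qed
  ultimately show ?thesis using borel_measurable_continuous_onI[OF f] by (simp add: L2_def)
qed

lemma test_fun_L2:
  assumes \<phi>: "\<phi> \<in> test_fun \<Omega>"
  shows "\<phi> \<in> L2 lborel" "grad \<phi> \<in> L2 lborel"
proof -
  have K: "compact (closure {x. \<phi> x \<noteq> 0})" using \<phi> by (simp add: test_fun_def)
  have C0: "C_k 0 \<phi>" and C1: "C_k (Suc 0) \<phi>" using \<phi> by (simp_all add: test_fun_def del: C_k.simps)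
  have "continuous_on UNIV \<phi>" using C0 by simp
  from L2_continuous_compact_support[OF this K test_fun_outside(1)[OF \<phi>]] show "\<phi> \<in> L2 lborel" .
  have "continuous_on UNIV (\<lambda>x. frechet_derivative \<phi> (at x) i)" if "i \<in> Basis" for i
    using C1 that by simp
  hence "continuous_on UNIV (grad \<phi>)"
    unfolding grad_def[abs_def] by (intro continuous_on_sum continuous_on_scaleR continuous_on_const)
  from L2_continuous_compact_support[OF this K test_fun_outside(2)[OF \<phi>]] show "grad \<phi> \<in> L2 lborel" .
qed

text \<open>The graph of the weak gradient on the Sobolev space with zero boundary values, extended
  by 0 to the whole space. As a closure it is closed by construction, matching the approximation
  clause of \<open>H10_with_grad\<close>.\<close>

definition dirichlet_graph :: "'a::euclidean_space set \<Rightarrow> (('a, real) l2 \<times> ('a, 'a) l2) set" where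
  "dirichlet_graph \<Omega> = closure ((\<lambda>\<phi>. (cls \<phi>, cls (grad \<phi>))) ` test_fun \<Omega>)"

lemma form_graph_dirichlet: "form_graph (dirichlet_graph \<Omega>)"
proof
  let ?N = "(\<lambda>\<phi>. (cls \<phi>, cls (grad \<phi>))) ` test_fun \<Omega>"
  have comb: "x + c *\<^sub>R y \<in> ?N" if xN: "x \<in> ?N" and yN: "y \<in> ?N" for x y c
  proof -
    obtain f where f: "f \<in> test_fun \<Omega>" "x = (cls f, cls (grad f))" using xN by auto
    obtain g where g: "g \<in> test_fun \<Omega>" "y = (cls g, cls (grad g))" using yN by auto
    note fg = f(1) g(1) f(2) g(2)
    let ?h = "\<lambda>x. f x + c * g x"
    have "cls ?h = cls f + c *\<^sub>R cls g"
      using cls_add[OF test_fun_L2(1)[OF fg(1)] L2_scaleR[OF test_fun_L2(1)[OF fg(2)], of c]]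
        cls_scaleR[OF test_fun_L2(1)[OF fg(2)], of c] by simp
    moreover have "grad ?h = (\<lambda>x. grad f x + c *\<^sub>R grad g x)"
      by (rule ext) (rule grad_add_scale; rule test_fun_differentiable; fact)
    hence "cls (grad ?h) = cls (grad f) + c *\<^sub>R cls (grad g)"
      using cls_add[OF test_fun_L2(2)[OF fg(1)] L2_scaleR[OF test_fun_L2(2)[OF fg(2)], of c]]
        cls_scaleR[OF test_fun_L2(2)[OF fg(2)], of c] by simp
    ultimately have "x + c *\<^sub>R y = (cls ?h, cls (grad ?h))" using fg by simp
    thus ?thesis using test_fun_add_scale[OF fg(1,2), of c] by (rule image_eqI)
  qed
  have N: "(cls (\<lambda>x. 0), cls (grad (\<lambda>x. 0))) \<in> ?N" using test_fun_zero by blast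
  have z0: "0 \<in> ?N" using comb[OF N N, of "-1"] by (simp add: zero_prod_def)
  have "subspace ?N"
  proof (rule subspaceI[OF z0])
    show "x + y \<in> ?N" if "x \<in> ?N" "y \<in> ?N" for x y using comb[OF that, of 1] by simp
    show "c *\<^sub>R x \<in> ?N" if "x \<in> ?N" for c x using comb[OF z0 that, of c] by simp
  qed
  thus "subspace (dirichlet_graph \<Omega>)" unfolding dirichlet_graph_def by (rule subspace_closure)
  show "closed (dirichlet_graph \<Omega>)" unfolding dirichlet_graph_def by simp
qed

lemma test_fun_graph: "\<phi> \<in> test_fun \<Omega> \<Longrightarrow> (cls \<phi>, cls (grad \<phi>)) \<in> dirichlet_graph \<Omega>"
  unfolding dirichlet_graph_def by (rule subsetD[OF closure_subset imageI])

lemma H10_imp_graph: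
  assumes \<Omega>: "\<Omega> \<in> sets borel" and H: "H10_with_grad \<Omega> v g"
  shows "(cls (zext \<Omega> v), cls (zext \<Omega> g)) \<in> dirichlet_graph \<Omega>"
proof -
  have v: "zext \<Omega> v \<in> L2 lborel" and g: "zext \<Omega> g \<in> L2 lborel"
    using H L2_restrict_iff[OF \<Omega>, of v] L2_restrict_iff[OF \<Omega>, of g] by (auto simp: H10_with_grad_def)
  obtain \<phi> where \<phi>: "\<And>n. \<phi> n \<in> test_fun \<Omega>"
    and lim: "(\<lambda>n. L2_norm (borel_on \<Omega>) (\<lambda>x. \<phi> n x - v x)) \<longlonglongrightarrow> 0"
       "(\<lambda>n. L2_norm (borel_on \<Omega>) (\<lambda>x. grad (\<phi> n) x - g x)) \<longlonglongrightarrow> 0"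
    using H by (auto simp: H10_with_grad_def)
  have e: "zext \<Omega> (\<lambda>x. \<phi> n x - v x) = (\<lambda>x. \<phi> n x - zext \<Omega> v x)"
    "zext \<Omega> (\<lambda>x. grad (\<phi> n) x - g x) = (\<lambda>x. grad (\<phi> n) x - zext \<Omega> g x)" for n
    using test_fun_outside_domain[OF \<phi>[of n]] by (auto simp: zext_def)
  have n1: "L2_norm (borel_on \<Omega>) (\<lambda>x. \<phi> n x - v x) = norm (cls (\<phi> n) - cls (zext \<Omega> v))" for n
    using L2_norm_restrict[OF \<Omega>, of "\<lambda>x. \<phi> n x - v x"] L2_diff[OF test_fun_L2(1)[OF \<phi>[of n]] v]
    by (simp add: e cls_diff test_fun_L2[OF \<phi>] v)
  have n2: "L2_norm (borel_on \<Omega>) (\<lambda>x. grad (\<phi> n) x - g x) = norm (cls (grad (\<phi> n)) - cls (zext \<Omega> g))" for n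
    using L2_norm_restrict[OF \<Omega>, of "\<lambda>x. grad (\<phi> n) x - g x"] L2_diff[OF test_fun_L2(2)[OF \<phi>[of n]] g]
    by (simp add: e cls_diff test_fun_L2[OF \<phi>] g)
  have "(\<lambda>n. cls (\<phi> n)) \<longlonglongrightarrow> cls (zext \<Omega> v)"
    by (rule LIM_zero_cancel, rule tendsto_norm_zero_cancel) (use lim(1) n1 in simp)
  moreover have "(\<lambda>n. cls (grad (\<phi> n))) \<longlonglongrightarrow> cls (zext \<Omega> g)"
    by (rule LIM_zero_cancel, rule tendsto_norm_zero_cancel) (use lim(2) n2 in simp)
  ultimately have "(\<lambda>n. (cls (\<phi> n), cls (grad (\<phi> n)))) \<longlonglongrightarrow> (cls (zext \<Omega> v), cls (zext \<Omega> g))"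
    by (rule tendsto_Pair)
  thus ?thesis
    by (rule closed_sequentially[OF form_graph.closed_V[OF form_graph_dirichlet], rotated])
       (rule test_fun_graph[OF \<phi>])
qed

text \<open>\<open>H10_with_grad\<close> measures distances over the domain only, and restricting
  from the whole space does not increase norms, so the approximating test functions still
  converge.\<close>

lemma graph_imp_H10:
  assumes \<Omega>: "\<Omega> \<in> sets borel" and v: "v \<in> L2 lborel" and g: "g \<in> L2 lborel"
    and V: "(cls v, cls g) \<in> dirichlet_graph \<Omega>"
  shows "H10_with_grad \<Omega> v g"
proof -
  obtain X where X: "\<And>n. X n \<in> (\<lambda>\<phi>. (cls \<phi>, cls (grad \<phi>))) ` test_fun \<Omega>" "X \<longlonglongrightarrow> (cls v, cls g)"
    using V unfolding dirichlet_graph_def closure_sequential by auto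
  have "\<exists>\<phi>\<in>test_fun \<Omega>. X n = (cls \<phi>, cls (grad \<phi>))" for n using X(1)[of n] by auto
  then obtain \<phi> where \<phi>: "\<And>n. \<phi> n \<in> test_fun \<Omega>" "\<And>n. X n = (cls (\<phi> n), cls (grad (\<phi> n)))" by metis
  have lim: "(\<lambda>n. cls (\<phi> n)) \<longlonglongrightarrow> cls v" "(\<lambda>n. cls (grad (\<phi> n))) \<longlonglongrightarrow> cls g"
    using tendsto_fst[OF X(2)] tendsto_snd[OF X(2)] by (simp_all add: \<phi>(2))
  have d1: "(\<lambda>x. \<phi> n x - v x) \<in> L2 lborel" and d2: "(\<lambda>x. grad (\<phi> n) x - g x) \<in> L2 lborel" for n
    by (intro L2_diff test_fun_L2[OF \<phi>(1)] v g)+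
  have le1: "L2_norm (borel_on \<Omega>) (\<lambda>x. \<phi> n x - v x) \<le> norm (cls (\<phi> n) - cls v)" for n
    using norm_cls_zext_le[OF \<Omega> d1[of n]]
    by (simp add: L2_norm_restrict[OF \<Omega> zext_L2[OF \<Omega> d1]] cls_diff test_fun_L2[OF \<phi>(1)] v)
  have le2: "L2_norm (borel_on \<Omega>) (\<lambda>x. grad (\<phi> n) x - g x) \<le> norm (cls (grad (\<phi> n)) - cls g)" for n
    using norm_cls_zext_le[OF \<Omega> d2[of n]]
    by (simp add: L2_norm_restrict[OF \<Omega> zext_L2[OF \<Omega> d2]] cls_diff test_fun_L2[OF \<phi>(1)] g)
  have nn: "0 \<le> L2_norm M f" for M and f :: "'b \<Rightarrow> 'c::euclidean_space" by (simp add: L2_norm_def)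
  have "(\<lambda>n. L2_norm (borel_on \<Omega>) (\<lambda>x. \<phi> n x - v x)) \<longlonglongrightarrow> 0"
    by (rule tendsto_sandwich[OF _ _ tendsto_const tendsto_norm_zero[OF LIM_zero[OF lim(1)]]])
       (simp_all add: le1 nn)
  moreover have "(\<lambda>n. L2_norm (borel_on \<Omega>) (\<lambda>x. grad (\<phi> n) x - g x)) \<longlonglongrightarrow> 0"
    by (rule tendsto_sandwich[OF _ _ tendsto_const tendsto_norm_zero[OF LIM_zero[OF lim(2)]]])
       (simp_all add: le2 nn)
  ultimately show ?thesis
    using \<phi>(1) L2_restrict_iff[OF \<Omega>, of v] L2_restrict_iff[OF \<Omega>, of g] zext_L2[OF \<Omega> v] zext_L2[OF \<Omega> g]
    by (auto simp: H10_with_grad_def)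
qed

section \<open>Weak solutions of the heat equation as curves in the Hilbert space\<close>

lemma integral_borel_on:
  fixes h k :: "'c::euclidean_space \<Rightarrow> 'b::euclidean_space"
  assumes "S \<in> sets borel" "\<And>x. x \<in> S \<Longrightarrow> h x = k x" "\<And>x. x \<notin> S \<Longrightarrow> h x = 0"
  shows "(\<integral>x. k x \<partial>borel_on S) = (\<integral>x. h x \<partial>lborel)"
proof -
  have "(\<lambda>x. indicator S x *\<^sub>R k x) = h" using assms(2,3) by (auto simp: indicator_def fun_eq_iff)
  thus ?thesis using assms(1) by (simp add: integral_restrict_space)
qed

lemma bounded_linear_J_const: "t \<ge> 0 \<Longrightarrow> bounded_linear (\<lambda>v::('a::euclidean_space, 'b::euclidean_space) l2. J t (\<lambda>_. v))"
proof (rule bounded_linear_intro[of _ "sqrt t"])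
  fix v :: "('a, 'b) l2" assume t: "t \<ge> 0"
  have "(norm (J t (\<lambda>_. v)))\<^sup>2 = (norm v * sqrt t)\<^sup>2"
    using norm_J[of t "\<lambda>_. v"] t by (simp add: power_mult_distrib)
  hence "norm (J t (\<lambda>_. v)) = norm v * sqrt t" by (rule power2_eq_imp_eq) (use t in auto)
  thus "norm (J t (\<lambda>_. v)) \<le> norm v * sqrt t" by simp
qed (simp_all add: J_add J_scaleR)

lemma measurable_section_integral:
  fixes h :: "real \<times> 'a::euclidean_space \<Rightarrow> real"
  assumes "h \<in> borel_measurable borel"
  shows "(\<lambda>s. \<integral>x. h (s, x) \<partial>lborel) \<in> borel_measurable borel"
proof -
  have [measurable]: "h \<in> borel_measurable (lborel \<Otimes>\<^sub>M lborel)" unfolding lborel_prod using assms by simp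
  have "(\<lambda>s. \<integral>x. h (s, x) \<partial>lborel) \<in> borel_measurable lborel" by measurable
  thus ?thesis by simp
qed

lemma borel_measurable_compose_snd:
  fixes m :: "'a::euclidean_space \<Rightarrow> 'b::euclidean_space"
  assumes "m \<in> borel_measurable borel"
  shows "(\<lambda>z::real \<times> 'a. m (snd z)) \<in> borel_measurable borel"
  by (rule measurable_compose[OF _ assms]) (intro borel_measurable_continuous_onI continuous_intros)

text \<open>Pairing with a constant-in-time element is an iterated integral; the closed time
  interval of \<open>J\<close> and the open one of the definitions differ by a null set.\<close>

lemma inner_J_const_cls:
  fixes U :: "real \<times> 'a::euclidean_space \<Rightarrow> 'b::euclidean_space"
  assumes U: "U \<in> L2 lborel" and \<psi>: "\<psi> \<in> L2 lborel"
  shows "cls U \<bullet> J t (\<lambda>_. cls \<psi>) = (\<integral>s. (\<integral>x. U (s, x) \<bullet> \<psi> x \<partial>lborel) \<partial>borel_on {0<..<t})"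
    and "integrable (borel_on {0<..<t}) (\<lambda>s. \<integral>x. U (s, x) \<bullet> \<psi> x \<partial>lborel)"
proof -
  let ?h = "\<lambda>s. \<integral>x. U (s, x) \<bullet> \<psi> x \<partial>lborel"
  have Um: "U \<in> borel_measurable borel" "\<psi> \<in> borel_measurable borel" using U \<psi> by (auto simp: L2_def)
  have "(\<lambda>z. U z \<bullet> \<psi> (snd z)) \<in> borel_measurable borel"
    by (intro borel_measurable_inner Um(1) borel_measurable_compose_snd Um(2))
  from measurable_section_integral[OF this] have [measurable]: "?h \<in> borel_measurable borel" by simp
  have "AE s in lborel. s \<noteq> 0 \<and> s \<noteq> t" using AE_lborel_singleton[of 0] AE_lborel_singleton[of t] by auto
  with slice_cls[OF U] AE_L2_section[OF U]
  have eq: "AE s in lborel. indicator {0..t} s *\<^sub>R (cls \<psi> \<bullet> slice (cls U) s) = indicator {0<..<t} s *\<^sub>R ?h s"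
    by eventually_elim (auto simp: inner_cls \<psi> indicator_def inner_commute)
  note i = inner_J_left(2)[of t "\<lambda>_. cls \<psi>" "cls U", OF continuous_on_const]
  have "cls U \<bullet> J t (\<lambda>_. cls \<psi>) = (\<integral>s. indicator {0..t} s *\<^sub>R (cls \<psi> \<bullet> slice (cls U) s) \<partial>lborel)"
    by (subst inner_commute) (rule inner_J_const_left)
  also have "\<dots> = (\<integral>s. indicator {0<..<t} s *\<^sub>R ?h s \<partial>lborel)"
    by (rule integral_cong_AE[OF borel_measurable_integrable[OF i] _ eq]) measurable
  also have "\<dots> = (\<integral>s. ?h s \<partial>borel_on {0<..<t})" by (simp add: integral_restrict_space)
  finally show "cls U \<bullet> J t (\<lambda>_. cls \<psi>) = (\<integral>s. ?h s \<partial>borel_on {0<..<t})" .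
  have "integrable lborel (\<lambda>s. indicator {0<..<t} s *\<^sub>R ?h s)"
    by (rule integrable_cong_AE[THEN iffD1, OF borel_measurable_integrable[OF i] _ eq i]) measurable
  thus "integrable (borel_on {0<..<t}) ?h" by (simp add: integrable_restrict_space)
qed

section \<open>Translation between functions on the cylinder and classes\<close>

locale heat_problem =
  fixes \<Omega> :: "'a::euclidean_space set" and T :: real and a :: "real \<Rightarrow> 'a \<Rightarrow> real"
  assumes open_\<Omega>: "open \<Omega>" and T_pos: "T > 0" and a_Linf: "case_prod a \<in> Linf (cylinder T \<Omega>)"
begin

definition Q :: "(real \<times> 'a) set" where "Q = {0<..<T} \<times> \<Omega>"

text \<open>Some essential bound of the potential; the maximum with 0 secures nonnegativity even if
  the cylinder were null.\<close>

definition bd :: real where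
  "bd = max 0 (SOME C. AE z in cylinder T \<Omega>. \<bar>case_prod a z\<bar> \<le> C)"

text \<open>Clipping changes the zero extension of the potential on a null set only
  (\<open>pot_AE\<close>), and makes the bound hold everywhere, as \<open>heat_form\<close>
  demands.\<close>

definition pot :: "real \<times> 'a \<Rightarrow> real" where
  "pot z = max (- bd) (min bd (zext Q (case_prod a) z))"

lemma \<Omega>_sets: "\<Omega> \<in> sets borel" using open_\<Omega> by simp

lemma Q_sets: "Q \<in> sets borel"
  unfolding Q_def using open_\<Omega> by (intro borel_open open_Times) auto

lemma cylinder_Q: "cylinder T \<Omega> = restrict_space lborel Q"
  unfolding Q_def by (rule cylinder_eq[OF \<Omega>_sets])

lemma measurable_zext_Q: "f \<in> borel_measurable (cylinder T \<Omega>) \<longleftrightarrow> zext Q f \<in> borel_measurable borel"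
  for f :: "_ \<Rightarrow> 'b::euclidean_space"
  unfolding cylinder_Q using Q_sets by (simp add: borel_measurable_restrict_space_iff zext_eq)

lemma L2_zext_Q: "f \<in> L2 (cylinder T \<Omega>) \<longleftrightarrow> zext Q f \<in> L2 lborel" for f :: "_ \<Rightarrow> 'b::euclidean_space"
  unfolding cylinder_Q by (rule L2_restrict_iff[OF Q_sets])

lemma a_measurable: "zext Q (case_prod a) \<in> borel_measurable borel"
  using a_Linf measurable_zext_Q by (auto simp: Linf_def)

lemma pot_measurable: "pot \<in> borel_measurable borel"
  unfolding pot_def[abs_def] using a_measurable by measurable

lemma pot_le: "\<bar>pot z\<bar> \<le> bd"
proof -
  have "0 \<le> bd" by (simp add: bd_def)
  thus ?thesis unfolding pot_def by (auto simp: abs_le_iff)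
qed

lemma pot_AE: "AE z in lborel. pot z = zext Q (case_prod a) z"
proof -
  have "AE z in cylinder T \<Omega>. \<bar>case_prod a z\<bar> \<le> (SOME C. AE z in cylinder T \<Omega>. \<bar>case_prod a z\<bar> \<le> C)"
    by (rule someI_ex) (use a_Linf in \<open>simp add: Linf_def\<close>)
  hence "AE z in lborel. z \<in> Q \<longrightarrow> \<bar>case_prod a z\<bar> \<le> bd"
    unfolding cylinder_Q bd_def using Q_sets by (subst (asm) AE_restrict_space_iff) (auto elim: eventually_mono)
  thus ?thesis
  proof eventually_elim
    case (elim z)
    have "0 \<le> bd" by (simp add: bd_def)
    thus ?case using elim by (auto simp: pot_def zext_def)
  qed
qed

end

sublocale heat_problem \<subseteq> heat_form "dirichlet_graph \<Omega>" T pot bd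
  by (intro heat_form.intro form_graph_dirichlet heat_form_axioms.intro T_pos pot_measurable pot_le)

context heat_problem
begin

lemma mult_pot_cls:
  assumes U: "U \<in> L2 lborel"
  shows "(\<lambda>z. zext Q (case_prod a) z * U z) \<in> L2 lborel"
    and "mult pot (cls U) = cls (\<lambda>z. zext Q (case_prod a) z * U z)"
proof -
  have eq: "AE z in lborel. pot z *\<^sub>R U z = zext Q (case_prod a) z * U z"
    using pot_AE by eventually_elim simp
  have [measurable]: "zext Q (case_prod a) \<in> borel_measurable borel" "U \<in> borel_measurable borel"
    using a_measurable U by (auto simp: L2_def)
  have L: "(\<lambda>z. pot z *\<^sub>R U z) \<in> L2 lborel" by (rule mult_L2[OF pot_measurable pot_le U])
  show M: "(\<lambda>z. zext Q (case_prod a) z * U z) \<in> L2 lborel"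
    by (rule L2_cong_AE[OF L _ eq]) measurable
  show "mult pot (cls U) = cls (\<lambda>z. zext Q (case_prod a) z * U z)"
    unfolding mult_cls[OF pot_measurable pot_le U] by (rule iffD2[OF cls_eq_iff[OF L M] eq])
qed

lemma source_term:
  assumes U: "U \<in> L2 lborel" and \<phi>: "\<phi> \<in> test_fun \<Omega>" and t: "t \<in> {0..T}"
    and eq: "\<And>s x. (s, x) \<in> Q \<Longrightarrow> U (s, x) = f s x"
  shows "cls U \<bullet> J t (\<lambda>_. cls \<phi>) = (\<integral>s. (\<integral>x. f s x * \<phi> x \<partial>borel_on \<Omega>) \<partial>borel_on {0<..<t})"
  unfolding inner_J_const_cls(1)[OF U test_fun_L2(1)[OF \<phi>]]
proof (rule Bochner_Integration.integral_cong[OF refl])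
  fix s assume "s \<in> space (borel_on {0<..<t})"
  hence "s \<in> {0<..<T}" using t by auto
  thus "(\<integral>x. U (s, x) \<bullet> \<phi> x \<partial>lborel) = (\<integral>x. f s x * \<phi> x \<partial>borel_on \<Omega>)"
    by (intro integral_borel_on[symmetric] \<Omega>_sets)
       (use eq test_fun_outside_domain(1)[OF \<phi>] in \<open>auto simp: Q_def\<close>)
qed

text \<open>\<open>heat_solution\<close> keeps the gradient and potential terms under one spatial
  integral. The two pairings may be merged because for almost every time both sections are square
  integrable.\<close>

lemma form_term:
  assumes Y: "Y \<in> L2 lborel" and G: "G \<in> L2 lborel" and \<phi>: "\<phi> \<in> test_fun \<Omega>" and t: "t \<in> {0..T}"
    and eqY: "\<And>s x. (s, x) \<in> Q \<Longrightarrow> Y (s, x) = y s x" and eqG: "\<And>s x. (s, x) \<in> Q \<Longrightarrow> G (s, x) = g s x"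
  shows "cls G \<bullet> J t (\<lambda>_. cls (grad \<phi>)) + mult pot (cls Y) \<bullet> J t (\<lambda>_. cls \<phi>) =
     (\<integral>s. (\<integral>x. g s x \<bullet> grad \<phi> x + a s x * y s x * \<phi> x \<partial>borel_on \<Omega>) \<partial>borel_on {0<..<t})"
proof -
  define U where "U z = zext Q (case_prod a) z * Y z" for z
  have U: "U \<in> L2 lborel" and mU: "mult pot (cls Y) = cls U"
    using mult_pot_cls[OF Y] by (simp_all add: U_def[abs_def])
  note \<phi>L = test_fun_L2[OF \<phi>]
  note iG = inner_J_const_cls[OF G \<phi>L(2), of t] and iU = inner_J_const_cls[OF U \<phi>L(1), of t]
  have m: "G \<in> borel_measurable borel" "U \<in> borel_measurable borel" "\<phi> \<in> borel_measurable borel" "grad \<phi> \<in> borel_measurable borel"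
    using G U \<phi>L by (auto simp: L2_def)
  let ?h = "\<lambda>s. \<integral>x. G (s, x) \<bullet> grad \<phi> x + U (s, x) \<bullet> \<phi> x \<partial>lborel"
  have "(\<lambda>z. G z \<bullet> grad \<phi> (snd z) + U z \<bullet> \<phi> (snd z)) \<in> borel_measurable borel"
    by (intro borel_measurable_add borel_measurable_inner m borel_measurable_compose_snd)
  from measurable_section_integral[OF this] have hm: "?h \<in> borel_measurable borel" by simp
  have "cls G \<bullet> J t (\<lambda>_. cls (grad \<phi>)) + mult pot (cls Y) \<bullet> J t (\<lambda>_. cls \<phi>)
     = (\<integral>s. (\<integral>x. G (s, x) \<bullet> grad \<phi> x \<partial>lborel) + (\<integral>x. U (s, x) \<bullet> \<phi> x \<partial>lborel) \<partial>borel_on {0<..<t})"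
    unfolding mU iG(1) iU(1) by (rule Bochner_Integration.integral_add[OF iG(2) iU(2), symmetric])
  also have "\<dots> = (\<integral>s. ?h s \<partial>borel_on {0<..<t})"
  proof (rule integral_cong_AE)
    show "(\<lambda>s. (\<integral>x. G (s, x) \<bullet> grad \<phi> x \<partial>lborel) + (\<integral>x. U (s, x) \<bullet> \<phi> x \<partial>lborel)) \<in> borel_measurable (borel_on {0<..<t})"
      by (intro borel_measurable_add borel_measurable_integrable iG(2) iU(2))
    show "?h \<in> borel_measurable (borel_on {0<..<t})" by (rule measurable_restrict_space1) (use hm in simp)
    have "AE s in lborel. (\<integral>x. G (s, x) \<bullet> grad \<phi> x \<partial>lborel) + (\<integral>x. U (s, x) \<bullet> \<phi> x \<partial>lborel) = ?h s"
      using AE_L2_section[OF G] AE_L2_section[OF U]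
      by eventually_elim (rule Bochner_Integration.integral_add[symmetric]; intro L2_integrable_inner \<phi>L; assumption)
    thus "AE s in borel_on {0<..<t}. (\<integral>x. G (s, x) \<bullet> grad \<phi> x \<partial>lborel) + (\<integral>x. U (s, x) \<bullet> \<phi> x \<partial>lborel) = ?h s"
      by (subst AE_restrict_space_iff) auto
  qed
  also have "\<dots> = (\<integral>s. (\<integral>x. g s x \<bullet> grad \<phi> x + a s x * y s x * \<phi> x \<partial>borel_on \<Omega>) \<partial>borel_on {0<..<t})"
  proof (rule Bochner_Integration.integral_cong[OF refl])
    fix s assume "s \<in> space (borel_on {0<..<t})"
    hence "s \<in> {0<..<T}" using t by auto
    thus "?h s = (\<integral>x. g s x \<bullet> grad \<phi> x + a s x * y s x * \<phi> x \<partial>borel_on \<Omega>)"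
      by (intro integral_borel_on[symmetric] \<Omega>_sets)
         (use eqY eqG test_fun_outside_domain[OF \<phi>] in \<open>auto simp: Q_def U_def zext_def\<close>)
  qed
  finally show ?thesis .
qed

lemma inner_test_fun:
  assumes v: "v \<in> L2 lborel" and \<phi>: "\<phi> \<in> test_fun \<Omega>" and eq: "\<And>x. x \<in> \<Omega> \<Longrightarrow> v x = u x"
  shows "cls v \<bullet> cls \<phi> = (\<integral>x. u x * \<phi> x \<partial>borel_on \<Omega>)"
  unfolding inner_cls[OF v test_fun_L2(1)[OF \<phi>]]
  by (rule integral_borel_on[OF \<Omega>_sets, symmetric]) (use eq test_fun_outside_domain(1)[OF \<phi>] in auto)

text \<open>The definition tests with smooth functions only. Both sides of the identity are
  continuous in the test pair, so it extends to the closure, which is the whole graph.\<close>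

lemma heat_solution_imp_wsol:
  assumes y: "heat_solution T \<Omega> a f y0 y" and f: "zext Q (case_prod f) \<in> L2 lborel"
    and y0: "zext \<Omega> y0 \<in> L2 lborel"
  obtains G where "wsol (cls (zext Q (case_prod f))) (cls (zext \<Omega> y0)) (\<lambda>t. cls (zext \<Omega> (y t))) G"
    and "zext \<Omega> (y T) \<in> L2 lborel"
proof -
  obtain G where CL: "y \<in> C_L2 T \<Omega>" and ym: "case_prod y \<in> borel_measurable (cylinder T \<Omega>)"
    and init: "AE x in borel_on \<Omega>. y 0 x = y0 x" and G: "case_prod G \<in> L2 (cylinder T \<Omega>)"
    and H: "AE t in borel_on {0<..<T}. H10_with_grad \<Omega> (y t) (G t)"
    and weak: "\<And>\<phi> t. \<phi> \<in> test_fun \<Omega> \<Longrightarrow> t \<in> {0..T} \<Longrightarrow>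
           (\<integral>x. y t x * \<phi> x \<partial>borel_on \<Omega>) +
           (\<integral>s. (\<integral>x. G s x \<bullet> grad \<phi> x + a s x * y s x * \<phi> x \<partial>borel_on \<Omega>) \<partial>borel_on {0<..<t}) =
           (\<integral>x. y0 x * \<phi> x \<partial>borel_on \<Omega>) +
           (\<integral>s. (\<integral>x. f s x * \<phi> x \<partial>borel_on \<Omega>) \<partial>borel_on {0<..<t})"
    using y unfolding heat_solution_def by blast
  define yc where "yc t = cls (zext \<Omega> (y t))" for t
  have yL: "zext \<Omega> (y t) \<in> L2 lborel" if "t \<in> {0..T}" for t
    using CL that L2_restrict_iff[OF \<Omega>_sets, of "y t"] by (auto simp: C_L2_def)
  have nrm: "L2_norm (borel_on \<Omega>) (\<lambda>x. y s x - y t x) = norm (yc s - yc t)" if "s \<in> {0..T}" "t \<in> {0..T}" for s t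
    using L2_norm_restrict[OF \<Omega>_sets, of "\<lambda>x. y s x - y t x"] L2_diff[OF yL[OF that(1)] yL[OF that(2)]]
    by (simp add: zext_diff yc_def cls_diff[OF yL[OF that(1)] yL[OF that(2)]])
  have cyc: "continuous_on {0..T} yc"
    unfolding continuous_on_def
  proof
    fix t assume t: "t \<in> {0..T}"
    have "((\<lambda>s. L2_norm (borel_on \<Omega>) (\<lambda>x. y s x - y t x)) \<longlongrightarrow> 0) (at t within {0..T})"
      using CL t by (auto simp: C_L2_def)
    moreover have "\<forall>\<^sub>F s in at t within {0..T}. L2_norm (borel_on \<Omega>) (\<lambda>x. y s x - y t x) = norm (yc s - yc t)"
      unfolding eventually_at_filter using nrm[OF _ t] by (simp add: always_eventually)
    ultimately have "((\<lambda>s. norm (yc s - yc t)) \<longlongrightarrow> 0) (at t within {0..T})"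
      by (rule Lim_transform_eventually)
    thus "(yc \<longlongrightarrow> yc t) (at t within {0..T})"
      by (rule LIM_zero_cancel[OF tendsto_norm_zero_cancel])
  qed
  define Y where "Y = zext Q (case_prod y)"
  have Ysec: "(\<lambda>x. Y (t, x)) = (if t \<in> {0<..<T} then zext \<Omega> (y t) else (\<lambda>x. 0))" for t
    by (auto simp: Y_def zext_def Q_def)
  have YL: "Y \<in> L2 lborel"
  proof (rule L2_sectionsI)
    show "Y \<in> borel_measurable borel" unfolding Y_def by (rule iffD1[OF measurable_zext_Q ym])
    show "continuous_on {0..T} (\<lambda>t. (norm (yc t))\<^sup>2)" by (intro continuous_intros cyc)
    have "(\<integral>\<^sup>+x. ennreal ((norm (Y (t, x)))\<^sup>2) \<partial>lborel) \<le> ennreal (indicator {0..T} t *\<^sub>R (norm (yc t))\<^sup>2)" for t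
    proof (cases "t \<in> {0<..<T}")
      case True
      hence "(\<lambda>x. Y (t, x)) = zext \<Omega> (y t)" by (simp add: Ysec)
      thus ?thesis using nn_integral_cls[OF yL[of t]] True by (simp add: fun_eq_iff yc_def)
    next
      case False
      hence "(\<lambda>x. Y (t, x)) = (\<lambda>x. 0)" unfolding Ysec by (rule if_not_P)
      thus ?thesis by (simp add: fun_eq_iff)
    qed
    thus "AE t in lborel. (\<integral>\<^sup>+x. ennreal ((norm (Y (t, x)))\<^sup>2) \<partial>lborel)
        \<le> ennreal (indicator {0..T} t *\<^sub>R (norm (yc t))\<^sup>2)" by simp
  qed simp
  have ends: "AE t in lborel. t \<noteq> 0 \<and> t \<noteq> T" using AE_lborel_singleton[of 0] AE_lborel_singleton[of T] by auto
  \<comment> \<open>The given jointly measurable \<open>y\<close> and the representative chosen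
    inside \<open>J\<close> need agree only as classes; their slices coincide at almost every
    time.\<close>
  have YJ: "cls Y = J T yc"
  proof (rule slice_eqI)
    show "AE t in lborel. slice (cls Y) t = slice (J T yc) t"
      using slice_cls[OF YL] slice_J[OF cyc] ends
      by eventually_elim (auto simp: Ysec yc_def indicator_def cls_zero)
  qed
  define Gf where "Gf = zext Q (case_prod G)"
  have GL: "Gf \<in> L2 lborel" using G unfolding Gf_def L2_zext_Q .
  have "wsol (cls (zext Q (case_prod f))) (cls (zext \<Omega> y0)) yc (cls Gf)"
    unfolding wsol_def
  proof (intro conjI allI impI)
    show "continuous_on {0..T} yc" by (rule cyc)
    have "AE x in lborel. x \<in> \<Omega> \<longrightarrow> y 0 x = y0 x"
      using init \<Omega>_sets by (subst (asm) AE_restrict_space_iff) auto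
    hence "AE x in lborel. zext \<Omega> (y 0) x = zext \<Omega> y0 x"
      by eventually_elim (simp add: zext_def)
    thus "yc 0 = cls (zext \<Omega> y0)" unfolding yc_def using T_pos by (subst cls_eq_iff) (auto intro: yL y0)
    have "AE t in lborel. t \<in> {0<..<T} \<longrightarrow> H10_with_grad \<Omega> (y t) (G t)"
      using H by (subst (asm) AE_restrict_space_iff) auto
    with ends slice_cls[OF GL]
    show "AE t in lborel. t \<in> {0..T} \<longrightarrow> (yc t, slice (cls Gf) t) \<in> dirichlet_graph \<Omega>"
    proof eventually_elim
      case (elim t)
      show ?case
      proof
        assume "t \<in> {0..T}"
        hence t: "t \<in> {0<..<T}" using elim(1) by auto
        hence "(\<lambda>x. Gf (t, x)) = zext \<Omega> (G t)" by (auto simp: Gf_def zext_def Q_def)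
        thus "(yc t, slice (cls Gf) t) \<in> dirichlet_graph \<Omega>"
          using H10_imp_graph[OF \<Omega>_sets, of "y t" "G t"] elim t by (simp add: yc_def)
      qed
    qed
    fix \<phi> \<gamma> t assume V: "(\<phi>, \<gamma>) \<in> dirichlet_graph \<Omega>" and t: "t \<in> {0..T}"
    have t0: "t \<ge> 0" using t by simp
    let ?P = "{p. yc t \<bullet> fst p + cls Gf \<bullet> J t (\<lambda>_. snd p) + mult pot (J T yc) \<bullet> J t (\<lambda>_. fst p)
      = cls (zext \<Omega> y0) \<bullet> fst p + cls (zext Q (case_prod f)) \<bullet> J t (\<lambda>_. fst p)}"
    have "closed ?P"
      by (intro closed_Collect_eq continuous_intros bounded_linear.continuous_on[OF bounded_linear_J_const[OF t0]])
    moreover have "(cls \<psi>, cls (grad \<psi>)) \<in> ?P" if \<psi>: "\<psi> \<in> test_fun \<Omega>" for \<psi>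
    proof -
      have 1: "yc t \<bullet> cls \<psi> = (\<integral>x. y t x * \<psi> x \<partial>borel_on \<Omega>)"
        unfolding yc_def by (rule inner_test_fun[OF yL[OF t] \<psi>]) (simp add: zext_def)
      have 2: "cls (zext \<Omega> y0) \<bullet> cls \<psi> = (\<integral>x. y0 x * \<psi> x \<partial>borel_on \<Omega>)"
        by (rule inner_test_fun[OF y0 \<psi>]) (simp add: zext_def)
      have 3: "cls (zext Q (case_prod f)) \<bullet> J t (\<lambda>_. cls \<psi>) = (\<integral>s. (\<integral>x. f s x * \<psi> x \<partial>borel_on \<Omega>) \<partial>borel_on {0<..<t})"
        by (rule source_term[OF f \<psi> t]) (simp add: zext_def)
      have 4: "cls Gf \<bullet> J t (\<lambda>_. cls (grad \<psi>)) + mult pot (J T yc) \<bullet> J t (\<lambda>_. cls \<psi>) =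
         (\<integral>s. (\<integral>x. G s x \<bullet> grad \<psi> x + a s x * y s x * \<psi> x \<partial>borel_on \<Omega>) \<partial>borel_on {0<..<t})"
        unfolding YJ[symmetric] by (rule form_term[OF YL GL \<psi> t]) (simp_all add: Y_def Gf_def zext_def)
      show ?thesis using weak[OF \<psi> t] 4 by (simp add: 1 2 3)
    qed
    hence "(\<lambda>\<phi>. (cls \<phi>, cls (grad \<phi>))) ` test_fun \<Omega> \<subseteq> ?P" by blast
    ultimately have "dirichlet_graph \<Omega> \<subseteq> ?P" unfolding dirichlet_graph_def by (intro closure_minimal)
    with V show "yc t \<bullet> \<phi> + cls Gf \<bullet> J t (\<lambda>_. \<gamma>) + mult pot (J T yc) \<bullet> J t (\<lambda>_. \<phi>)
      = cls (zext \<Omega> y0) \<bullet> \<phi> + cls (zext Q (case_prod f)) \<bullet> J t (\<lambda>_. \<phi>)" by auto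
  qed
  thus ?thesis using that yL[of T] T_pos unfolding yc_def by simp
qed

text \<open>\<open>curve_rep\<close> is jointly measurable and has square integrable sections at
  every time of \<open>[0, T]\<close>, as \<open>C_L2\<close> requires; for the gradient,
  constrained only almost everywhere, any representative \<open>rep Gc\<close> serves.\<close>

lemma wsol_imp_heat_solution:
  assumes y: "wsol (cls (zext Q (case_prod f))) (cls (zext \<Omega> y0)) yc Gc"
    and f: "zext Q (case_prod f) \<in> L2 lborel" and y0: "zext \<Omega> y0 \<in> L2 lborel"
  shows "heat_solution T \<Omega> a f y0 (\<lambda>t x. curve_rep T yc (t, x))"
proof -
  define y where "y t x = curve_rep T yc (t, x)" for t x
  have cyc: "continuous_on {0..T} yc" and yc0: "yc 0 = cls (zext \<Omega> y0)" using y by (auto simp: wsol_def)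
  have yL: "y t \<in> L2 lborel" and ycls: "cls (y t) = yc t" if "t \<in> {0..T}" for t
    using curve_rep_section[OF cyc that] by (simp_all add: y_def[abs_def])
  have yr: "case_prod y = curve_rep T yc" by (auto simp: y_def)
  define G where "G s x = rep Gc (s, x)" for s x
  have Gr: "case_prod G = rep Gc" by (auto simp: G_def)
  show ?thesis unfolding heat_solution_def y_def[abs_def, symmetric]
  proof (intro conjI exI[of _ G] ballI)
    show "y \<in> C_L2 T \<Omega>"
      unfolding C_L2_def
    proof (intro CollectI conjI ballI)
      show "y t \<in> L2 (borel_on \<Omega>)" if "t \<in> {0..T}" for t
        unfolding L2_restrict_iff[OF \<Omega>_sets] by (rule zext_L2[OF \<Omega>_sets yL[OF that]])
      fix t assume t: "t \<in> {0..T}"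
      have le: "L2_norm (borel_on \<Omega>) (\<lambda>x. y s x - y t x) \<le> norm (yc s - yc t)" if s: "s \<in> {0..T}" for s
      proof -
        have d: "(\<lambda>x. y s x - y t x) \<in> L2 lborel" by (rule L2_diff[OF yL[OF s] yL[OF t]])
        show ?thesis
          using norm_cls_zext_le[OF \<Omega>_sets d] L2_norm_restrict[OF \<Omega>_sets zext_L2[OF \<Omega>_sets d]]
          by (simp add: cls_diff[OF yL[OF s] yL[OF t]] ycls[OF s] ycls[OF t])
      qed
      have "(yc \<longlongrightarrow> yc t) (at t within {0..T})" using cyc t by (simp add: continuous_on_def)
      hence lim: "((\<lambda>s. norm (yc s - yc t)) \<longlongrightarrow> 0) (at t within {0..T})"
        using tendsto_norm_zero[OF LIM_zero] by blast
      show "((\<lambda>s. L2_norm (borel_on \<Omega>) (\<lambda>x. y s x - y t x)) \<longlongrightarrow> 0) (at t within {0..T})"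
      proof (rule tendsto_sandwich[OF _ _ tendsto_const lim])
        show "\<forall>\<^sub>F s in at t within {0..T}. 0 \<le> L2_norm (borel_on \<Omega>) (\<lambda>x. y s x - y t x)"
          by (simp add: L2_norm_def)
        show "\<forall>\<^sub>F s in at t within {0..T}. L2_norm (borel_on \<Omega>) (\<lambda>x. y s x - y t x) \<le> norm (yc s - yc t)"
          unfolding eventually_at_filter using le by (simp add: always_eventually)
      qed
    qed
    show "case_prod y \<in> borel_measurable (cylinder T \<Omega>)"
      unfolding yr cylinder_Q by (rule measurable_restrict_space1) (use curve_rep_measurable[OF cyc] in simp)
    have 0: "0 \<in> {0..T}" using T_pos by simp
    have "AE x in lborel. y 0 x = zext \<Omega> y0 x"
      using ycls[OF 0] yc0 cls_eq_iff[OF yL[OF 0] y0] by simp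
    hence "AE x in lborel. x \<in> \<Omega> \<longrightarrow> y 0 x = y0 x" by eventually_elim (simp add: zext_def)
    thus "AE x in borel_on \<Omega>. y 0 x = y0 x" using \<Omega>_sets by (subst AE_restrict_space_iff) auto
    show "case_prod G \<in> L2 (cylinder T \<Omega>)"
      unfolding L2_zext_Q Gr by (rule zext_L2[OF Q_sets rep_L2])
    have "AE t in lborel. t \<in> {0..T} \<longrightarrow> (yc t, slice Gc t) \<in> dirichlet_graph \<Omega>"
      using y by (simp add: wsol_def)
    with slice_rep[of Gc] have "AE t in lborel. t \<in> {0<..<T} \<longrightarrow> H10_with_grad \<Omega> (y t) (G t)"
    proof eventually_elim
      case (elim t)
      show ?case
      proof
        assume "t \<in> {0<..<T}"
        hence t: "t \<in> {0..T}" by simp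
        show "H10_with_grad \<Omega> (y t) (G t)"
          using elim t by (intro graph_imp_H10[OF \<Omega>_sets yL[OF t]]) (simp_all add: G_def[abs_def] ycls)
      qed
    qed
    thus "AE t in borel_on {0<..<T}. H10_with_grad \<Omega> (y t) (G t)" by (subst AE_restrict_space_iff) auto
    fix \<phi> t assume \<phi>: "\<phi> \<in> test_fun \<Omega>" and t: "t \<in> {0..T}"
    have 1: "yc t \<bullet> cls \<phi> = (\<integral>x. y t x * \<phi> x \<partial>borel_on \<Omega>)"
      unfolding ycls[OF t, symmetric] by (rule inner_test_fun[OF yL[OF t] \<phi>]) simp
    have 2: "cls (zext \<Omega> y0) \<bullet> cls \<phi> = (\<integral>x. y0 x * \<phi> x \<partial>borel_on \<Omega>)"
      by (rule inner_test_fun[OF y0 \<phi>]) (simp add: zext_def)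
    have 3: "cls (zext Q (case_prod f)) \<bullet> J t (\<lambda>_. cls \<phi>) = (\<integral>s. (\<integral>x. f s x * \<phi> x \<partial>borel_on \<Omega>) \<partial>borel_on {0<..<t})"
      by (rule source_term[OF f \<phi> t]) (simp add: zext_def)
    have 4: "cls (rep Gc) \<bullet> J t (\<lambda>_. cls (grad \<phi>)) + mult pot (cls (curve_rep T yc)) \<bullet> J t (\<lambda>_. cls \<phi>) =
       (\<integral>s. (\<integral>x. G s x \<bullet> grad \<phi> x + a s x * y s x * \<phi> x \<partial>borel_on \<Omega>) \<partial>borel_on {0<..<t})"
      by (rule form_term[OF curve_rep_L2[OF cyc] rep_L2 \<phi> t]) (simp_all add: y_def G_def)
    have "yc t \<bullet> cls \<phi> + Gc \<bullet> J t (\<lambda>_. cls (grad \<phi>)) + mult pot (J T yc) \<bullet> J t (\<lambda>_. cls \<phi>)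
      = cls (zext \<Omega> y0) \<bullet> cls \<phi> + cls (zext Q (case_prod f)) \<bullet> J t (\<lambda>_. cls \<phi>)"
      using y test_fun_graph[OF \<phi>] t unfolding wsol_def by blast
    thus "(\<integral>x. y t x * \<phi> x \<partial>borel_on \<Omega>) +
           (\<integral>s. (\<integral>x. G s x \<bullet> grad \<phi> x + a s x * y s x * \<phi> x \<partial>borel_on \<Omega>) \<partial>borel_on {0<..<t}) =
           (\<integral>x. y0 x * \<phi> x \<partial>borel_on \<Omega>) +
           (\<integral>s. (\<integral>x. f s x * \<phi> x \<partial>borel_on \<Omega>) \<partial>borel_on {0<..<t})"
      using 4 unfolding 1 2 3 J_def[symmetric] cls_rep by simp
  qed
qed

end

section \<open>The game\<close>

text \<open>The two quadratic costs differ from the common potential \<open>f\<close> by terms that do not depend on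
  the respective player's own control, so a minimizer of \<open>f\<close> is an equilibrium.\<close>

lemma quadratic_game_equilibrium:
  fixes P1 :: "'u::{real_inner,complete_space} \<Rightarrow> 'h::real_inner" and P2 :: "'v::{real_inner,complete_space} \<Rightarrow> 'h"
  assumes P: "bounded_linear P1" "bounded_linear P2"
    and K1: "K1 \<noteq> {}" "closed K1" "convex K1" "bounded K1"
    and K2: "K2 \<noteq> {}" "closed K2" "convex K2" "bounded K2"
  shows "\<exists>u\<in>K1. \<exists>v\<in>K2.
    (\<forall>u'\<in>K1. norm (z + (P1 u + P2 v) - b1) \<le> norm (z + (P1 u' + P2 v) - b1)) \<and>
    (\<forall>v'\<in>K2. norm (z + (P1 u + P2 v) - b2) \<le> norm (z + (P1 u + P2 v') - b2))"
proof -
  interpret P1: bounded_linear P1 by fact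
  interpret P2: bounded_linear P2 by fact
  define l where "l p = P1 (fst p) \<bullet> b1 + P2 (snd p) \<bullet> b2" for p
  define A where "A p = P1 (fst p) + P2 (snd p)" for p
  define f where "f p = (norm (z + A p))\<^sup>2 / 2 - l p" for p
  have l: "bounded_linear l" unfolding l_def[abs_def]
    by (intro bounded_linear_add bounded_linear_compose[OF bounded_linear_inner_left]
        bounded_linear_compose[OF P(1)] bounded_linear_compose[OF P(2)] bounded_linear_fst bounded_linear_snd)
  have A: "bounded_linear A" unfolding A_def[abs_def]
    by (intro bounded_linear_add bounded_linear_compose[OF P(1)] bounded_linear_compose[OF P(2)] bounded_linear_fst bounded_linear_snd)
  interpret l: bounded_linear l by (rule l)
  interpret A: bounded_linear A by (rule A)
  have "\<exists>p\<in>K1 \<times> K2. \<forall>q\<in>K1 \<times> K2. f p \<le> f q"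
  proof (rule convex_continuous_attains_inf)
    show "K1 \<times> K2 \<noteq> {}" "closed (K1 \<times> K2)" "convex (K1 \<times> K2)" "bounded (K1 \<times> K2)"
      using K1 K2 by (auto intro: closed_Times convex_Times bounded_Times)
    show "continuous_on (K1 \<times> K2) f" unfolding f_def[abs_def]
      by (intro continuous_intros A.continuous_on l.continuous_on) auto
    show "convex_on (K1 \<times> K2) f"
    proof (rule convex_onI)
      show "convex (K1 \<times> K2)" using K1 K2 by (intro convex_Times)
      fix t :: real and p q :: "'u \<times> 'v" assume t: "0 < t" "t < 1"
      have sq: "(norm ((1 - t) *\<^sub>R x + t *\<^sub>R y))\<^sup>2 \<le> (1 - t) * (norm x)\<^sup>2 + t * (norm y)\<^sup>2" for x y :: 'h
      proof -
        have "(1 - t) * (norm x)\<^sup>2 + t * (norm y)\<^sup>2 - (norm ((1 - t) *\<^sub>R x + t *\<^sub>R y))\<^sup>2 = t * (1 - t) * (norm (x - y))\<^sup>2"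
          unfolding power2_norm_eq_inner
          by (simp add: inner_add_left inner_add_right inner_diff_left inner_diff_right inner_commute[of y x] algebra_simps)
        moreover have "0 \<le> t * (1 - t) * (norm (x - y))\<^sup>2" using t by simp
        ultimately show ?thesis by linarith
      qed
      have "z + A ((1 - t) *\<^sub>R p + t *\<^sub>R q) = (1 - t) *\<^sub>R (z + A p) + t *\<^sub>R (z + A q)"
        unfolding A.add A.scaleR by (simp add: scaleR_diff_left scaleR_add_right algebra_simps)
      hence "(norm (z + A ((1 - t) *\<^sub>R p + t *\<^sub>R q)))\<^sup>2 \<le> (1 - t) * (norm (z + A p))\<^sup>2 + t * (norm (z + A q))\<^sup>2"
        using sq[of "z + A p" "z + A q"] by simp
      moreover have "l ((1 - t) *\<^sub>R p + t *\<^sub>R q) = (1 - t) * l p + t * l q" by (simp add: l.add l.scaleR)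
      ultimately show "f ((1 - t) *\<^sub>R p + t *\<^sub>R q) \<le> (1 - t) * f p + t * f q"
        by (simp add: f_def right_diff_distrib)
    qed
    have "bounded (l ` (K1 \<times> K2))" using K1 K2 by (intro bounded_linear_image l bounded_Times)
    then obtain b where b: "\<And>p. p \<in> K1 \<times> K2 \<Longrightarrow> norm (l p) \<le> b" by (auto simp: bounded_iff)
    show "bdd_below (f ` (K1 \<times> K2))"
    proof (rule bdd_belowI2)
      fix p assume "p \<in> K1 \<times> K2"
      hence "l p \<le> b" using b[of p] by simp
      moreover have "0 \<le> (norm (z + A p))\<^sup>2 / 2" by simp
      ultimately show "- b \<le> f p" unfolding f_def by linarith
    qed
  qed
  then obtain u v where uv: "u \<in> K1" "v \<in> K2" and min: "\<And>u' v'. u' \<in> K1 \<Longrightarrow> v' \<in> K2 \<Longrightarrow> f (u, v) \<le> f (u', v')"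
    by auto
  have sq: "(norm (x - b))\<^sup>2 = (norm x)\<^sup>2 - 2 * (x \<bullet> b) + (norm b)\<^sup>2" for x b :: 'h
    unfolding power2_norm_eq_inner by (simp add: inner_diff_left inner_diff_right inner_commute[of b x])
  have f1: "(norm (z + (P1 u' + P2 v') - b1))\<^sup>2 = 2 * f (u', v') + (2 * (P2 v' \<bullet> (b2 - b1)) - 2 * (z \<bullet> b1) + (norm b1)\<^sup>2)" for u' v'
    unfolding sq by (simp add: f_def A_def l_def inner_add_left inner_diff_right)
  have f2: "(norm (z + (P1 u' + P2 v') - b2))\<^sup>2 = 2 * f (u', v') + (2 * (P1 u' \<bullet> (b1 - b2)) - 2 * (z \<bullet> b2) + (norm b2)\<^sup>2)" for u' v'
    unfolding sq by (simp add: f_def A_def l_def inner_add_left inner_diff_right)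
  have "norm (z + (P1 u + P2 v) - b1) \<le> norm (z + (P1 u' + P2 v) - b1)" if "u' \<in> K1" for u'
    by (rule power2_le_imp_le) (use min[OF that uv(2)] f1[of u v] f1[of u' v] in simp_all)
  moreover have "norm (z + (P1 u + P2 v) - b2) \<le> norm (z + (P1 u + P2 v') - b2)" if "v' \<in> K2" for v'
    by (rule power2_le_imp_le) (use min[OF uv(1) that] f2[of u v] f2[of u v'] in simp_all)
  ultimately show ?thesis using uv by blast
qed

section \<open>Admissible controls as space-time classes, and the equilibrium\<close>

context heat_problem
begin

text \<open>The classes of admissible controls; being fixed by multiplication with the indicator of
  \<open>Q\<close> encodes vanishing almost everywhere off the cylinder.\<close>

definition ctrl :: "real \<Rightarrow> (real \<times> 'a, real) l2 set" where
  "ctrl M = {U. mult (indicator Q) U = U \<and> (AE t in lborel. norm (slice U t) \<le> M)}"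

lemma ind_Q: "(indicator Q :: _ \<Rightarrow> real) \<in> borel_measurable borel" "\<bar>indicator Q z :: real\<bar> \<le> 1"
  using Q_sets by (auto simp: indicator_def)

lemma linear_ind_Q: "bounded_linear (mult (indicator Q) :: (real \<times> 'a, real) l2 \<Rightarrow> _)"
  by (rule bounded_linear_mult[OF ind_Q])

lemma mult_ind_Q: "mult (indicator Q) U = cls (zext Q (rep U))" for U :: "(real \<times> 'a, real) l2"
  unfolding mult_def zext_eq ..

lemma convex_ctrl: "convex (ctrl M)"
proof (rule convexI)
  fix U V and u v :: real
  assume U: "U \<in> ctrl M" and V: "V \<in> ctrl M" and uv: "0 \<le> u" "0 \<le> v" "u + v = 1"
  note lin = bounded_linear.linear[OF linear_ind_Q]
  have "mult (indicator Q) (u *\<^sub>R U + v *\<^sub>R V) = u *\<^sub>R U + v *\<^sub>R V"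
    using U V by (simp add: linear_add[OF lin] linear_scale[OF lin] ctrl_def)
  moreover have "AE t in lborel. norm (slice (u *\<^sub>R U + v *\<^sub>R V) t) \<le> M"
  proof -
    have "AE t in lborel. norm (slice U t) \<le> M" "AE t in lborel. norm (slice V t) \<le> M"
      using U V by (auto simp: ctrl_def)
    with slice_add[of "u *\<^sub>R U" "v *\<^sub>R V"] slice_scaleR[of u U] slice_scaleR[of v V] show ?thesis
    proof eventually_elim
      case (elim t)
      have "norm (slice (u *\<^sub>R U + v *\<^sub>R V) t) \<le> u * norm (slice U t) + v * norm (slice V t)"
        unfolding elim(1,2,3) using uv by (intro order_trans[OF norm_triangle_ineq]) simp
      also have "\<dots> \<le> M" by (rule convex_bound_le) (use elim uv in auto)
      finally show ?case .
    qed
  qed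
  ultimately show "u *\<^sub>R U + v *\<^sub>R V \<in> ctrl M" by (simp add: ctrl_def)
qed

text \<open>The bound at almost every time is not a norm condition on the class, so it passes to the
  limit through a subsequence whose slices converge almost everywhere.\<close>

lemma closed_ctrl: "closed (ctrl M)"
  unfolding closed_sequential_limits
proof (intro allI impI, elim conjE)
  fix X U assume X: "\<forall>n. X n \<in> ctrl M" and lim: "X \<longlonglongrightarrow> U"
  have "(\<lambda>n. mult (indicator Q) (X n)) \<longlonglongrightarrow> mult (indicator Q) U"
    by (rule bounded_linear.tendsto[OF linear_ind_Q lim])
  moreover have "mult (indicator Q) (X n) = X n" for n using X by (simp add: ctrl_def)
  ultimately have "X \<longlonglongrightarrow> mult (indicator Q) U" by simp
  hence "mult (indicator Q) U = U" using lim by (rule LIMSEQ_unique)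
  moreover obtain r where r: "AE t in lborel. (\<lambda>n. slice (X (r n)) t) \<longlonglongrightarrow> slice U t"
    using slice_LIMSEQ_subseq[OF lim] by blast
  have "AE t in lborel. norm (slice (X (r n)) t) \<le> M" for n using X by (simp add: ctrl_def)
  hence "AE t in lborel. \<forall>n. norm (slice (X (r n)) t) \<le> M" by (simp add: AE_all_countable)
  with r have "AE t in lborel. norm (slice U t) \<le> M"
  proof eventually_elim
    case (elim t)
    show ?case by (rule LIMSEQ_le_const2[OF tendsto_norm[OF elim(1)]]) (use elim(2) in auto)
  qed
  ultimately show "U \<in> ctrl M" by (simp add: ctrl_def)
qed

lemma bounded_ctrl: "bounded (ctrl M)"
proof -
  have "norm U \<le> sqrt (T * M\<^sup>2)" if U: "U \<in> ctrl M" for U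
  proof (rule real_le_rsqrt)
    have "U = cls (zext Q (rep U))" using U mult_ind_Q by (simp add: ctrl_def)
    hence "AE t in lborel. slice U t = cls (\<lambda>x. zext Q (rep U) (t, x))"
      using slice_cls[OF zext_L2[OF Q_sets rep_L2[of U]]] by simp
    moreover have "AE t in lborel. norm (slice U t) \<le> M" using U by (simp add: ctrl_def)
    ultimately have le: "AE t in lborel. (norm (slice U t))\<^sup>2 \<le> indicator {0..T} t *\<^sub>R M\<^sup>2"
    proof eventually_elim
      case (elim t)
      show ?case
      proof (cases "t \<in> {0..T}")
        case False
        hence "(\<lambda>x. zext Q (rep U) (t, x)) = (\<lambda>x. 0)" by (auto simp: zext_def Q_def)
        thus ?thesis using elim(1) False by (simp add: cls_zero)
      qed (use elim(2) in \<open>simp add: power_mono\<close>)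
    qed
    have "(norm U)\<^sup>2 \<le> (\<integral>t. indicator {0..T} t *\<^sub>R M\<^sup>2 \<partial>lborel)"
      unfolding norm_slice
    proof (rule integral_mono_AE[OF integrable_norm_slice _ le])
      show "integrable lborel (\<lambda>t. indicator {0..T} t *\<^sub>R M\<^sup>2)"
        by (rule borel_integrable_compact[OF compact_Icc]) simp
    qed
    also have "\<dots> = T * M\<^sup>2" using T_pos by simp
    finally show "(norm U)\<^sup>2 \<le> T * M\<^sup>2" .
  qed
  thus ?thesis by (auto simp: bounded_iff)
qed

lemma zero_ctrl: "M \<ge> 0 \<Longrightarrow> 0 \<in> ctrl M"
proof -
  assume M: "M \<ge> 0"
  have "AE t in lborel. slice (0 :: (real \<times> 'a, real) l2) t = 0"
    using slice_scaleR[of 0 "0 :: (real \<times> 'a, real) l2"] by simp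
  hence "AE t in lborel. norm (slice (0 :: (real \<times> 'a, real) l2) t) \<le> M"
    by eventually_elim (simp add: M)
  thus ?thesis using linear_0[OF bounded_linear.linear[OF linear_ind_Q]] by (simp add: ctrl_def)
qed

text \<open>Outside \<open>(0, T)\<close> the extended control has slices 0, where
  \<open>M \<ge> 0\<close> gives the bound; inside, the bound transfers section by section.\<close>

lemma admissible_imp_ctrl:
  assumes u: "u \<in> admissible T \<Omega> M" and M: "M \<ge> 0"
  shows "zext Q (case_prod u) \<in> L2 lborel" "cls (zext Q (case_prod u)) \<in> ctrl M"
proof -
  let ?U = "zext Q (case_prod u)"
  have um: "case_prod u \<in> borel_measurable (cylinder T \<Omega>)"
    and uL: "AE t in borel_on {0<..<T}. u t \<in> L2 (borel_on \<Omega>)"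
    and uM: "AE t in borel_on {0<..<T}. L2_norm (borel_on \<Omega>) (u t) \<le> M"
    using u by (auto simp: admissible_def Linf_L2_def)
  have sec: "(\<lambda>x. ?U (t, x)) = (if t \<in> {0<..<T} then zext \<Omega> (u t) else (\<lambda>x. 0))" for t
    by (auto simp: zext_def Q_def)
  have "{0<..<T} \<inter> space lborel \<in> sets lborel" by simp
  note uL[unfolded AE_restrict_space_iff[OF this]] uM[unfolded AE_restrict_space_iff[OF this]]
  hence good: "AE t in lborel. t \<in> {0<..<T} \<longrightarrow> zext \<Omega> (u t) \<in> L2 lborel \<and> norm (cls (zext \<Omega> (u t))) \<le> M"
    by eventually_elim (simp add: L2_restrict_iff[OF \<Omega>_sets] L2_norm_restrict[OF \<Omega>_sets])
  have Um: "?U \<in> borel_measurable borel" by (rule iffD1[OF measurable_zext_Q um])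
  show UL: "?U \<in> L2 lborel"
  proof (rule L2_sectionsI[OF Um])
    show "continuous_on {0..T} (\<lambda>t. M\<^sup>2)" by simp
    show "AE t in lborel. (\<integral>\<^sup>+x. ennreal ((norm (?U (t, x)))\<^sup>2) \<partial>lborel) \<le> ennreal (indicator {0..T} t *\<^sub>R M\<^sup>2)"
      using good
    proof eventually_elim
      case (elim t)
      show ?case
      proof (cases "t \<in> {0<..<T}")
        case True
        hence eq: "?U (t, x) = zext \<Omega> (u t) x" for x using sec[of t] by (simp add: fun_eq_iff)
        have "(\<integral>\<^sup>+x. ennreal ((norm (?U (t, x)))\<^sup>2) \<partial>lborel) = ennreal ((norm (cls (zext \<Omega> (u t))))\<^sup>2)"
          unfolding eq by (rule nn_integral_cls) (use elim True in simp)
        also have "\<dots> \<le> ennreal (M\<^sup>2)" using elim True by (intro ennreal_leI power_mono) auto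
        finally show ?thesis using True by simp
      next
        case False
        hence "?U (t, x) = 0" for x using sec[of t] by (auto simp: fun_eq_iff)
        thus ?thesis by simp
      qed
    qed
  qed simp
  have "mult (indicator Q) (cls ?U) = cls ?U"
    unfolding mult_cls[OF ind_Q UL] by (rule arg_cong[where f=cls]) (auto simp: zext_def indicator_def)
  moreover have "AE t in lborel. norm (slice (cls ?U) t) \<le> M"
    using slice_cls[OF UL] good by eventually_elim (auto simp: sec cls_zero M)
  ultimately show "cls ?U \<in> ctrl M" by (simp add: ctrl_def)
qed

lemma ctrl_imp_admissible:
  assumes U: "U \<in> ctrl M"
  obtains u where "u \<in> admissible T \<Omega> M" "cls (zext Q (case_prod u)) = U"
proof
  define u where "u t x = rep U (t, x)" for t x
  have ur: "case_prod u = rep U" by (auto simp: u_def)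
  show "cls (zext Q (case_prod u)) = U" using U mult_ind_Q by (simp add: ur ctrl_def)
  have "AE t in lborel. norm (slice U t) \<le> M" using U by (simp add: ctrl_def)
  with slice_rep[of U] have "AE t in lborel. u t \<in> L2 (borel_on \<Omega>) \<and> L2_norm (borel_on \<Omega>) (u t) \<le> M"
  proof eventually_elim
    case (elim t)
    have t: "u t \<in> L2 lborel" and s: "slice U t = cls (u t)" using elim by (simp_all add: u_def[abs_def])
    note z = zext_L2[OF \<Omega>_sets t]
    have "L2_norm (borel_on \<Omega>) (u t) \<le> norm (cls (u t))"
      unfolding L2_norm_restrict[OF \<Omega>_sets z] by (rule norm_cls_zext_le[OF \<Omega>_sets t])
    thus ?case using z elim s by (simp add: L2_restrict_iff[OF \<Omega>_sets])
  qed
  hence "AE t in borel_on {0<..<T}. u t \<in> L2 (borel_on \<Omega>)" "AE t in borel_on {0<..<T}. L2_norm (borel_on \<Omega>) (u t) \<le> M"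
    by (subst AE_restrict_space_iff; auto elim: eventually_mono)+
  moreover have "case_prod u \<in> borel_measurable (cylinder T \<Omega>)"
    unfolding ur cylinder_Q by (rule measurable_restrict_space1) simp
  ultimately show "u \<in> admissible T \<Omega> M" by (auto simp: admissible_def Linf_L2_def)
qed

lemma nash_equilibrium:
  assumes \<omega>: "open \<omega>1" "open \<omega>2" and y0: "y0 \<in> L2 (borel_on \<Omega>)" and y1: "y1 \<in> L2 (borel_on \<Omega>)"
    and y2: "y2 \<in> L2 (borel_on \<Omega>)" and M: "M1 > 0" "M2 > 0"
  shows "\<exists>u1s\<in>admissible T \<Omega> M1. \<exists>u2s\<in>admissible T \<Omega> M2.
    (\<forall>u1\<in>admissible T \<Omega> M1.
       cost T \<Omega> \<omega>1 \<omega>2 a y0 y1 u1s u2s \<le> cost T \<Omega> \<omega>1 \<omega>2 a y0 y1 u1 u2s) \<and>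
    (\<forall>u2\<in>admissible T \<Omega> M2.
       cost T \<Omega> \<omega>1 \<omega>2 a y0 y2 u1s u2s \<le> cost T \<Omega> \<omega>1 \<omega>2 a y0 y2 u1s u2)"
proof -
  let ?\<chi> = "\<lambda>\<omega> z. indicator \<omega> (snd z) :: real"
  let ?f = "\<lambda>u1 u2 t x. indicator \<omega>1 x * u1 t x + indicator \<omega>2 x * u2 t x :: real"
  have M0: "M1 \<ge> 0" "M2 \<ge> 0" using M by auto
  have zL: "zext \<Omega> v \<in> L2 lborel" if "v \<in> L2 (borel_on \<Omega>)" for v :: "'a \<Rightarrow> real"
    using that L2_restrict_iff[OF \<Omega>_sets] by blast
  have \<chi>: "(\<lambda>z::real \<times> 'a. ?\<chi> \<omega> z) \<in> borel_measurable borel" "\<bar>?\<chi> \<omega> z\<bar> \<le> 1"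
    if "open \<omega>" for \<omega> :: "'a set" and z :: "real \<times> 'a"
  proof -
    have "indicator \<omega> \<in> borel_measurable (borel :: 'a measure)" using that by simp
    thus "(\<lambda>z::real \<times> 'a. ?\<chi> \<omega> z) \<in> borel_measurable borel" by (rule borel_measurable_compose_snd)
    show "\<bar>?\<chi> \<omega> z\<bar> \<le> 1" by (simp add: indicator_def)
  qed
  have blX: "bounded_linear (mult (?\<chi> \<omega>) :: (real \<times> 'a, real) l2 \<Rightarrow> _)" if "open \<omega>" for \<omega> :: "'a set"
    by (rule bounded_linear_mult[OF \<chi>[OF that]])
  have data: "zext Q (case_prod (?f u1 u2)) \<in> L2 lborel"
    "cls (zext Q (case_prod (?f u1 u2))) = mult (?\<chi> \<omega>1) (cls (zext Q (case_prod u1))) + mult (?\<chi> \<omega>2) (cls (zext Q (case_prod u2)))"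
    if u: "u1 \<in> admissible T \<Omega> M1" "u2 \<in> admissible T \<Omega> M2" for u1 u2
  proof -
    note L1 = mult_L2[OF \<chi>[OF \<omega>(1)] admissible_imp_ctrl(1)[OF u(1) M0(1)]]
      and L2 = mult_L2[OF \<chi>[OF \<omega>(2)] admissible_imp_ctrl(1)[OF u(2) M0(2)]]
    have eq: "zext Q (case_prod (?f u1 u2)) = (\<lambda>z. ?\<chi> \<omega>1 z *\<^sub>R zext Q (case_prod u1) z + ?\<chi> \<omega>2 z *\<^sub>R zext Q (case_prod u2) z)"
      by (auto simp: zext_def)
    show "zext Q (case_prod (?f u1 u2)) \<in> L2 lborel" unfolding eq by (rule L2_add[OF L1 L2])
    show "cls (zext Q (case_prod (?f u1 u2))) = mult (?\<chi> \<omega>1) (cls (zext Q (case_prod u1))) + mult (?\<chi> \<omega>2) (cls (zext Q (case_prod u2)))"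
      unfolding eq cls_add[OF L1 L2] mult_cls[OF \<chi>[OF \<omega>(1)] admissible_imp_ctrl(1)[OF u(1) M0(1)]]
        mult_cls[OF \<chi>[OF \<omega>(2)] admissible_imp_ctrl(1)[OF u(2) M0(2)]] ..
  qed
  show ?thesis
  proof (cases "cls (zext \<Omega> y0) \<in> Hb")
    case True
    then obtain L z where L: "bounded_linear L" and ex: "\<And>F. \<exists>y G. wsol F (cls (zext \<Omega> y0)) y G"
      and endpoint: "\<And>F y G. wsol F (cls (zext \<Omega> y0)) y G \<Longrightarrow> y T = z + L F"
      using endpoint_affine by blast
    define P where "P \<omega> U = L (mult (?\<chi> \<omega>) U)" for \<omega> U
    have P: "bounded_linear (P \<omega>)" if "open \<omega>" for \<omega>
      unfolding P_def[abs_def] by (rule bounded_linear_compose[OF L blX[OF that]])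
    \<comment> \<open>The choice made by \<open>SOME\<close> does not matter: every solution has the
      same endpoint class by \<open>endpoint_affine\<close>, and the cost depends on that class
      only.\<close>
    have cost: "cost T \<Omega> \<omega>1 \<omega>2 a y0 yd u1 u2 =
        norm (z + (P \<omega>1 (cls (zext Q (case_prod u1))) + P \<omega>2 (cls (zext Q (case_prod u2)))) - cls (zext \<Omega> yd))"
      if u: "u1 \<in> admissible T \<Omega> M1" "u2 \<in> admissible T \<Omega> M2" and yd: "yd \<in> L2 (borel_on \<Omega>)" for u1 u2 yd
    proof -
      define y where "y = heat_state T \<Omega> \<omega>1 \<omega>2 a y0 u1 u2"
      have "\<exists>y. heat_solution T \<Omega> a (?f u1 u2) y0 y"
        using ex wsol_imp_heat_solution[OF _ data(1)[OF u] zL[OF y0]] by blast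
      hence "heat_solution T \<Omega> a (?f u1 u2) y0 y"
        unfolding y_def heat_state_def by (rule someI_ex)
      from heat_solution_imp_wsol[OF this data(1)[OF u] zL[OF y0]]
      obtain G where G: "wsol (cls (zext Q (case_prod (?f u1 u2)))) (cls (zext \<Omega> y0)) (\<lambda>t. cls (zext \<Omega> (y t))) G"
        and yT: "zext \<Omega> (y T) \<in> L2 lborel" by blast
      have "cls (zext \<Omega> (y T)) = z + (P \<omega>1 (cls (zext Q (case_prod u1))) + P \<omega>2 (cls (zext Q (case_prod u2))))"
        using endpoint[OF G] unfolding data(2)[OF u] P_def linear_add[OF bounded_linear.linear[OF L]] .
      moreover have "cost T \<Omega> \<omega>1 \<omega>2 a y0 yd u1 u2 = norm (cls (zext \<Omega> (y T)) - cls (zext \<Omega> yd))"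
        using L2_norm_restrict[OF \<Omega>_sets, of "\<lambda>x. y T x - yd x"] L2_diff[OF yT zL[OF yd]]
        by (simp add: cost_def y_def[symmetric] zext_diff cls_diff[OF yT zL[OF yd]])
      ultimately show ?thesis by simp
    qed
    have ne: "ctrl M1 \<noteq> {}" "ctrl M2 \<noteq> {}" using zero_ctrl M0 by blast+
    obtain U V where UV: "U \<in> ctrl M1" "V \<in> ctrl M2"
      and eqU: "\<And>U'. U' \<in> ctrl M1 \<Longrightarrow> norm (z + (P \<omega>1 U + P \<omega>2 V) - cls (zext \<Omega> y1)) \<le> norm (z + (P \<omega>1 U' + P \<omega>2 V) - cls (zext \<Omega> y1))"
      and eqV: "\<And>V'. V' \<in> ctrl M2 \<Longrightarrow> norm (z + (P \<omega>1 U + P \<omega>2 V) - cls (zext \<Omega> y2)) \<le> norm (z + (P \<omega>1 U + P \<omega>2 V') - cls (zext \<Omega> y2))"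
      using quadratic_game_equilibrium[OF P[OF \<omega>(1)] P[OF \<omega>(2)] ne(1) closed_ctrl convex_ctrl bounded_ctrl
          ne(2) closed_ctrl convex_ctrl bounded_ctrl, of z "cls (zext \<Omega> y1)" "cls (zext \<Omega> y2)"] by blast
    obtain u where u: "u \<in> admissible T \<Omega> M1" "cls (zext Q (case_prod u)) = U"
      using ctrl_imp_admissible[OF UV(1)] by blast
    obtain v where v: "v \<in> admissible T \<Omega> M2" "cls (zext Q (case_prod v)) = V"
      using ctrl_imp_admissible[OF UV(2)] by blast
    show ?thesis
    proof (intro bexI[OF _ u(1)] bexI[OF _ v(1)] conjI ballI)
      fix u' assume u': "u' \<in> admissible T \<Omega> M1"
      show "cost T \<Omega> \<omega>1 \<omega>2 a y0 y1 u v \<le> cost T \<Omega> \<omega>1 \<omega>2 a y0 y1 u' v"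
        unfolding cost[OF u(1) v(1) y1] cost[OF u' v(1) y1] u(2) v(2)
        by (rule eqU[OF admissible_imp_ctrl(2)[OF u' M0(1)]])
    next
      fix v' assume v': "v' \<in> admissible T \<Omega> M2"
      show "cost T \<Omega> \<omega>1 \<omega>2 a y0 y2 u v \<le> cost T \<Omega> \<omega>1 \<omega>2 a y0 y2 u v'"
        unfolding cost[OF u(1) v(1) y2] cost[OF u(1) v' y2] u(2) v(2)
        by (rule eqV[OF admissible_imp_ctrl(2)[OF v' M0(2)]])
    qed
  next
    case False
    have no: "\<not> heat_solution T \<Omega> a (?f u1 u2) y0 y"
      if u: "u1 \<in> admissible T \<Omega> M1" "u2 \<in> admissible T \<Omega> M2" for u1 u2 y
    proof
      assume "heat_solution T \<Omega> a (?f u1 u2) y0 y"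
      from heat_solution_imp_wsol[OF this data(1)[OF u] zL[OF y0]]
      obtain G where G: "wsol (cls (zext Q (case_prod (?f u1 u2)))) (cls (zext \<Omega> y0)) (\<lambda>t. cls (zext \<Omega> (y t))) G" by blast
      have "cls (zext \<Omega> (y 0)) \<in> Hb" by (rule wsol_in_Hb[OF G]) (use T_pos in simp)
      moreover have "cls (zext \<Omega> (y 0)) = cls (zext \<Omega> y0)" using G by (simp add: wsol_def)
      ultimately show False using False by simp
    qed
    \<comment> \<open>With no solution for any admissible pair, \<open>SOME\<close> is applied to
      the constantly false predicate and returns the same function for all controls, so the cost
      depends on the target alone.\<close>
    have const: "cost T \<Omega> \<omega>1 \<omega>2 a y0 yd u1 u2 = L2_norm (borel_on \<Omega>) (\<lambda>x. (SOME y. False) T x - yd x)"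
      if u: "u1 \<in> admissible T \<Omega> M1" "u2 \<in> admissible T \<Omega> M2" for u1 u2 yd
      using no[OF u] by (simp add: cost_def heat_state_def)
    obtain u where u: "u \<in> admissible T \<Omega> M1" using ctrl_imp_admissible[OF zero_ctrl[OF M0(1)]] by blast
    obtain v where v: "v \<in> admissible T \<Omega> M2" using ctrl_imp_admissible[OF zero_ctrl[OF M0(2)]] by blast
    show ?thesis
      by (intro bexI[OF _ u] bexI[OF _ v] conjI ballI) (simp_all add: const u v)
  qed
qed

end

theorem theorem1p1:
  fixes \<Omega> \<omega>1 \<omega>2 :: "'a::euclidean_space set"
    and T M1 M2 :: real
    and a :: "real \<Rightarrow> 'a \<Rightarrow> real"
    and y0 y1 y2 :: "'a \<Rightarrow> real"
  assumes "open \<Omega>" "connected \<Omega>" "\<Omega> \<noteq> {}" "bounded \<Omega>" "C2_boundary \<Omega>"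
    and "T > 0"
    and "open \<omega>1" "\<omega>1 \<noteq> {}" "\<omega>1 \<subseteq> \<Omega>"
    and "open \<omega>2" "\<omega>2 \<noteq> {}" "\<omega>2 \<subseteq> \<Omega>"
    and "\<omega>1 \<inter> \<omega>2 = {}"
    and "case_prod a \<in> Linf (cylinder T \<Omega>)"
    and "y0 \<in> L2 (borel_on \<Omega>)"
    and "y1 \<in> L2 (borel_on \<Omega>)" "y2 \<in> L2 (borel_on \<Omega>)"
    and "\<not> (AE x in borel_on \<Omega>. y1 x = y2 x)"
    and "M1 > 0" "M2 > 0"
  shows "\<exists>u1s\<in>admissible T \<Omega> M1. \<exists>u2s\<in>admissible T \<Omega> M2.
    (\<forall>u1\<in>admissible T \<Omega> M1.
       cost T \<Omega> \<omega>1 \<omega>2 a y0 y1 u1s u2s \<le> cost T \<Omega> \<omega>1 \<omega>2 a y0 y1 u1 u2s) \<and>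
    (\<forall>u2\<in>admissible T \<Omega> M2.
       cost T \<Omega> \<omega>1 \<omega>2 a y0 y2 u1s u2s \<le> cost T \<Omega> \<omega>1 \<omega>2 a y0 y2 u1s u2)"
proof -
  interpret heat_problem \<Omega> T a by (rule heat_problem.intro; fact)
  show ?thesis by (rule nash_equilibrium; fact)
qed

end
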